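(* Let $X$ be a finite 2-covered graph of spaces such that its horizontal subgraph is a disjoint union $\Gamma(X)=\Gamma_\infty\sqcup r_1\sqcup\dots\sqcup r_m$, where $\Gamma_\infty$ is a connected graph which is not homeomorphic to a circle and each $r_i$ is homeomorphic to a circle, and such that the realization of $X$ is obtained from $\Gamma(X)$ by attaching, for each $i$, the mapping cylinder $M_i$ of a $k_i$-fold covering $S^1\to r_i$ ($k_i\ge2$) along an immersion $S^1\looparrowright\Gamma_\infty$ representing the conjugacy class of an element $\gamma_i\in\pi_1(\Gamma_\infty)$, where the $M_i$ are exactly the unions of the 2-cells (products of edges of edge spaces with the interval) of $X$. Suppose $\gamma_1,\dots,\gamma_m$ are indivisible in the free group $\pi_1(\Gamma_\infty)$, pairwise non-conjugate, and $\gamma_i$ is not conjugate to $\gamma_j^{-1}$ for $i\ne j$. If $\chi(\Gamma(X))=\chi(\Gamma_U(X))$, then every edge space of $X$ is a tree.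
   Context: A 2-covered graph of spaces $X$ consists of: a finite connected graph $\Gamma_U(X)$ (the underlying graph), with oriented edges $e$, reversal $\bar e$, and terminal/initial vertices $\tau(e),\iota(e)=\tau(\bar e)$; for each vertex $v$ a finite connected graph $V$ (vertex space); for each edge $e$ a finite connected graph $E=\bar E$ (edge space, possibly a single point); and for each oriented edge $e$ a combinatorial immersion (locally injective graph map) $\tau_e\colon E\looparrowright V$ where $v=\tau(e)$; subject to the 2-covering condition: for each vertex $v$, every edge of $V$ is the image of exactly two edges of $\bigsqcup_{\tau(e)=v}E$. The realization of $X$ is $\bigsqcup V\sqcup\bigsqcup_e (E\times[0,1])$ with $E\times\{1\}$ glued via $\tau_e$ and $E\times\{0\}$ glued via $\tau_{\bar e}$. The horizontal subgraph $\Gamma(X)$ is the graph whose vertices are the vertices of all vertex spaces and with one edge $x\times[0,1]$ for each edge $e$ of $\Gamma_U(X)$ and each vertex $x$ of $E$, joining $\tau_{\bar e}(x)$ to $\tau_e(x)$ (it need not be connected). An element $g$ of a group is indivisible if $h^k=g$ implies $k=\pm1$. $\chi$ denotes Euler characteristic. *)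

theory Defs
  imports "HOL-Analysis.Analysis"
begin

record ('v, 'e) sgraph =
  verts :: "'v set"
  edges :: "'e set"
  rv    :: "'e \<Rightarrow> 'e"
  tgt   :: "'e \<Rightarrow> 'v"

definition src :: "('v, 'e) sgraph \<Rightarrow> 'e \<Rightarrow> 'v" where
  "src G e = tgt G (rv G e)"

definition wf_graph :: "('v, 'e) sgraph \<Rightarrow> bool" where
  "wf_graph G \<longleftrightarrow> finite (verts G) \<and> finite (edges G) \<and>
     (\<forall>e\<in>edges G. rv G e \<in> edges G \<and> rv G e \<noteq> e \<and> rv G (rv G e) = e \<and> tgt G e \<in> verts G)"

definition connected_graph :: "('v, 'e) sgraph \<Rightarrow> bool" where
  "connected_graph G \<longleftrightarrow> verts G \<noteq> {} \<and>
     (\<forall>x\<in>verts G. \<forall>y\<in>verts G.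
        (\<lambda>a b. \<exists>e\<in>edges G. src G e = a \<and> tgt G e = b)\<^sup>*\<^sup>* x y)"

definition reduced_circuit :: "('v, 'e) sgraph \<Rightarrow> 'e list \<Rightarrow> bool" where
  "reduced_circuit G es \<longleftrightarrow> es \<noteq> [] \<and> set es \<subseteq> edges G \<and>
     (\<forall>i. Suc i < length es \<longrightarrow> tgt G (es ! i) = src G (es ! Suc i)
                              \<and> es ! Suc i \<noteq> rv G (es ! i)) \<and>
     tgt G (last es) = src G (hd es)"

definition is_tree :: "('v, 'e) sgraph \<Rightarrow> bool" where
  "is_tree G \<longleftrightarrow> connected_graph G \<and> \<not> (\<exists>es. reduced_circuit G es)"

text \<open>Euler characteristic: vertices minus unoriented edges.\<close>

definition chi :: "('v, 'e) sgraph \<Rightarrow> int" where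
  "chi G = int (card (verts G)) - int (card (edges G)) div 2"

definition graph_map :: "('v, 'e) sgraph \<Rightarrow> ('w, 'f) sgraph \<Rightarrow> ('v \<Rightarrow> 'w) \<Rightarrow> ('e \<Rightarrow> 'f) \<Rightarrow> bool" where
  "graph_map G H fv fe \<longleftrightarrow> fv ` verts G \<subseteq> verts H \<and> fe ` edges G \<subseteq> edges H \<and>
     (\<forall>e\<in>edges G. fe (rv G e) = rv H (fe e) \<and> fv (tgt G e) = tgt H (fe e))"

definition immersion :: "('v, 'e) sgraph \<Rightarrow> ('w, 'f) sgraph \<Rightarrow> ('v \<Rightarrow> 'w) \<Rightarrow> ('e \<Rightarrow> 'f) \<Rightarrow> bool" where
  "immersion G H fv fe \<longleftrightarrow> graph_map G H fv fe \<and>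
     (\<forall>x\<in>verts G. inj_on fe {e\<in>edges G. tgt G e = x})"

definition is_subgraph :: "('v, 'e) sgraph \<Rightarrow> 'v set \<Rightarrow> 'e set \<Rightarrow> bool" where
  "is_subgraph G Vs Es \<longleftrightarrow> Vs \<subseteq> verts G \<and> Es \<subseteq> edges G \<and>
     (\<forall>e\<in>Es. rv G e \<in> Es \<and> tgt G e \<in> Vs)"

definition subg :: "('v, 'e) sgraph \<Rightarrow> 'v set \<Rightarrow> 'e set \<Rightarrow> ('v, 'e) sgraph" where
  "subg G Vs Es = G\<lparr>verts := Vs, edges := Es\<rparr>"

text \<open>UG: underlying graph; VS v: vertex space at v; ES e: edge space of e;
(tv e, te e): the immersion tau_e from ES e into VS (tgt UG e).\<close>

record ('a, 'b, 'c, 'd) gspaces =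
  UG :: "('a, 'b) sgraph"
  VS :: "'a \<Rightarrow> ('c, 'd) sgraph"
  ES :: "'b \<Rightarrow> ('c, 'd) sgraph"
  tv :: "'b \<Rightarrow> 'c \<Rightarrow> 'c"
  te :: "'b \<Rightarrow> 'd \<Rightarrow> 'd"

definition two_covered :: "('a, 'b, 'c, 'd) gspaces \<Rightarrow> bool" where
  "two_covered X \<longleftrightarrow> wf_graph (UG X) \<and> connected_graph (UG X) \<and>
     (\<forall>v\<in>verts (UG X). wf_graph (VS X v) \<and> connected_graph (VS X v)) \<and>
     (\<forall>e\<in>edges (UG X). wf_graph (ES X e) \<and> connected_graph (ES X e) \<and>
        ES X (rv (UG X) e) = ES X e \<and>
        immersion (ES X e) (VS X (tgt (UG X) e)) (tv X e) (te X e)) \<and>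
     (\<forall>v\<in>verts (UG X). \<forall>\<epsilon>\<in>edges (VS X v).
        card {(e, d). e \<in> edges (UG X) \<and> tgt (UG X) e = v \<and> d \<in> edges (ES X e) \<and> te X e d = \<epsilon>} = 2)"

definition hgraph :: "('a, 'b, 'c, 'd) gspaces \<Rightarrow> ('a \<times> 'c, 'b \<times> 'c) sgraph" where
  "hgraph X = \<lparr>verts = {(v, x). v \<in> verts (UG X) \<and> x \<in> verts (VS X v)},
               edges = {(e, x). e \<in> edges (UG X) \<and> x \<in> verts (ES X e)},
               rv = (\<lambda>(e, x). (rv (UG X) e, x)),
               tgt = (\<lambda>(e, x). (tgt (UG X) e, tv X e x))\<rparr>"

definition quotient_top :: "'p topology \<Rightarrow> ('p \<Rightarrow> 'p \<Rightarrow> bool) \<Rightarrow> 'p set topology" where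
  "quotient_top T R = topology (\<lambda>U.
      U \<subseteq> (\<lambda>x. {y\<in>topspace T. R x y}) ` topspace T \<and>
      openin T {x\<in>topspace T. {y\<in>topspace T. R x y} \<in> U})"

lemma istopology_quotient_top:
  fixes T :: "'p topology" and R :: "'p \<Rightarrow> 'p \<Rightarrow> bool"
  shows "istopology (\<lambda>U. U \<subseteq> (\<lambda>x. {y\<in>topspace T. R x y}) ` topspace T \<and>
      openin T {x\<in>topspace T. {y\<in>topspace T. R x y} \<in> U})"
proof -
  define c where "c x = {y\<in>topspace T. R x y}" for x
  have i: "{x\<in>topspace T. c x \<in> A \<inter> B} = {x\<in>topspace T. c x \<in> A} \<inter> {x\<in>topspace T. c x \<in> B}"
    for A B by auto
  have u: "{x\<in>topspace T. c x \<in> \<Union>K} = \<Union>((\<lambda>A. {x\<in>topspace T. c x \<in> A}) ` K)"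
    for K by auto
  have I: "A \<inter> B \<subseteq> c ` topspace T \<and> openin T {x \<in> topspace T. c x \<in> A \<inter> B}"
    if "A \<subseteq> c ` topspace T \<and> openin T {x \<in> topspace T. c x \<in> A}"
       "B \<subseteq> c ` topspace T \<and> openin T {x \<in> topspace T. c x \<in> B}" for A B
    using that unfolding i by auto
  have U: "\<Union>K \<subseteq> c ` topspace T \<and> openin T {x \<in> topspace T. c x \<in> \<Union>K}"
    if "\<forall>A\<in>K. A \<subseteq> c ` topspace T \<and> openin T {x \<in> topspace T. c x \<in> A}" for K
  proof -
    have "openin T (\<Union>((\<lambda>A. {x\<in>topspace T. c x \<in> A}) ` K))"
      using that by (intro openin_Union) auto
    then show ?thesis using that unfolding u by auto
  qed
  have "istopology (\<lambda>U. U \<subseteq> c ` topspace T \<and> openin T {x\<in>topspace T. c x \<in> U})"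
    unfolding istopology_def using I U by blast
  then show ?thesis by (simp add: c_def)
qed

datatype ('a, 'b, 'c, 'd) cell =
    VV 'a 'c   \<comment> \<open>vertex x of the vertex space at v\<close>
  | VE 'a 'd   \<comment> \<open>oriented edge of the vertex space at v, parametrised by [0,1] x {0}\<close>
  | HE 'b 'c   \<comment> \<open>x \<times> [0,1] for a vertex x of the edge space of e\<close>
  | SQ 'b 'd   \<comment> \<open>d \<times> [0,1] for an oriented edge d of the edge space of e\<close>

fun cdom :: "('a, 'b, 'c, 'd) cell \<Rightarrow> (real \<times> real) set" where
  "cdom (VV v x) = {(0, 0)}"
| "cdom (VE v d) = {0..1} \<times> {0}"
| "cdom (HE e x) = {0..1} \<times> {0}"
| "cdom (SQ e d) = {0..1} \<times> {0..1}"

definition cells :: "('a, 'b, 'c, 'd) gspaces \<Rightarrow> ('a, 'b, 'c, 'd) cell set" where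
  "cells X = {VV v x | v x. v \<in> verts (UG X) \<and> x \<in> verts (VS X v)}
           \<union> {VE v d | v d. v \<in> verts (UG X) \<and> d \<in> edges (VS X v)}
           \<union> {HE e x | e x. e \<in> edges (UG X) \<and> x \<in> verts (ES X e)}
           \<union> {SQ e d | e d. e \<in> edges (UG X) \<and> d \<in> edges (ES X e)}"

type_synonym ('a, 'b, 'c, 'd) pt = "('a, 'b, 'c, 'd) cell \<times> (real \<times> real)"

definition base_top :: "('a, 'b, 'c, 'd) gspaces \<Rightarrow> ('a, 'b, 'c, 'd) pt topology" where
  "base_top X = sum_topology (\<lambda>c. top_of_set (cdom c)) (cells X)"

text \<open>Gluing: the edge space of e is glued at time 1 via tau_e and at time 0 via
tau_{rev e} (obtained by combining with the reversal identifications).\<close>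

definition glue :: "('a, 'b, 'c, 'd) gspaces \<Rightarrow> ('a, 'b, 'c, 'd) pt \<Rightarrow> ('a, 'b, 'c, 'd) pt \<Rightarrow> bool" where
  "glue X p q \<longleftrightarrow> p \<in> topspace (base_top X) \<and> q \<in> topspace (base_top X) \<and>
    ((\<exists>v d t. p = (VE v d, (t, 0)) \<and> q = (VE v (rv (VS X v) d), (1 - t, 0))) \<or>
     (\<exists>v d. p = (VE v d, (1, 0)) \<and> q = (VV v (tgt (VS X v) d), (0, 0))) \<or>
     (\<exists>e x s. p = (HE e x, (s, 0)) \<and> q = (HE (rv (UG X) e) x, (1 - s, 0))) \<or>
     (\<exists>e x. p = (HE e x, (1, 0)) \<and> q = (VV (tgt (UG X) e) (tv X e x), (0, 0))) \<or>
     (\<exists>e d t s. p = (SQ e d, (t, s)) \<and> q = (SQ e (rv (ES X e) d), (1 - t, s))) \<or>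
     (\<exists>e d t s. p = (SQ e d, (t, s)) \<and> q = (SQ (rv (UG X) e) d, (t, 1 - s))) \<or>
     (\<exists>e d t. p = (SQ e d, (t, 1)) \<and> q = (VE (tgt (UG X) e) (te X e d), (t, 0))) \<or>
     (\<exists>e d s. p = (SQ e d, (1, s)) \<and> q = (HE e (tgt (ES X e) d), (s, 0))))"

definition realization :: "('a, 'b, 'c, 'd) gspaces \<Rightarrow> ('a, 'b, 'c, 'd) pt set topology" where
  "realization X = quotient_top (base_top X) (equivclp (glue X))"

definition cls :: "('a, 'b, 'c, 'd) gspaces \<Rightarrow> ('a, 'b, 'c, 'd) pt \<Rightarrow> ('a, 'b, 'c, 'd) pt set" where
  "cls X p = {q \<in> topspace (base_top X). equivclp (glue X) p q}"

definition hreal :: "('a, 'b, 'c, 'd) gspaces \<Rightarrow> ('a \<times> 'c) set \<Rightarrow> ('b \<times> 'c) set \<Rightarrow> ('a, 'b, 'c, 'd) pt set set" where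
  "hreal X Vs Es = cls X ` ({(VV v x, (0, 0)) | v x. (v, x) \<in> Vs}
                          \<union> {(HE e x, (s, 0)) | e x s. (e, x) \<in> Es \<and> s \<in> {0..1}})"

definition two_cell :: "('a, 'b, 'c, 'd) gspaces \<Rightarrow> 'b \<Rightarrow> 'd \<Rightarrow> ('a, 'b, 'c, 'd) pt set set" where
  "two_cell X e d = cls X ` ({SQ e d} \<times> ({0..1} \<times> {0..1}))"

definition two_cell_index :: "('a, 'b, 'c, 'd) gspaces \<Rightarrow> ('b \<times> 'd) set" where
  "two_cell_index X = {(e, d). e \<in> edges (UG X) \<and> d \<in> edges (ES X e)}"

abbreviation S1 :: "complex topology" where
  "S1 \<equiv> top_of_set (sphere 0 1)"

definition k_fold_covering :: "nat \<Rightarrow> 'x topology \<Rightarrow> 'y topology \<Rightarrow> ('x \<Rightarrow> 'y) \<Rightarrow> bool" where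
  "k_fold_covering k A B p \<longleftrightarrow> continuous_map A B p \<and> p ` topspace A = topspace B \<and>
     (\<forall>y\<in>topspace B. \<exists>U. openin B U \<and> y \<in> U \<and>
        (\<exists>Vs. finite Vs \<and> card Vs = k \<and> \<Union>Vs = {x\<in>topspace A. p x \<in> U} \<and>
              pairwise disjnt Vs \<and>
              (\<forall>W\<in>Vs. openin A W \<and> homeomorphic_map (subtopology A W) (subtopology B U) p)))"

definition circle_immersion :: "'y topology \<Rightarrow> (complex \<Rightarrow> 'y) \<Rightarrow> bool" where
  "circle_immersion Y c \<longleftrightarrow> continuous_map S1 Y c \<and>
     (\<forall>z\<in>sphere 0 1. \<exists>U. openin S1 U \<and> z \<in> U \<and> inj_on c U)"

text \<open>Free homotopy of loops S^1 \<rightarrow> Y; free homotopy classes of loops correspond to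
conjugacy classes in pi_1(Y).\<close>

definition freely_homotopic :: "'y topology \<Rightarrow> (complex \<Rightarrow> 'y) \<Rightarrow> (complex \<Rightarrow> 'y) \<Rightarrow> bool" where
  "freely_homotopic Y f g \<longleftrightarrow> homotopic_with (\<lambda>_. True) S1 Y f g"

text \<open>The conjugacy class represented by c is indivisible: no conjugate is a k-th power
with k \<noteq> \<plusminus>1 (the loop h composed with z \<mapsto> z^k represents [h]^k).\<close>

definition indivisible_loop :: "'y topology \<Rightarrow> (complex \<Rightarrow> 'y) \<Rightarrow> bool" where
  "indivisible_loop Y c \<longleftrightarrow>
     \<not> (\<exists>h (k::int). k \<noteq> 1 \<and> k \<noteq> -1 \<and> continuous_map S1 Y h \<and>
          freely_homotopic Y c (\<lambda>z. h (z powi k)))"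

end

theory Submission
  imports Defs "HOL-Complex_Analysis.Complex_Analysis"
begin

text \<open>
Every square joins a vertex of \<open>\<Gamma>\<^sub>\<infinity>\<close> to a vertex of some \<open>r\<^sub>i\<close>, because the annulus
containing it touches both; so every vertical edge has exactly one end in \<open>\<Gamma>\<^sub>\<infinity>\<close>, and the
vertices on the circles \<open>r\<^sub>i\<close> have horizontal valence 2. In a vertex space \<open>V\<close> let \<open>W\<close> be a
set of \<open>\<Gamma>\<^sub>\<infinity>\<close>-vertices connected through \<open>r\<close>-vertices. Adding to \<open>W\<close> a vertex
that shares an \<open>r\<close>-vertex with \<open>W\<close> meets two edge spaces already present, so at most
\<open>2 + \<Sum>\<^bsub>x \<in> W\<^esub> (deg x - 2)\<close> edge spaces meet \<open>W\<close>. Summed over all \<open>V\<close> this is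
\<open>\<chi>(\<Gamma>(X)) \<le> \<chi>(\<Gamma>\<^sub>U(X))\<close>, and equality forces equality for every \<open>W\<close>. Then the maps \<open>\<tau>\<^sub>e\<close> are
injective, and all edges of a simple cycle in \<open>V\<close> lift to the same two edge spaces. Hence a simple
cycle in an edge space moves through the whole complex, and two adjacent squares of it run along the
same horizontal edge path in \<open>\<Gamma>\<^sub>\<infinity>\<close> forever.

The loop \<open>\<gamma>\<^sub>i\<close> is freely homotopic, up to orientation, to the edge path traced by the upper side of
its strip of squares: retract the complement of the \<open>r\<^sub>j\<close> onto \<open>\<Gamma>\<^sub>\<infinity>\<close>, and note that the middle circle
of the mapping cylinder is a simple closed curve in an open annulus, whose degree is
\<open>\<plusminus>1\<close> or \<open>0\<close>, the latter being excluded by indivisibility. Two squares tracing the same periodic word have, by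
indivisibility, the same minimal period. If they lie in different strips, the two loops are freely
homotopic up to orientation; if they lie in the same strip, the word has a smaller period or equals its own
reverse, and a reduced cyclic word cannot be its own reverse.
\<close>

section \<open>Graphs, cycles and strips of squares\<close>

text \<open>The maps \<open>\<Phi> i\<close> are not assumed cellular: they are continuous, and
  injective on the open annulus only. Statements relating them to squares are therefore extracted
  from continuous functions on the complement of the horizontal graph. The values, or their moduli,
  lie in a disconnected set ({0, 1}, or 0 together with the interval from 1 to 2), so on the
  connected open annulus one value decides all. The plane-valued function unrolls a strip of n
  squares onto the annulus 1 < |w| < 2, the angle growing by 2 pi / n per square. That a cylinder
  runs exactly once round its strip is never shown directly: injectivity bounds the degree of the
  middle circle by 1 in absolute value, and indivisibility excludes 0. The constant 2 in the count
  comes from a single vertex x, which meets at most deg x = 2 + (deg x - 2) edge spaces. Equality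
  for every W says that a vertex attached to W shares with W no edge space beyond those of the
  connecting vertical edge; this is what carries a cycle through a vertex space.\<close>

lemma wf_graphD:
  assumes "wf_graph G"
  shows "finite (verts G)" "finite (edges G)"
    and "e \<in> edges G \<Longrightarrow> rv G e \<in> edges G" "e \<in> edges G \<Longrightarrow> rv G e \<noteq> e"
    and "e \<in> edges G \<Longrightarrow> rv G (rv G e) = e" "e \<in> edges G \<Longrightarrow> tgt G e \<in> verts G"
    and "e \<in> edges G \<Longrightarrow> src G e \<in> verts G"
    and "e \<in> edges G \<Longrightarrow> tgt G (rv G e) = src G e" "e \<in> edges G \<Longrightarrow> src G (rv G e) = tgt G e"
  using assms by (auto simp: wf_graph_def src_def)

lemma even_card_involution:
  assumes "finite A" "\<And>x. x \<in> A \<Longrightarrow> f x \<in> A \<and> f x \<noteq> x \<and> f (f x) = x"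
  shows "even (card A)"
  using assms
proof (induction "card A" arbitrary: A rule: less_induct)
  case less
  show ?case
  proof (cases "A = {}")
    case False
    then obtain x where x: "x \<in> A" by blast
    let ?B = "A - {x, f x}"
    have "A = insert x (insert (f x) ?B)" using less.prems(2)[OF x] x by auto
    moreover have "x \<notin> insert (f x) ?B" "f x \<notin> ?B" using less.prems(2)[OF x] by auto
    ultimately have c: "card A = card ?B + 2"
      using less.prems(1) by (metis card_insert_disjoint add_2_eq_Suc' finite_Diff finite_insert)
    have "even (card ?B)"
    proof (rule less.hyps)
      show "card ?B < card A" using c by simp
      show "finite ?B" using less.prems by simp
      fix y assume "y \<in> ?B"
      then show "f y \<in> ?B \<and> f y \<noteq> y \<and> f (f y) = y" using less.prems(2) x
        by (metis Diff_iff insert_iff singletonD)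
    qed
    then show ?thesis using c by simp
  qed simp
qed

text \<open>Oriented edges come in pairs under \<open>rv\<close>, so the division by 2 in
  \<open>chi\<close> is exact.\<close>

lemma two_chi:
  assumes "wf_graph G"
  shows "2 * chi G = 2 * int (card (verts G)) - int (card (edges G))"
proof -
  have "even (card (edges G))"
    by (rule even_card_involution[where f = "rv G"]) (use wf_graphD[OF assms] in auto)
  then show ?thesis by (simp add: chi_def)
qed

text \<open>A simple closed edge path, stored as a periodic sequence so that no index is special and
  shifts need no case distinction. Loops (n = 1) and bigons (n = 2) are included.\<close>

definition cycle :: "('v, 'e) sgraph \<Rightarrow> nat \<Rightarrow> (nat \<Rightarrow> 'e) \<Rightarrow> bool" where
  "cycle G n c \<longleftrightarrow> 0 < n \<and> (\<forall>j. c j \<in> edges G \<and> tgt G (c j) = src G (c (Suc j)) \<and>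
     c (Suc j) \<noteq> rv G (c j)) \<and> (\<forall>i j. i mod n = j mod n \<longrightarrow> c i = c j) \<and>
     (\<forall>i j. tgt G (c i) = tgt G (c j) \<longleftrightarrow> i mod n = j mod n)"

text \<open>A closed subwalk of minimal length of a reduced circuit has distinct vertices, and it
cannot backtrack at the base point, since otherwise it could be shortened.\<close>

lemma reduced_circuit_imp_cycle:
  assumes G: "wf_graph G" and es: "reduced_circuit G es"
  obtains n c where "cycle G n c"
proof -
  \<comment> \<open>\<open>P l\<close> concerns closed subwalks of l + 1 edges, from position i to
    position i + l inclusive.\<close>
  define P where "P l \<longleftrightarrow> (\<exists>i. i + l < length es \<and> src G (es ! i) = tgt G (es ! (i + l)))" for l
  have E: "es ! i \<in> edges G" if "i < length es" for i
    using es that by (auto simp: reduced_circuit_def)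
  have S: "tgt G (es ! i) = src G (es ! Suc i)" "es ! Suc i \<noteq> rv G (es ! i)" if "Suc i < length es" for i
    using es that by (auto simp: reduced_circuit_def)
  have "P (length es - 1)"
    using es by (auto simp: P_def reduced_circuit_def last_conv_nth hd_conv_nth intro!: exI[of _ 0])
  then obtain l where l: "P l" "\<And>l'. l' < l \<Longrightarrow> \<not> P l'"
    using exists_least_iff[of P] by auto
  then obtain i where i: "i + l < length es" "src G (es ! i) = tgt G (es ! (i + l))"
    by (auto simp: P_def)
  define n where "n = Suc l"
  define c where "c j = es ! (i + j mod n)" for j
  have lt: "i + j mod n < length es" for j
    using i(1) mod_less_divisor[of n j] by (simp add: n_def del: mod_less_divisor)
  have dist: "a = b" if "a < n" "b < n" "tgt G (es ! (i + a)) = tgt G (es ! (i + b))" for a b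
  proof (rule ccontr)
    have *: False if "a < b" "b < n" "tgt G (es ! (i + a)) = tgt G (es ! (i + b))" for a b
    proof -
      have "src G (es ! Suc (i + a)) = tgt G (es ! (i + b))"
        using S[of "i + a"] that i(1) by (simp add: n_def)
      then have "P (b - Suc a)" unfolding P_def using that i(1)
        by (intro exI[of _ "Suc (i + a)"]) (simp add: n_def)
      moreover have "b - Suc a < l" using that(1,2) unfolding n_def by arith
      ultimately show False using l(2) by blast
    qed
    assume "a \<noteq> b"
    then show False using *[of a b] *[of b a] that by (metis linorder_neqE_nat)
  qed
  have wrap: "es ! i \<noteq> rv G (es ! (i + l))"
  proof
    assume a: "es ! i = rv G (es ! (i + l))"
    have "l \<noteq> 0" using a wf_graphD(4)[OF G E[of i]] i(1) by (metis add_0_right)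
    moreover have "l \<noteq> 1"
    proof
      assume "l = 1"
      then have "es ! Suc i = rv G (es ! i)"
        using a wf_graphD(5)[OF G E[OF i(1)]] by simp
      then show False using S(2)[of i] i(1) \<open>l = 1\<close> by simp
    qed
    \<comment> \<open>Cutting off the first and the last edge leaves a closed walk of l - 1 edges,
      that is \<open>P (l - 2)\<close>.\<close>
    ultimately have l2: "2 \<le> l" by simp
    have "src G (es ! Suc i) = tgt G (es ! i)" using S(1)[of i] i(1) l2 by simp
    also have "\<dots> = src G (es ! (i + l))" using a by (simp add: src_def)
    also have "\<dots> = tgt G (es ! (i + l - 1))" using S(1)[of "i + l - 1"] i(1) l2 by simp
    finally have "P (l - 2)" unfolding P_def using i(1) l2
      by (intro exI[of _ "Suc i"]) (simp add: numeral_2_eq_2 Suc_diff_Suc)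
    then show False using l(2)[of "l - 2"] l2 by simp
  qed
  have "cycle G n c"
    unfolding cycle_def
  proof (intro conjI allI impI)
    show "0 < n" by (simp add: n_def)
    fix j
    show "c j \<in> edges G" unfolding c_def by (rule E[OF lt])
    show "tgt G (c j) = src G (c (Suc j))" "c (Suc j) \<noteq> rv G (c j)"
      using S[of "i + j mod n"] lt[of "Suc j"] i(2) wrap
      by (auto simp: c_def mod_Suc n_def split: if_splits)
    fix k
    show "c j = c k" if "j mod n = k mod n" using that by (simp add: c_def)
    show "tgt G (c j) = tgt G (c k) \<longleftrightarrow> j mod n = k mod n"
      using dist[of "j mod n" "k mod n"] by (auto simp: c_def n_def)
  qed
  then show thesis by (rule that)
qed

section \<open>Squares, their four labels and their strips\<close>

locale two_cov =
  fixes X :: "('a, 'b, 'c, 'd) gspaces"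
  assumes two_covered: "two_covered X"
begin

abbreviation "U \<equiv> UG X"
abbreviation "V \<equiv> VS X"
abbreviation "E \<equiv> ES X"
abbreviation "squares \<equiv> two_cell_index X"

lemma wfU: "wf_graph U" and wfV: "v \<in> verts U \<Longrightarrow> wf_graph (V v)"
  and conV: "v \<in> verts U \<Longrightarrow> connected_graph (V v)"
  and wfE: "e \<in> edges U \<Longrightarrow> wf_graph (E e)"
  and conE: "e \<in> edges U \<Longrightarrow> connected_graph (E e)"
  and E_rv: "e \<in> edges U \<Longrightarrow> E (rv U e) = E e"
  using two_covered unfolding two_covered_def by blast+

lemmas Ud = wf_graphD[OF wfU]
lemmas Vd = wf_graphD[OF wfV]
lemmas Ed = wf_graphD[OF wfE]

lemma imm: "e \<in> edges U \<Longrightarrow> immersion (E e) (V (tgt U e)) (tv X e) (te X e)"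
  using two_covered unfolding two_covered_def by blast

lemma tau:
  assumes "e \<in> edges U"
  shows "y \<in> verts (E e) \<Longrightarrow> tv X e y \<in> verts (V (tgt U e))"
    and "d \<in> edges (E e) \<Longrightarrow> te X e d \<in> edges (V (tgt U e))"
    and "d \<in> edges (E e) \<Longrightarrow> te X e (rv (E e) d) = rv (V (tgt U e)) (te X e d)"
    and "d \<in> edges (E e) \<Longrightarrow> tgt (V (tgt U e)) (te X e d) = tv X e (tgt (E e) d)"
    and "d \<in> edges (E e) \<Longrightarrow> src (V (tgt U e)) (te X e d) = tv X e (src (E e) d)"
proof -
  have g: "tv X e ` verts (E e) \<subseteq> verts (V (tgt U e))" "te X e ` edges (E e) \<subseteq> edges (V (tgt U e))"
    "\<And>d. d \<in> edges (E e) \<Longrightarrow> te X e (rv (E e) d) = rv (V (tgt U e)) (te X e d)"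
    "\<And>d. d \<in> edges (E e) \<Longrightarrow> tgt (V (tgt U e)) (te X e d) = tv X e (tgt (E e) d)"
    using imm[OF assms] unfolding immersion_def graph_map_def by simp_all
  show "y \<in> verts (E e) \<Longrightarrow> tv X e y \<in> verts (V (tgt U e))"
    "d \<in> edges (E e) \<Longrightarrow> te X e d \<in> edges (V (tgt U e))"
    using g(1,2) by blast+
  show "d \<in> edges (E e) \<Longrightarrow> te X e (rv (E e) d) = rv (V (tgt U e)) (te X e d)"
    and "d \<in> edges (E e) \<Longrightarrow> tgt (V (tgt U e)) (te X e d) = tv X e (tgt (E e) d)"
    by (rule g; assumption)+
  assume d: "d \<in> edges (E e)"
  show "src (V (tgt U e)) (te X e d) = tv X e (src (E e) d)"
    unfolding src_def using g(3)[OF d] g(4)[OF Ed(3)[OF assms d]] by simp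
qed

lemma te_inj:
  assumes "e \<in> edges U" "d \<in> edges (E e)" "d' \<in> edges (E e)" "tgt (E e) d = tgt (E e) d'"
    "te X e d = te X e d'"
  shows "d = d'"
proof -
  have "inj_on (te X e) {d' \<in> edges (E e). tgt (E e) d' = tgt (E e) d}"
    using imm[OF assms(1)] Ed(6)[OF assms(1,2)] unfolding immersion_def by blast
  then show ?thesis using assms by (auto dest: inj_onD)
qed

lemma te_inj_src:
  assumes "e \<in> edges U" "d \<in> edges (E e)" "d' \<in> edges (E e)" "src (E e) d = src (E e) d'"
    "te X e d = te X e d'"
  shows "d = d'"
proof -
  have "rv (E e) d = rv (E e) d'"
    by (rule te_inj[OF assms(1)]) (use assms Ed[OF assms(1)] tau(3)[OF assms(1)] in auto)
  then show ?thesis using Ed(5)[OF assms(1)] assms by metis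
qed

lemma mem_squares: "(e, d) \<in> squares \<longleftrightarrow> e \<in> edges U \<and> d \<in> edges (E e)"
  by (simp add: two_cell_index_def)

lemma finite_squares: "finite squares"
proof -
  have "squares = Sigma (edges U) (\<lambda>e. edges (E e))" by (auto simp: two_cell_index_def)
  then show ?thesis using Ud(2) Ed(2) by simp
qed

definition pre :: "'a \<Rightarrow> 'd \<Rightarrow> ('b \<times> 'd) set" where
  "pre v \<epsilon> = {(e, d). e \<in> edges U \<and> tgt U e = v \<and> d \<in> edges (E e) \<and> te X e d = \<epsilon>}"

lemma mem_pre: "(e, d) \<in> pre v \<epsilon> \<longleftrightarrow> e \<in> edges U \<and> tgt U e = v \<and> d \<in> edges (E e) \<and> te X e d = \<epsilon>"
  by (simp add: pre_def)

lemma card_pre: "v \<in> verts U \<Longrightarrow> \<epsilon> \<in> edges (V v) \<Longrightarrow> card (pre v \<epsilon>) = 2"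
  using two_covered unfolding two_covered_def pre_def by blast

text \<open>The other lift of the same vertex-space edge, hence the square glued to \<open>s\<close>
  along its side at time 1.\<close>

definition partner :: "'b \<times> 'd \<Rightarrow> 'b \<times> 'd" where
  "partner s = (THE s'. s' \<in> pre (tgt U (fst s)) (te X (fst s) (snd s)) \<and> s' \<noteq> s)"

text \<open>Each 2-cell carries four labels: \<open>reverse\<close> changes the time direction,
  \<open>flip\<close> (below) the direction of the edge in the edge space.\<close>

definition reverse :: "'b \<times> 'd \<Rightarrow> 'b \<times> 'd" where
  "reverse s = (rv U (fst s), snd s)"

definition flip :: "'b \<times> 'd \<Rightarrow> 'b \<times> 'd" where
  "flip s = (fst s, rv (E (fst s)) (snd s))"

lemma pre_partner:
  assumes s: "s \<in> squares"
  shows "pre (tgt U (fst s)) (te X (fst s) (snd s)) = {s, partner s}" "partner s \<noteq> s"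
proof -
  let ?P = "pre (tgt U (fst s)) (te X (fst s) (snd s))"
  have s': "fst s \<in> edges U" "snd s \<in> edges (E (fst s))" using s by (auto simp: two_cell_index_def)
  have "card ?P = 2" by (rule card_pre) (use Ud(6) tau(2) s' in auto)
  then obtain a b where ab: "?P = {a, b}" "a \<noteq> b" unfolding card_2_iff by blast
  have "s \<in> ?P" using s' by (cases s) (auto simp: pre_def)
  then have "s = a \<or> s = b" unfolding ab(1) by simp
  then obtain u where u: "?P = {s, u}" "u \<noteq> s" using ab by blast
  have "partner s = u" unfolding partner_def by (rule the_equality) (use u in auto)
  with u show "?P = {s, partner s}" "partner s \<noteq> s" by auto
qed

lemma partner:
  assumes "s \<in> squares"
  shows "partner s \<in> squares" "tgt U (fst (partner s)) = tgt U (fst s)"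
    "te X (fst (partner s)) (snd (partner s)) = te X (fst s) (snd s)" "partner (partner s) = s"
proof -
  have k: "partner s \<in> pre (tgt U (fst s)) (te X (fst s) (snd s))" using pre_partner[OF assms] by blast
  then show 1: "partner s \<in> squares" "tgt U (fst (partner s)) = tgt U (fst s)"
    "te X (fst (partner s)) (snd (partner s)) = te X (fst s) (snd s)"
    by (cases "partner s"; auto simp: pre_def two_cell_index_def)+
  have "{partner s, partner (partner s)} = {s, partner s}" using pre_partner(1)[OF 1(1)] pre_partner(1)[OF assms] 1 by simp
  then show "partner (partner s) = s" using pre_partner(2)[OF 1(1)] by (auto simp: doubleton_eq_iff)
qed

lemma partner_unique:
  assumes "s \<in> squares" "s' \<in> squares" "s' \<noteq> s" "tgt U (fst s') = tgt U (fst s)"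
    "te X (fst s') (snd s') = te X (fst s) (snd s)"
  shows "s' = partner s"
proof -
  have "s' \<in> pre (tgt U (fst s)) (te X (fst s) (snd s))"
    using assms by (cases s') (auto simp: pre_def two_cell_index_def)
  then show ?thesis using pre_partner[OF assms(1)] assms(3) by auto
qed

lemma flip: "s \<in> squares \<Longrightarrow> flip s \<in> squares" "s \<in> squares \<Longrightarrow> flip (flip s) = s" "s \<in> squares \<Longrightarrow> flip s \<noteq> s"
  using Ed by (cases s; auto simp: flip_def two_cell_index_def)+

lemma reverse: "s \<in> squares \<Longrightarrow> reverse s \<in> squares" "s \<in> squares \<Longrightarrow> reverse (reverse s) = s" "s \<in> squares \<Longrightarrow> reverse s \<noteq> s"
  using Ud E_rv by (cases s; auto simp: reverse_def two_cell_index_def)+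

lemma reverse_flip: "s \<in> squares \<Longrightarrow> reverse (flip s) = flip (reverse s)"
  using E_rv by (cases s) (auto simp: reverse_def flip_def two_cell_index_def)

lemma partner_flip: assumes s: "s \<in> squares" shows "partner (flip s) = flip (partner s)"
proof -
  have te_flip: "te X (fst (flip u)) (snd (flip u)) = rv (V (tgt U (fst u))) (te X (fst u) (snd u))"
    if "u \<in> squares" for u
    using that tau(3) by (cases u) (auto simp: flip_def two_cell_index_def)
  have "flip (partner s) = partner (flip s)"
  proof (rule partner_unique)
    show "flip (partner s) \<noteq> flip s" using flip(2) partner(1) s pre_partner(2) by metis
  qed (use s partner[OF s] flip te_flip in \<open>auto simp: flip_def\<close>)
  then show ?thesis by simp
qed

text \<open>The identity outside the squares makes \<open>advance\<close> an injection of the whole type.\<close>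

definition advance :: "'b \<times> 'd \<Rightarrow> 'b \<times> 'd" where
  "advance s = (if s \<in> squares then reverse (partner s) else s)"

lemma advance_squares: "advance s \<in> squares \<longleftrightarrow> s \<in> squares"
  by (auto simp: advance_def reverse partner)

lemma partner_reverse_advance: "s \<in> squares \<Longrightarrow> partner (reverse (advance s)) = s"
  by (simp add: advance_def reverse partner)

lemma inj_advance: "inj advance"
  by (rule injI) (metis partner_reverse_advance advance_squares advance_def)

lemma advance_pow_squares: "(advance ^^ j) s \<in> squares \<longleftrightarrow> s \<in> squares"
  by (induction j) (auto simp: advance_squares)

lemma advance_flip: "s \<in> squares \<Longrightarrow> advance (flip s) = flip (advance s)"
  by (simp add: advance_def flip partner_flip partner reverse_flip)

text \<open>Reading a strip backwards conjugates \<open>advance\<close> into its inverse.\<close>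

lemma advance_reverse_advance: "s \<in> squares \<Longrightarrow> advance (reverse (advance s)) = reverse s"
  using partner_reverse_advance[of s] by (simp add: advance_def[of "reverse (advance s)"] reverse advance_squares)

lemma reverse_advance_pow: "s \<in> squares \<Longrightarrow> (advance ^^ j) (reverse ((advance ^^ j) s)) = reverse s"
proof (induction j)
  case (Suc j)
  have "(advance ^^ Suc j) (reverse ((advance ^^ Suc j) s)) = (advance ^^ j) (advance (reverse (advance ((advance ^^ j) s))))"
    by (simp add: funpow_swap1)
  then show ?case using Suc by (simp add: advance_reverse_advance advance_pow_squares)
qed simp

definition period :: "'b \<times> 'd \<Rightarrow> nat" where
  "period s = (LEAST n. 0 < n \<and> (advance ^^ n) s = s)"

lemma period:
  assumes "s \<in> squares"
  shows "0 < period s" "(advance ^^ period s) s = s"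
    "\<And>j. 0 < j \<Longrightarrow> j < period s \<Longrightarrow> (advance ^^ j) s \<noteq> s"
proof -
  have "range (\<lambda>n. (advance ^^ n) s) \<subseteq> squares" using assms by (simp add: image_subset_iff advance_pow_squares)
  then have "finite {y. \<exists>n. y = (advance ^^ n) s}"
    using finite_subset finite_squares by (metis full_SetCompr_eq)
  then obtain n where n: "0 < n" "(advance ^^ n) s = s" using funpow_inj_finite[OF inj_advance] by metis
  have "0 < period s \<and> (advance ^^ period s) s = s"
    unfolding period_def by (rule LeastI[of _ n]) (use n in simp)
  then show "0 < period s" "(advance ^^ period s) s = s" by auto
  show "\<And>j. 0 < j \<Longrightarrow> j < period s \<Longrightarrow> (advance ^^ j) s \<noteq> s"
    unfolding period_def using not_less_Least by blast
qed

text \<open>The horizontal edge to which the side t = 1 of the square is glued.\<close>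

definition head_edge :: "'b \<times> 'd \<Rightarrow> 'b \<times> 'c" where
  "head_edge s = (fst s, tgt (E (fst s)) (snd s))"

text \<open>The horizontal edges ending at the vertex (v, x); the cardinality is its valence in the
  horizontal graph.\<close>

definition half :: "'a \<Rightarrow> 'c \<Rightarrow> ('b \<times> 'c) set" where
  "half v x = {(e, y). e \<in> edges U \<and> tgt U e = v \<and> y \<in> verts (E e) \<and> tv X e y = x}"

lemma finite_hgraph: "finite (verts (hgraph X))" "finite (edges (hgraph X))"
proof -
  have "verts (hgraph X) = Sigma (verts U) (\<lambda>v. verts (V v))"
    "edges (hgraph X) = Sigma (edges U) (\<lambda>e. verts (E e))" by (auto simp: hgraph_def)
  then show "finite (verts (hgraph X))" "finite (edges (hgraph X))" using Ud Vd Ed by simp_all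
qed

lemma finite_half: "finite (half v x)"
  by (rule finite_subset[OF _ finite_hgraph(2)]) (auto simp: half_def hgraph_def)

lemma wf_hgraph: "wf_graph (hgraph X)"
  unfolding wf_graph_def using finite_hgraph Ud E_rv tau(1) by (auto simp: hgraph_def)

end

section \<open>Counting half-edges in a vertex space\<close>

text \<open>Isolates the input of the count: \<open>VA\<close> and \<open>EA\<close> stand for the
  large component, their complements for the circles. In \<open>B_half\<close> an upper bound
  suffices, because a vertical edge, supplied by \<open>B_edge\<close>, has two lifts and so forces
  valence at least 2.\<close>

locale bip = two_cov X for X :: "('a, 'b, 'c, 'd) gspaces" +
  fixes VA :: "('a \<times> 'c) set" and EA :: "('b \<times> 'c) set"
  assumes VA_sub: "VA \<subseteq> verts (hgraph X)" and EA_sub: "EA \<subseteq> edges (hgraph X)"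
    and EA_VA: "\<And>e y. e \<in> edges (UG X) \<Longrightarrow> y \<in> verts (ES X e) \<Longrightarrow>
      (e, y) \<in> EA \<longleftrightarrow> (tgt (UG X) e, tv X e y) \<in> VA"
    and EA_rv: "\<And>e y. e \<in> edges (UG X) \<Longrightarrow> y \<in> verts (ES X e) \<Longrightarrow> (rv (UG X) e, y) \<in> EA \<longleftrightarrow> (e, y) \<in> EA"
    and bip: "\<And>e d. e \<in> edges (UG X) \<Longrightarrow> d \<in> edges (ES X e) \<Longrightarrow>
      (e, tgt (ES X e) d) \<in> EA \<longleftrightarrow> (e, src (ES X e) d) \<notin> EA"
    and B_half: "\<And>v x. v \<in> verts (UG X) \<Longrightarrow> x \<in> verts (VS X v) \<Longrightarrow> (v, x) \<notin> VA \<Longrightarrow>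
      card {(e, y). e \<in> edges (UG X) \<and> tgt (UG X) e = v \<and> y \<in> verts (ES X e) \<and> tv X e y = x} \<le> 2"
    and B_edge: "\<And>v x. v \<in> verts (UG X) \<Longrightarrow> x \<in> verts (VS X v) \<Longrightarrow> (v, x) \<notin> VA \<Longrightarrow>
      \<exists>\<epsilon>\<in>edges (VS X v). src (VS X v) \<epsilon> = x"
begin

lemma bipV:
  assumes v: "v \<in> verts U" and e: "\<epsilon> \<in> edges (V v)"
  shows "(v, tgt (V v) \<epsilon>) \<in> VA \<longleftrightarrow> (v, src (V v) \<epsilon>) \<notin> VA"
proof -
  have "pre v \<epsilon> \<noteq> {}" using card_pre[OF v e] by auto
  then obtain e d where "(e, d) \<in> pre v \<epsilon>" by auto
  then have *: "e \<in> edges U" "tgt U e = v" "d \<in> edges (E e)" "te X e d = \<epsilon>" by (auto simp: mem_pre)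
  show ?thesis using bip[OF *(1,3)] EA_VA[OF *(1) Ed(6)[OF *(1,3)]] EA_VA[OF *(1) Ed(7)[OF *(1,3)]]
      tau(4,5)[OF *(1,3)] *(2,4) by simp
qed

definition inf_verts :: "'a \<Rightarrow> 'c set" where "inf_verts v = {x \<in> verts (V v). (v, x) \<in> VA}"
definition nbrs :: "'a \<Rightarrow> 'c set \<Rightarrow> 'b set" where "nbrs v W = fst ` (\<Union>x\<in>W. half v x)"
text \<open>The edge spaces carrying the two lifts of a vertical edge; it is a singleton if both
  lifts lie in the same one.\<close>

definition strands :: "'a \<Rightarrow> 'd \<Rightarrow> 'b set" where "strands v \<epsilon> = fst ` pre v \<epsilon>"
text \<open>The gap between the two sides of the bound on the number of edge spaces meeting W. For W
  = {x} it counts the half-edges at x that repeat an edge space.\<close>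

definition slack :: "'a \<Rightarrow> 'c set \<Rightarrow> int" where
  "slack v W = 2 + (\<Sum>x\<in>W. int (card (half v x)) - 2) - int (card (nbrs v W))"

lemma finite_inf_verts: "v \<in> verts U \<Longrightarrow> finite (inf_verts v)"
  using Vd(1) by (simp add: inf_verts_def)

lemma finite_nbrs: "finite W \<Longrightarrow> finite (nbrs v W)"
  by (simp add: nbrs_def finite_half)

text \<open>By local injectivity of the immersions, the two lifts of a vertical edge occupy
  different half-edges at its ends.\<close>

lemma half_src:
  assumes v: "v \<in> verts U" and e: "\<epsilon> \<in> edges (V v)"
  shows "(\<lambda>(e, d). (e, src (E e) d)) ` pre v \<epsilon> \<subseteq> half v (src (V v) \<epsilon>)"
    "card ((\<lambda>(e, d). (e, src (E e) d)) ` pre v \<epsilon>) = 2"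
proof -
  show "(\<lambda>(e, d). (e, src (E e) d)) ` pre v \<epsilon> \<subseteq> half v (src (V v) \<epsilon>)"
    using Ed(7) by (auto simp: mem_pre half_def tau(5))
  have "inj_on (\<lambda>(e, d). (e, src (E e) d)) (pre v \<epsilon>)"
    by (auto simp: inj_on_def mem_pre intro: te_inj_src)
  then show "card ((\<lambda>(e, d). (e, src (E e) d)) ` pre v \<epsilon>) = 2"
    using card_pre[OF v e] by (simp add: card_image)
qed

lemma half_tgt:
  assumes v: "v \<in> verts U" and e: "\<epsilon> \<in> edges (V v)"
  shows "(\<lambda>(e, d). (e, tgt (E e) d)) ` pre v \<epsilon> \<subseteq> half v (tgt (V v) \<epsilon>)"
    "card ((\<lambda>(e, d). (e, tgt (E e) d)) ` pre v \<epsilon>) = 2"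
proof -
  show "(\<lambda>(e, d). (e, tgt (E e) d)) ` pre v \<epsilon> \<subseteq> half v (tgt (V v) \<epsilon>)"
    using Ed(6) by (auto simp: mem_pre half_def tau(4))
  have "inj_on (\<lambda>(e, d). (e, tgt (E e) d)) (pre v \<epsilon>)"
    by (auto simp: inj_on_def mem_pre intro: te_inj)
  then show "card ((\<lambda>(e, d). (e, tgt (E e) d)) ` pre v \<epsilon>) = 2"
    using card_pre[OF v e] by (simp add: card_image)
qed

text \<open>Two lifts and valence at most 2: at an r-vertex the lifts of any single vertical edge
  already use up all half-edges.\<close>

lemma half_B:
  assumes v: "v \<in> verts U" and e: "\<epsilon> \<in> edges (V v)" and B: "(v, src (V v) \<epsilon>) \<notin> VA"
  shows "half v (src (V v) \<epsilon>) = (\<lambda>(e, d). (e, src (E e) d)) ` pre v \<epsilon>"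
    and "card (half v (src (V v) \<epsilon>)) = 2"
proof -
  have "card (half v (src (V v) \<epsilon>)) \<le> 2"
    using B_half[OF v Vd(7)[OF v e] B] by (simp add: half_def)
  then show "half v (src (V v) \<epsilon>) = (\<lambda>(e, d). (e, src (E e) d)) ` pre v \<epsilon>"
    using card_seteq[OF finite_half half_src(1)[OF v e]] half_src(2)[OF v e] by simp
  then show "card (half v (src (V v) \<epsilon>)) = 2" using half_src(2)[OF v e] by simp
qed

text \<open>The right-hand side depends only on the source, so all vertical edges at one r-vertex
  have the same strands.\<close>

lemma strands_B:
  assumes "v \<in> verts U" "\<epsilon> \<in> edges (V v)" "(v, src (V v) \<epsilon>) \<notin> VA"
  shows "strands v \<epsilon> = fst ` half v (src (V v) \<epsilon>)"
  using half_B(1)[OF assms] by (auto simp: strands_def image_image split_def)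

lemma strands_half_tgt: "v \<in> verts U \<Longrightarrow> \<epsilon> \<in> edges (V v) \<Longrightarrow> strands v \<epsilon> \<subseteq> fst ` half v (tgt (V v) \<epsilon>)"
  using image_mono[OF half_tgt(1), of v \<epsilon> fst] by (simp add: strands_def image_image split_def)

lemma strands_rv:
  assumes v: "v \<in> verts U" and e: "\<epsilon> \<in> edges (V v)"
  shows "strands v (rv (V v) \<epsilon>) = strands v \<epsilon>"
proof -
  have *: "strands v \<epsilon> \<subseteq> strands v (rv (V v) \<epsilon>)" if "\<epsilon> \<in> edges (V v)" for \<epsilon>
  proof
    fix e assume "e \<in> strands v \<epsilon>"
    then obtain d where d: "(e, d) \<in> pre v \<epsilon>" by (auto simp: strands_def)
    then have "(e, rv (E e) d) \<in> pre v (rv (V v) \<epsilon>)"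
      using Ed(3) tau(3) by (auto simp: mem_pre)
    then show "e \<in> strands v (rv (V v) \<epsilon>)" by (force simp: strands_def)
  qed
  show ?thesis using *[OF e] *[OF Vd(3)[OF v e]] Vd(5)[OF v e] by auto
qed

text \<open>The two half-edges at the new vertex over the shared vertical vertex lie in edge spaces
that are already counted.\<close>

lemma slack_insert:
  assumes v: "v \<in> verts U" and W: "finite W" and e: "\<epsilon> \<in> edges (V v)" "\<epsilon>' \<in> edges (V v)"
    and b: "src (V v) \<epsilon> = src (V v) \<epsilon>'" "(v, src (V v) \<epsilon>) \<notin> VA"
    and x: "tgt (V v) \<epsilon> \<in> W" "tgt (V v) \<epsilon>' = x'" "x' \<notin> W"
  shows "slack v W \<le> slack v (insert x' W)"
    and "slack v (insert x' W) = slack v W \<Longrightarrow> fst ` half v x' \<inter> nbrs v W = strands v \<epsilon>'"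
proof -
  \<comment> \<open>\<open>G\<close> holds the half-edges at x' belonging to the two lifts of the
    connecting edge, \<open>R\<close> all the others.\<close>
  define G where "G = (\<lambda>(e, d). (e, tgt (E e) d)) ` pre v \<epsilon>'"
  define R where "R = half v x' - G"
  have G: "G \<subseteq> half v x'" "card G = 2" "fst ` G = strands v \<epsilon>'"
    using half_tgt[OF v e(2)] x(2) by (auto simp: G_def strands_def image_image split_def)
  have R: "card (half v x') = card R + 2" "finite R"
    using G card_Diff_subset[of G "half v x'"] card_mono[OF finite_half G(1)] finite_half[of v x']
      finite_subset[OF G(1) finite_half] by (auto simp: R_def)
  have "strands v \<epsilon>' = strands v \<epsilon>" using strands_B[OF v e(1) b(2)] strands_B[OF v e(2)] b by simp
  also have "\<dots> \<subseteq> nbrs v W" using strands_half_tgt[OF v e(1)] x(1) unfolding nbrs_def image_UN by blast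
  finally have prN: "strands v \<epsilon>' \<subseteq> nbrs v W" .
  have un: "fst ` half v x' = strands v \<epsilon>' \<union> fst ` R" using G(1) unfolding R_def G(3)[symmetric] by blast
  have Ni: "nbrs v (insert x' W) = nbrs v W \<union> fst ` R" using un prN by (auto simp: nbrs_def image_Un)
  have fin: "finite (nbrs v W)" "finite (fst ` R)" using finite_nbrs[OF W] R by auto
  have c: "card (nbrs v W) + card (fst ` R) = card (nbrs v (insert x' W)) + card (nbrs v W \<inter> fst ` R)"
    unfolding Ni by (rule card_Un_Int[OF fin])
  have cR: "card (fst ` R) \<le> card R" by (rule card_image_le[OF R(2)])
  have sl: "slack v (insert x' W) = slack v W + int (card R) + int (card (nbrs v W)) - int (card (nbrs v (insert x' W)))"
    using W x(3) R(1) by (simp add: slack_def)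
  show "slack v W \<le> slack v (insert x' W)" using sl c cR by linarith
  assume "slack v (insert x' W) = slack v W"
  then have "card (nbrs v W \<inter> fst ` R) = 0" using sl c cR by linarith
  then have "nbrs v W \<inter> fst ` R = {}" using fin by simp
  then show "fst ` half v x' \<inter> nbrs v W = strands v \<epsilon>'" unfolding un using prN by blast
qed

text \<open>Connectedness through shared r-vertices, given as a build-up so that
  \<open>slack_insert\<close> is exactly the induction step.\<close>

inductive connset :: "'a \<Rightarrow> 'c set \<Rightarrow> bool" for v where
  single: "x \<in> inf_verts v \<Longrightarrow> connset v {x}"
| insert: "connset v W \<Longrightarrow> \<epsilon> \<in> edges (V v) \<Longrightarrow> \<epsilon>' \<in> edges (V v) \<Longrightarrow>
    src (V v) \<epsilon> = src (V v) \<epsilon>' \<Longrightarrow> tgt (V v) \<epsilon> \<in> W \<Longrightarrow> tgt (V v) \<epsilon>' \<in> inf_verts v \<Longrightarrow> tgt (V v) \<epsilon>' \<notin> W \<Longrightarrow>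
    connset v (insert (tgt (V v) \<epsilon>') W)"

lemma connset: "connset v W \<Longrightarrow> W \<subseteq> inf_verts v \<and> W \<noteq> {}"
  by (induction rule: connset.induct) auto

lemma src_notin_VA: "v \<in> verts U \<Longrightarrow> \<epsilon> \<in> edges (V v) \<Longrightarrow> tgt (V v) \<epsilon> \<in> inf_verts v \<Longrightarrow> (v, src (V v) \<epsilon>) \<notin> VA"
  using bipV by (auto simp: inf_verts_def)

lemma connset_finite: "v \<in> verts U \<Longrightarrow> connset v W \<Longrightarrow> finite W"
  using connset finite_inf_verts finite_subset by blast

lemma slack_single: "slack v {x} = int (card (half v x)) - int (card (fst ` half v x))"
  by (simp add: slack_def nbrs_def)

lemma slack_nonneg:
  assumes v: "v \<in> verts U" shows "connset v W \<Longrightarrow> 0 \<le> slack v W"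
proof (induction rule: connset.induct)
  case (single x)
  then show ?case using card_image_le[OF finite_half, of fst v x] by (simp add: slack_single)
next
  case (insert W \<epsilon> \<epsilon>')
  have "slack v W \<le> slack v (insert (tgt (V v) \<epsilon>') W)"
    by (rule slack_insert(1)[OF v connset_finite[OF v insert(1)] insert(2,3)])
      (use insert src_notin_VA[OF v] in auto)
  then show ?case using insert by linarith
qed

text \<open>Since slack never decreases along the build-up, once the full set has slack 0 every
  connected subset has slack 0 too. The build-up reaches the full set because the vertex space is
  connected.\<close>

lemma connset_extend:
  assumes v: "v \<in> verts U" and W: "connset v W"
  shows "slack v W \<le> slack v (inf_verts v) \<and> connset v (inf_verts v)"
  using W
proof (induction "card (inf_verts v - W)" arbitrary: W rule: less_induct)
  case less
  note W = connset[OF less.prems]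
  show ?case
  proof (cases "\<exists>\<epsilon>\<in>edges (V v). \<exists>\<epsilon>'\<in>edges (V v). src (V v) \<epsilon> = src (V v) \<epsilon>' \<and> tgt (V v) \<epsilon> \<in> W \<and>
      tgt (V v) \<epsilon>' \<in> inf_verts v \<and> tgt (V v) \<epsilon>' \<notin> W")
    case True
    then obtain \<epsilon> \<epsilon>' where e: "\<epsilon> \<in> edges (V v)" "\<epsilon>' \<in> edges (V v)" "src (V v) \<epsilon> = src (V v) \<epsilon>'"
      "tgt (V v) \<epsilon> \<in> W" "tgt (V v) \<epsilon>' \<in> inf_verts v" "tgt (V v) \<epsilon>' \<notin> W" by blast
    let ?W = "insert (tgt (V v) \<epsilon>') W"
    have c: "connset v ?W" by (rule connset.insert[OF less.prems e])
    have "inf_verts v - ?W \<subset> inf_verts v - W" using e by blast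
    then have "card (inf_verts v - ?W) < card (inf_verts v - W)"
      using finite_inf_verts[OF v] by (intro psubset_card_mono) auto
    from less.hyps[OF this c] have "slack v ?W \<le> slack v (inf_verts v) \<and> connset v (inf_verts v)" .
    moreover have "slack v W \<le> slack v ?W"
      by (rule slack_insert(1)[OF v connset_finite[OF v less.prems] e(1,2,3) _ e(4) refl e(6)])
        (use e W src_notin_VA[OF v e(1)] in auto)
    ultimately show ?thesis by simp
  next
    case False
    \<comment> \<open>When no vertex can be added, W together with its adjacent r-vertices is closed
      under edges, hence is the whole vertex space.\<close>
    define Z where "Z = W \<union> {src (V v) \<epsilon> | \<epsilon>. \<epsilon> \<in> edges (V v) \<and> tgt (V v) \<epsilon> \<in> W}"
    have step: "tgt (V v) \<delta> \<in> Z" if d: "\<delta> \<in> edges (V v)" "src (V v) \<delta> \<in> Z" for \<delta>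
    proof (cases "src (V v) \<delta> \<in> W")
      case True
      then have "tgt (V v) (rv (V v) \<delta>) \<in> W" "rv (V v) \<delta> \<in> edges (V v)" "src (V v) (rv (V v) \<delta>) = tgt (V v) \<delta>"
        using Vd[OF v] that by auto
      then have "\<exists>\<epsilon>. tgt (V v) \<delta> = src (V v) \<epsilon> \<and> \<epsilon> \<in> edges (V v) \<and> tgt (V v) \<epsilon> \<in> W" by metis
      then show ?thesis unfolding Z_def by blast
    next
      case F: False
      then obtain \<epsilon> where \<epsilon>: "\<epsilon> \<in> edges (V v)" "tgt (V v) \<epsilon> \<in> W" "src (V v) \<epsilon> = src (V v) \<delta>"
        using d(2) by (auto simp: Z_def)
      then have "(v, src (V v) \<delta>) \<notin> VA" using src_notin_VA[OF v \<epsilon>(1)] W by auto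
      then have "tgt (V v) \<delta> \<in> inf_verts v" using bipV[OF v that(1)] Vd(6)[OF v that(1)] by (auto simp: inf_verts_def)
      then have "tgt (V v) \<delta> \<in> W" using False \<epsilon> that(1) by metis
      then show ?thesis by (simp add: Z_def)
    qed
    obtain x where x: "x \<in> W" using W by auto
    have "y \<in> Z" if "y \<in> verts (V v)" for y
    proof -
      have "(\<lambda>a b. \<exists>e\<in>edges (V v). src (V v) e = a \<and> tgt (V v) e = b)\<^sup>*\<^sup>* x y"
        using conV[OF v] that x W unfolding connected_graph_def inf_verts_def by blast
      then show ?thesis
      proof (induction rule: rtranclp_induct)
        case base then show ?case using x by (simp add: Z_def)
      next
        case (step a b) then show ?case using \<open>\<And>\<delta>. \<lbrakk>\<delta> \<in> edges (V v); src (V v) \<delta> \<in> Z\<rbrakk> \<Longrightarrow> tgt (V v) \<delta> \<in> Z\<close> by auto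
      qed
    qed
    moreover have "z \<in> W" if "z \<in> Z" "z \<in> inf_verts v" for z
      using that src_notin_VA[OF v] W unfolding Z_def by (auto simp: inf_verts_def)
    ultimately have "inf_verts v \<subseteq> W" by (auto simp: inf_verts_def)
    then have "W = inf_verts v" using W by auto
    then show ?thesis using less.prems by simp
  qed
qed

lemma inf_verts_nonempty: assumes v: "v \<in> verts U" shows "inf_verts v \<noteq> {}"
proof -
  obtain x where x: "x \<in> verts (V v)" using conV[OF v] by (auto simp: connected_graph_def)
  show ?thesis
  proof (cases "(v, x) \<in> VA")
    case True then show ?thesis using x by (auto simp: inf_verts_def)
  next
    case False
    then obtain \<epsilon> where "\<epsilon> \<in> edges (V v)" "src (V v) \<epsilon> = x" using B_edge[OF v x] by blast
    then have "tgt (V v) \<epsilon> \<in> inf_verts v" using bipV[OF v] Vd(6)[OF v] False by (auto simp: inf_verts_def)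
    then show ?thesis by blast
  qed
qed

lemma connset_inf_verts: assumes v: "v \<in> verts U" shows "connset v (inf_verts v)"
proof -
  obtain x where "x \<in> inf_verts v" using inf_verts_nonempty[OF v] by auto
  then show ?thesis using connset_extend[OF v connset.single] by blast
qed

text \<open>No edge space lies over r-vertices alone: at an r-vertex every half-edge belongs to a
  lift of a vertical edge, so the edge space has an edge there, and one end of that edge is in the
  large component.\<close>

lemma nbrs_inf_verts: assumes v: "v \<in> verts U" shows "nbrs v (inf_verts v) = {e \<in> edges U. tgt U e = v}"
proof
  show "nbrs v (inf_verts v) \<subseteq> {e \<in> edges U. tgt U e = v}" by (auto simp: nbrs_def half_def)
  show "{e \<in> edges U. tgt U e = v} \<subseteq> nbrs v (inf_verts v)"
  proof
    fix e assume "e \<in> {e \<in> edges U. tgt U e = v}"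
    then have e: "e \<in> edges U" "tgt U e = v" by auto
    obtain y where y: "y \<in> verts (E e)" using conE[OF e(1)] by (auto simp: connected_graph_def)
    have "\<exists>y\<in>verts (E e). (v, tv X e y) \<in> VA"
    proof (rule ccontr)
      assume no: "\<not> (\<exists>y\<in>verts (E e). (v, tv X e y) \<in> VA)"
      then have B: "(v, tv X e y) \<notin> VA" using y by blast
      obtain \<epsilon> where \<epsilon>: "\<epsilon> \<in> edges (V v)" "src (V v) \<epsilon> = tv X e y"
        using B_edge[OF v _ B] tau(1)[OF e(1) y] e(2) by auto
      have "(e, y) \<in> half v (src (V v) \<epsilon>)" using e y \<epsilon>(2) by (auto simp: half_def)
      then obtain d where d: "d \<in> edges (E e)" "y = src (E e) d"
        using half_B(1)[OF v \<epsilon>(1)] B \<epsilon>(2) by (auto simp: mem_pre)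
      then have "(e, tgt (E e) d) \<in> EA \<or> (e, src (E e) d) \<in> EA" using bip[OF e(1)] by blast
      then show False using no EA_VA[OF e(1)] Ed(6,7)[OF e(1) d(1)] e(2) by blast
    qed
    then obtain y where "y \<in> verts (E e)" "(v, tv X e y) \<in> VA" by blast
    then show "e \<in> nbrs v (inf_verts v)" using e tau(1)[OF e(1)] by (force simp: nbrs_def inf_verts_def half_def)
  qed
qed

text \<open>Handshake formula in both graphs: twice the Euler characteristic is the sum of 2 -
  valence over the vertices. The r-vertices have valence 2 and drop out.\<close>

lemma sum_slack: "(\<Sum>v\<in>verts U. slack v (inf_verts v)) = 2 * chi U - 2 * chi (hgraph X)"
proof -
  let ?D = "\<lambda>v. {e \<in> edges U. tgt U e = v}"
  have A: "(\<Sum>v\<in>verts U. int (card (?D v))) = int (card (edges U))"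
    using sum.group[of "edges U" "verts U" "tgt U" "\<lambda>_. 1 :: int"] Ud by auto
  let ?g = "\<lambda>e. tgt (hgraph X) e" and ?h = "\<lambda>p. int (card (half (fst p) (snd p)))"
  have hf: "{e \<in> edges (hgraph X). ?g e = p} = half (fst p) (snd p)" for p
    by (cases p) (auto simp: hgraph_def half_def)
  have B: "(\<Sum>p\<in>verts (hgraph X). ?h p) = int (card (edges (hgraph X)))"
  proof -
    have "?g ` edges (hgraph X) \<subseteq> verts (hgraph X)" using wf_graphD(6)[OF wf_hgraph] by blast
    then show ?thesis using sum.group[of "edges (hgraph X)" "verts (hgraph X)" ?g "\<lambda>_. 1 :: int"]
        finite_hgraph by (simp add: hf)
  qed
  have "(\<Sum>p\<in>verts (hgraph X). ?h p - 2) = (\<Sum>v\<in>verts U. \<Sum>x\<in>verts (V v). int (card (half v x)) - 2)"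
    using sum.Sigma[of "verts U" "\<lambda>v. verts (V v)" "\<lambda>v x. int (card (half v x)) - 2"] Ud Vd
    by (simp add: hgraph_def Sigma_def split_def) (rule sum.cong, auto)
  also have "\<dots> = (\<Sum>v\<in>verts U. \<Sum>x\<in>inf_verts v. int (card (half v x)) - 2)"
  proof (rule sum.cong[OF refl])
    fix v assume v: "v \<in> verts U"
    have "int (card (half v x)) - 2 = 0" if "x \<in> verts (V v) - inf_verts v" for x
    proof -
      have x: "x \<in> verts (V v)" "(v, x) \<notin> VA" using that by (auto simp: inf_verts_def)
      then obtain \<epsilon> where "\<epsilon> \<in> edges (V v)" "src (V v) \<epsilon> = x" using B_edge[OF v] by blast
      then show ?thesis using half_B(2)[OF v] x by auto
    qed
    then show "(\<Sum>x\<in>verts (V v). int (card (half v x)) - 2) = (\<Sum>x\<in>inf_verts v. int (card (half v x)) - 2)"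
      using Vd(1)[OF v] by (intro sum.mono_neutral_right) (auto simp: inf_verts_def)
  qed
  finally have C: "(\<Sum>v\<in>verts U. \<Sum>x\<in>inf_verts v. int (card (half v x)) - 2)
      = int (card (edges (hgraph X))) - 2 * int (card (verts (hgraph X)))"
    using B by (simp add: sum_subtractf)
  have "(\<Sum>v\<in>verts U. slack v (inf_verts v)) = (\<Sum>v\<in>verts U. 2 + (\<Sum>x\<in>inf_verts v. int (card (half v x)) - 2) - int (card (?D v)))"
    by (rule sum.cong[OF refl]) (simp add: slack_def nbrs_inf_verts)
  also have "\<dots> = 2 * int (card (verts U)) + (\<Sum>v\<in>verts U. \<Sum>x\<in>inf_verts v. int (card (half v x)) - 2)
      - (\<Sum>v\<in>verts U. int (card (?D v)))"
    by (simp add: sum.distrib sum_subtractf)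
  finally show ?thesis using A C two_chi[OF wfU] two_chi[OF wf_hgraph] by simp
qed

text \<open>Selects, between \<open>s\<close> and \<open>flip s\<close>, the label whose side t = 1
  lies in the large component.\<close>

definition upward :: "('b \<times> 'd) set" where "upward = {s \<in> squares. head_edge s \<in> EA}"

end

section \<open>Rigidity when the Euler characteristics agree\<close>

locale bip_tight = bip +
  assumes euler: "chi (hgraph X) = chi (UG X)"
begin

lemma slack_0:
  assumes v: "v \<in> verts U" and W: "connset v W" shows "slack v W = 0"
proof -
  have "\<forall>v\<in>verts U. slack v (inf_verts v) = 0"
  proof -
    have "(\<Sum>v\<in>verts U. slack v (inf_verts v)) = 0" using sum_slack euler by simp
    then show ?thesis
      using sum_nonneg_eq_0_iff[OF Ud(1), of "\<lambda>v. slack v (inf_verts v)"] slack_nonneg connset_inf_verts by blast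
  qed
  then show ?thesis using connset_extend[OF v W] slack_nonneg[OF v W] v by fastforce
qed

lemma half_inj_A:
  assumes v: "v \<in> verts U" and x: "x \<in> inf_verts v" and h: "(e, y) \<in> half v x" "(e, y') \<in> half v x"
  shows "y = y'"
proof -
  have "card (fst ` half v x) = card (half v x)"
    using slack_0[OF v connset.single[OF x]] by (simp add: slack_single)
  then have "inj_on fst (half v x)" by (rule eq_card_imp_inj_on[OF finite_half])
  then show ?thesis using inj_onD[of fst _ "(e, y)" "(e, y')"] h by simp
qed

text \<open>In the large component, slack 0 of a singleton puts distinct half-edges into distinct
  edge spaces. At an r-vertex two half-edges of one edge space come from two lifts of a vertical
  edge, and the comparison is made at its other end, in the large component.\<close>

lemma tv_inj:
  assumes e: "e \<in> edges U" and y: "y \<in> verts (E e)" "y' \<in> verts (E e)" and eq: "tv X e y = tv X e y'"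
  shows "y = y'"
proof -
  let ?v = "tgt U e"
  have v: "?v \<in> verts U" using Ud(6)[OF e] .
  have h: "(e, y) \<in> half ?v (tv X e y)" "(e, y') \<in> half ?v (tv X e y)" using e y eq by (auto simp: half_def)
  show ?thesis
  proof (cases "tv X e y \<in> inf_verts ?v")
    case True then show ?thesis using half_inj_A[OF v _ h] by blast
  next
    case False
    then have B: "(?v, tv X e y) \<notin> VA" using tau(1)[OF e y(1)] by (auto simp: inf_verts_def)
    then obtain \<epsilon> where \<epsilon>: "\<epsilon> \<in> edges (V ?v)" "src (V ?v) \<epsilon> = tv X e y"
      using B_edge[OF v tau(1)[OF e y(1)]] by blast
    obtain d d' where d: "(e, d) \<in> pre ?v \<epsilon>" "y = src (E e) d" "(e, d') \<in> pre ?v \<epsilon>" "y' = src (E e) d'"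
      using half_B(1)[OF v \<epsilon>(1)] B \<epsilon>(2) h by auto
    have "tgt (V ?v) \<epsilon> \<in> inf_verts ?v" using bipV[OF v \<epsilon>(1)] B \<epsilon>(2) Vd(6)[OF v \<epsilon>(1)] by (auto simp: inf_verts_def)
    moreover have "(e, tgt (E e) d) \<in> half ?v (tgt (V ?v) \<epsilon>)" "(e, tgt (E e) d') \<in> half ?v (tgt (V ?v) \<epsilon>)"
      using half_tgt(1)[OF v \<epsilon>(1)] d by force+
    ultimately have "tgt (E e) d = tgt (E e) d'" using half_inj_A[OF v] by blast
    then have "d = d'" using te_inj[OF e] d by (auto simp: mem_pre)
    then show ?thesis using d by simp
  qed
qed

lemma fst_partner: assumes s: "(e, d) \<in> squares" shows "fst (partner (e, d)) \<noteq> e"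
proof
  assume f: "fst (partner (e, d)) = e"
  obtain d' where d': "partner (e, d) = (e, d')" using f by (cases "partner (e, d)") auto
  have e: "e \<in> edges U" "d \<in> edges (E e)" "d' \<in> edges (E e)" "te X e d' = te X e d"
    using s partner[OF s] d' by (auto simp: mem_squares)
  then have "tgt (E e) d' = tgt (E e) d" using tv_inj[OF e(1)] Ed(6)[OF e(1)] tau(4)[OF e(1)] by metis
  then have "d' = d" using te_inj e by metis
  then show False using pre_partner(2)[OF s] d' by simp
qed

lemma strands_partner: "(e, d) \<in> squares \<Longrightarrow> strands (tgt U e) (te X e d) = {e, fst (partner (e, d))}"
  using pre_partner(1)[of "(e, d)"] by (simp add: strands_def)

text \<open>At an r-vertex both cycle edges have the strands of that vertex. For a vertex x' of the
  large component, let W consist of the other such vertices on the cycle. W is connected along the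
  cycle, and x' can be attached to it through either of its two cycle edges. The equality case of
  \<open>slack_insert\<close> then identifies the edge spaces shared by x' and W with the strands of
  each of the two edges.\<close>

lemma cycle_strands_step:
  assumes v: "v \<in> verts U" and c: "cycle (V v) n c"
  shows "strands v (c (Suc i)) = strands v (c i)"
proof -
  have ce: "c j \<in> edges (V v)" and ct: "tgt (V v) (c j) = src (V v) (c (Suc j))"
    and cd: "i mod n = j mod n \<Longrightarrow> c i = c j"
    and cm: "tgt (V v) (c i) = tgt (V v) (c j) \<longleftrightarrow> i mod n = j mod n" and n0: "0 < n" for i j
    using c unfolding cycle_def by blast+
  note rvs = Vd(3,8,9)[OF v ce]
  have B: "strands v (c (Suc i)) = strands v (c i)" if "(v, tgt (V v) (c i)) \<notin> VA" for i
  proof -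
    have "strands v (c (Suc i)) = fst ` half v (tgt (V v) (c i))" using strands_B[OF v ce, of "Suc i"] that ct[of i] by simp
    also have "\<dots> = strands v (rv (V v) (c i))" using strands_B[OF v rvs(1)[of i]] rvs(3)[of i] that by simp
    finally show ?thesis using strands_rv[OF v ce] by simp
  qed
  show ?thesis
  proof (cases "(v, tgt (V v) (c i)) \<in> VA")
    case False then show ?thesis by (rule B)
  next
    case True
    have par: "(v, tgt (V v) (c (i + l))) \<in> VA \<longleftrightarrow> even l" for l
    proof (induction l)
      case (Suc l) then show ?case using bipV[OF v ce, of "Suc (i + l)"] ct[of "i + l"] by simp
    qed (use True in simp)
    have per: "c (i + n) = c i" by (rule cd) simp
    \<comment> \<open>The vertices alternate between the large component and the circles, so the
      cycle has even length.\<close>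
    then have ev: "even n" using par[of n] True by simp
    define x' where "x' = tgt (V v) (c i)"
    \<comment> \<open>Vertices counted from x' = \<open>t 0\<close>; those with even index lie in
      the large component.\<close>
    define t where "t j = tgt (V v) (c (i + j))" for j
    have tA: "t j \<in> inf_verts v" if "even j" for j
      using par[of j] that Vd(6)[OF v ce] by (auto simp: inf_verts_def t_def)
    have tne: "t j \<noteq> t l" if "j < l" "l < j + n" for j l
    proof
      assume "t j = t l"
      then have "(i + j) mod n = (i + l) mod n" using cm by (simp add: t_def)
      then have "n dvd (i + l) - (i + j)" by (metis mod_eq_dvd_iff_nat nat_add_left_cancel_le less_imp_le_nat that(1))
      then show False using that by (auto dest: dvd_imp_le)
    qed
    have conn: "connset v ((\<lambda>l. t (2 * l)) ` {1..k})" if "1 \<le> k" "2 * k < n" for k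
      using that
    proof (induction k)
      case (Suc k)
      show ?case
      proof (cases "k = 0")
        case True then show ?thesis using connset.single[OF tA[of 2]] by simp
      next
        case False
        have IH: "connset v ((\<lambda>l. t (2 * l)) ` {1..k})" using Suc False by simp
        let ?\<epsilon> = "rv (V v) (c (i + Suc (2 * k)))" and ?\<epsilon>' = "c (i + 2 * Suc k)"
        have "connset v (insert (tgt (V v) ?\<epsilon>') ((\<lambda>l. t (2 * l)) ` {1..k}))"
        proof (rule connset.insert[OF IH rvs(1) ce])
          show "src (V v) ?\<epsilon> = src (V v) ?\<epsilon>'" using rvs(3) ct[of "i + Suc (2 * k)"] by simp
          have "tgt (V v) ?\<epsilon> = t (2 * k)" using rvs(2) ct[of "i + 2 * k"] by (simp add: t_def)
          then show "tgt (V v) ?\<epsilon> \<in> (\<lambda>l. t (2 * l)) ` {1..k}" using False by auto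
          show "tgt (V v) ?\<epsilon>' \<in> inf_verts v" using tA[of "2 * Suc k"] by (simp add: t_def)
          show "tgt (V v) ?\<epsilon>' \<notin> (\<lambda>l. t (2 * l)) ` {1..k}"
          proof
            assume "tgt (V v) ?\<epsilon>' \<in> (\<lambda>l. t (2 * l)) ` {1..k}"
            then obtain l where "l \<in> {1..k}" "t (2 * Suc k) = t (2 * l)" by (auto simp: t_def)
            then show False using tne[of "2 * l" "2 * Suc k"] Suc.prems by auto
          qed
        qed
        then show ?thesis by (simp add: t_def atLeastAtMostSuc_conv)
      qed
    qed simp
    \<comment> \<open>In a bigon W would be empty; there the two edges meet a second time, at an
      r-vertex, where \<open>B\<close> applies.\<close>
    show ?thesis
    proof (cases "n = 2")
      case True
      have "strands v (c (Suc (Suc i))) = strands v (c (Suc i))" by (rule B) (use par[of 1] in simp)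
      then show ?thesis using per True by simp
    next
      case False
      \<comment> \<open>The remaining vertices of the large component are \<open>t 2\<close>, ...,
        \<open>t (2 * k)\<close>, whence n = 2k + 2.\<close>
      define k where "k = (n - 2) div 2"
      have nk: "n = 2 * k + 2" "1 \<le> k" using ev n0 False by (auto simp: k_def elim!: evenE)
      let ?W = "(\<lambda>l. t (2 * l)) ` {1..k}"
      have W: "connset v ?W" by (rule conn) (use nk in auto)
      have xW: "x' \<notin> ?W"
      proof
        assume "x' \<in> ?W"
        then obtain l where "l \<in> {1..k}" "t 0 = t (2 * l)" by (auto simp: t_def x'_def)
        then show False using tne[of 0 "2 * l"] nk by auto
      qed
      have x'A: "x' \<in> inf_verts v" using tA[of 0] by (simp add: t_def x'_def)
      have t2: "t 2 \<in> ?W" "t (2 * k) \<in> ?W" using nk image_eqI[of "t 2" "\<lambda>l. t (2 * l)" 1 "{1..k}"] by auto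
      have B1: "(v, tgt (V v) (c (Suc i))) \<notin> VA" "(v, tgt (V v) (c (i + Suc (2 * k)))) \<notin> VA"
        using par[of 1] par[of "Suc (2 * k)"] by simp_all
      have e1: "src (V v) (c (Suc (Suc i))) = src (V v) (rv (V v) (c (Suc i)))"
        "tgt (V v) (c (Suc (Suc i))) = t 2" "tgt (V v) (rv (V v) (c (Suc i))) = x'"
        using rvs ct[of "Suc i"] ct[of i] by (simp_all add: t_def x'_def)
      have e2: "src (V v) (rv (V v) (c (i + Suc (2 * k)))) = src (V v) (c i)"
        "tgt (V v) (rv (V v) (c (i + Suc (2 * k)))) = t (2 * k)"
        using rvs ct[of "i + Suc (2 * k)"] ct[of "i + 2 * k"] per nk(1) by (simp_all add: t_def)
      have ins: "connset v (insert x' ?W)"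
        using connset.insert[OF W ce rvs(1) e1(1)] e1 t2 x'A xW by simp
      have sl: "slack v (insert x' ?W) = slack v ?W" using slack_0[OF v W] slack_0[OF v ins] by simp
      have "fst ` half v x' \<inter> nbrs v ?W = strands v (rv (V v) (c (Suc i)))"
        by (rule slack_insert(2)[OF v connset_finite[OF v W] ce rvs(1) e1(1) _ _ e1(3) xW sl])
          (use e1 t2 B1(1) ct[of "Suc i"] in simp_all)
      moreover have "fst ` half v x' \<inter> nbrs v ?W = strands v (c i)"
        by (rule slack_insert(2)[OF v connset_finite[OF v W] rvs(1) ce e2(1) _ _ _ xW sl])
          (use e2 t2 B1(2) rvs in \<open>simp_all add: x'_def\<close>)
      ultimately show ?thesis using strands_rv[OF v ce] by simp
    qed
  qed
qed

lemma cycle_strands: "v \<in> verts U \<Longrightarrow> cycle (V v) n c \<Longrightarrow> strands v (c i) = strands v (c 0)"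
  by (induction i) (simp_all add: cycle_strands_step)

text \<open>Vertex injectivity makes the image in the vertex space a simple cycle again. As its
  edges share their strands, the partners of all its lifts lie in one edge space, where injectivity
  reassembles them into a cycle.\<close>

lemma cycle_flow:
  assumes e: "e \<in> edges U" and c: "cycle (E e) n c"
  obtains e' c' where "e' \<in> edges U" "tgt U e' = tgt U e" "\<And>j. partner (e, c j) = (e', c' j)" "cycle (E e') n c'"
proof -
  let ?v = "tgt U e"
  have v: "?v \<in> verts U" using Ud(6)[OF e] .
  have ce: "c j \<in> edges (E e)" and ct: "tgt (E e) (c j) = src (E e) (c (Suc j))"
    and cr: "c (Suc j) \<noteq> rv (E e) (c j)" and cd: "i mod n = j mod n \<Longrightarrow> c i = c j"
    and cm: "tgt (E e) (c i) = tgt (E e) (c j) \<longleftrightarrow> i mod n = j mod n" and n0: "0 < n" for i j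
    using c unfolding cycle_def by blast+
  have te_eqD: "d = d'" if "e \<in> edges U" "d \<in> edges (E e)" "d' \<in> edges (E e)" "te X e d = te X e d'" for e d d'
  proof -
    have "tgt (E e) d = tgt (E e) d'"
      using tv_inj[OF that(1) Ed(6)[OF that(1,2)] Ed(6)[OF that(1,3)]] that tau(4)[OF that(1)] by metis
    then show ?thesis using te_inj that by metis
  qed
  have cV: "cycle (V ?v) n (\<lambda>j. te X e (c j))"
    unfolding cycle_def
  proof (intro conjI allI impI)
    fix i j
    show "te X e (c j) \<in> edges (V ?v)" using tau(2)[OF e ce] .
    show "tgt (V ?v) (te X e (c j)) = src (V ?v) (te X e (c (Suc j)))"
      using tau(4,5)[OF e ce] ct by simp
    show "te X e (c (Suc j)) \<noteq> rv (V ?v) (te X e (c j))"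
      using te_eqD[OF e ce Ed(3)[OF e ce], of "Suc j" j] cr[of j] tau(3)[OF e ce, of j] by metis
    show "te X e (c i) = te X e (c j)" if "i mod n = j mod n" using cd[OF that] by simp
    show "tgt (V ?v) (te X e (c i)) = tgt (V ?v) (te X e (c j)) \<longleftrightarrow> i mod n = j mod n"
      using tau(4)[OF e ce] tv_inj[OF e Ed(6)[OF e ce] Ed(6)[OF e ce], of i j] cm[of i j] by metis
  qed (rule n0)
  define e' where "e' = fst (partner (e, c 0))"
  define c' where "c' j = snd (partner (e, c j))" for j
  have sq: "(e, c j) \<in> squares" for j using e ce by (simp add: mem_squares)
  have k: "partner (e, c j) = (e', c' j)" for j
  proof -
    have "{e, fst (partner (e, c j))} = {e, e'}"
      using cycle_strands[OF v cV, of j] strands_partner[OF sq] by (simp add: e'_def)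
    then have "fst (partner (e, c j)) = e'" using fst_partner[OF sq, of j] by (auto simp: doubleton_eq_iff)
    then show ?thesis by (simp add: c'_def prod_eq_iff)
  qed
  have e': "e' \<in> edges U" "c' j \<in> edges (E e')" "tgt U e' = ?v" "te X e' (c' j) = te X e (c j)" for j
    using partner[OF sq] k by (auto simp: mem_squares)
  have t': "tv X e' (tgt (E e') (c' j)) = tgt (V ?v) (te X e (c j))"
    "tv X e' (src (E e') (c' j)) = src (V ?v) (te X e (c j))" for j
    using tau(4,5)[OF e'(1,2)] e'(3,4) by simp_all
  have cV': "tgt (V ?v) (te X e (c j)) = src (V ?v) (te X e (c (Suc j)))" "te X e (c (Suc j)) \<noteq> rv (V ?v) (te X e (c j))"
    "tgt (V ?v) (te X e (c i)) = tgt (V ?v) (te X e (c j)) \<longleftrightarrow> i mod n = j mod n" for i j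
    using cV unfolding cycle_def by blast+
  have "cycle (E e') n c'"
    unfolding cycle_def
  proof (intro conjI allI impI)
    fix i j
    show "c' j \<in> edges (E e')" by (rule e'(2))
    show "tgt (E e') (c' j) = src (E e') (c' (Suc j))"
      by (rule tv_inj[OF e'(1) Ed(6)[OF e'(1,2)] Ed(7)[OF e'(1,2)]]) (simp add: t' cV'(1))
    show "c' (Suc j) \<noteq> rv (E e') (c' j)"
      using cV'(2)[of j] e'(3,4) tau(3)[OF e'(1,2), of j] by metis
    show "c' i = c' j" if "i mod n = j mod n" using cd[OF that] by (simp add: c'_def)
    show "tgt (E e') (c' i) = tgt (E e') (c' j) \<longleftrightarrow> i mod n = j mod n"
      using cV'(3)[of i j] t'(1) tv_inj[OF e'(1) Ed(6)[OF e'(1,2)] Ed(6)[OF e'(1,2)], of i j] by metis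
  qed (rule n0)
  then show thesis using that e' k by blast
qed


text \<open>Squares over two consecutive edges of a cycle, both oriented towards the common vertex
  so that their head edges agree. Keeping the whole cycle in the relation is what makes it stable
  under \<open>advance\<close>.\<close>

definition parallel :: "'b \<times> 'd \<Rightarrow> 'b \<times> 'd \<Rightarrow> bool" where
  "parallel s s' \<longleftrightarrow> (\<exists>e n c i. e \<in> edges U \<and> cycle (E e) n c \<and> s = (e, c i) \<and>
     s' = (e, rv (E e) (c (Suc i))) \<and> (e, tgt (E e) (c i)) \<in> EA)"

lemma parallelD:
  assumes "parallel s s'"
  shows "s \<in> upward" "s' \<in> upward" "s \<noteq> s'" "head_edge s = head_edge s'"
proof -
  obtain e n c i where e: "e \<in> edges U" and c: "cycle (E e) n c" and s: "s = (e, c i)"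
    "s' = (e, rv (E e) (c (Suc i)))" "(e, tgt (E e) (c i)) \<in> EA"
    using assms unfolding parallel_def by blast
  have ce: "c j \<in> edges (E e)" and ct: "tgt (E e) (c j) = src (E e) (c (Suc j))"
    and cr: "c (Suc j) \<noteq> rv (E e) (c j)" for j
    using c unfolding cycle_def by blast+
  show h: "head_edge s = head_edge s'" using s ct[of i] Ed(8)[OF e ce] by (simp add: head_edge_def)
  show "s \<in> upward" using s e ce by (simp add: upward_def mem_squares head_edge_def)
  then show "s' \<in> upward" using h s e Ed(3)[OF e ce] by (simp add: upward_def mem_squares)
  show "s \<noteq> s'" using cr[of i] s Ed(5)[OF e ce, of "Suc i"] by auto
qed

lemma parallel_advance:
  assumes "parallel s s'" shows "parallel (advance s) (advance s')"
proof -
  obtain e n c i where e: "e \<in> edges U" and c: "cycle (E e) n c" and s: "s = (e, c i)"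
    "s' = (e, rv (E e) (c (Suc i)))" "(e, tgt (E e) (c i)) \<in> EA"
    using assms unfolding parallel_def by blast
  have ce: "c j \<in> edges (E e)" for j using c unfolding cycle_def by blast
  obtain e' c' where e': "e' \<in> edges U" "tgt U e' = tgt U e" "\<And>j. partner (e, c j) = (e', c' j)" "cycle (E e') n c'"
    using cycle_flow[OF e c] by metis
  have ce': "c' j \<in> edges (E e')" for j using e'(4) unfolding cycle_def by blast
  have sq: "(e, c j) \<in> squares" for j using e ce by (simp add: mem_squares)
  have sg: "advance (e, c j) = (rv U e', c' j)" for j using sq e'(3) by (simp add: advance_def reverse_def)
  have "advance s' = flip (advance (e, c (Suc i)))"
    using advance_flip[OF sq, of "Suc i"] s(2) by (simp add: flip_def)
  then have s': "advance s' = (rv U e', rv (E (rv U e')) (c' (Suc i)))" by (simp add: sg flip_def)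
  have "tv X e' (tgt (E e') (c' i)) = tv X e (tgt (E e) (c i))"
    using tau(4)[OF e'(1) ce', of i] tau(4)[OF e ce, of i] partner(3)[OF sq, of i] e'(2) e'(3)[of i] by simp
  then have "(e', tgt (E e') (c' i)) \<in> EA"
    using EA_VA[OF e'(1) Ed(6)[OF e'(1) ce']] EA_VA[OF e Ed(6)[OF e ce]] e'(2) s(3) by simp
  then have "(rv U e', tgt (E (rv U e')) (c' i)) \<in> EA"
    using EA_rv[OF e'(1) Ed(6)[OF e'(1) ce']] E_rv[OF e'(1)] by simp
  then show ?thesis unfolding parallel_def
    using s' sg[of i] s(1) Ud(3)[OF e'(1)] e'(4) E_rv[OF e'(1)] by metis
qed

lemma parallel_squares:
  assumes e: "e \<in> edges U" and nt: "\<not> is_tree (E e)"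
  obtains s s' where "s \<in> upward" "s' \<in> upward" "s \<noteq> s'" "\<And>j. head_edge ((advance ^^ j) s) = head_edge ((advance ^^ j) s')"
proof -
  obtain es where "reduced_circuit (E e) es" using nt conE[OF e] by (auto simp: is_tree_def)
  then obtain n c where c: "cycle (E e) n c" using reduced_circuit_imp_cycle[OF wfE[OF e]] by blast
  have ce: "c j \<in> edges (E e)" and ct: "tgt (E e) (c j) = src (E e) (c (Suc j))" for j
    using c unfolding cycle_def by blast+
  obtain i where "(e, tgt (E e) (c i)) \<in> EA"
    using bip[OF e ce, of "Suc 0"] ct[of 0] by metis
  then obtain s s' where p: "parallel s s'" using e c unfolding parallel_def by blast
  have "parallel ((advance ^^ j) s) ((advance ^^ j) s')" for j
    by (induction j) (simp_all add: p parallel_advance)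
  then show thesis using that parallelD p by metis
qed

end

section \<open>Maps out of the realization\<close>

context two_cov
begin

abbreviation "cell_pts \<equiv> topspace (base_top X)"

lemma mem_cell_pts:
  "(VV v x, z) \<in> cell_pts \<longleftrightarrow> v \<in> verts U \<and> x \<in> verts (V v) \<and> z = (0, 0)"
  "(VE v \<epsilon>, z) \<in> cell_pts \<longleftrightarrow> v \<in> verts U \<and> \<epsilon> \<in> edges (V v) \<and> z \<in> {0..1} \<times> {0}"
  "(HE e y, z) \<in> cell_pts \<longleftrightarrow> e \<in> edges U \<and> y \<in> verts (E e) \<and> z \<in> {0..1} \<times> {0}"
  "(SQ e d, z) \<in> cell_pts \<longleftrightarrow> e \<in> edges U \<and> d \<in> edges (E e) \<and> z \<in> {0..1} \<times> {0..1}"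
  by (auto simp: base_top_def cells_def)

lemma glue_cases [consumes 1, case_names VE_VE VE_VV HE_HE HE_VV SQ_flip SQ_reverse SQ_VE SQ_HE]:
  assumes "glue X p q"
    and "\<And>v \<epsilon> t. \<lbrakk>v \<in> verts U; \<epsilon> \<in> edges (V v); 0 \<le> t; t \<le> 1; p = (VE v \<epsilon>, (t, 0));
      q = (VE v (rv (V v) \<epsilon>), (1 - t, 0))\<rbrakk> \<Longrightarrow> P"
    and "\<And>v \<epsilon>. \<lbrakk>v \<in> verts U; \<epsilon> \<in> edges (V v); p = (VE v \<epsilon>, (1, 0)); q = (VV v (tgt (V v) \<epsilon>), (0, 0))\<rbrakk> \<Longrightarrow> P"
    and "\<And>e y s. \<lbrakk>e \<in> edges U; y \<in> verts (E e); 0 \<le> s; s \<le> 1; p = (HE e y, (s, 0)); q = (HE (rv U e) y, (1 - s, 0))\<rbrakk> \<Longrightarrow> P"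
    and "\<And>e y. \<lbrakk>e \<in> edges U; y \<in> verts (E e); p = (HE e y, (1, 0)); q = (VV (tgt U e) (tv X e y), (0, 0))\<rbrakk> \<Longrightarrow> P"
    and "\<And>e d t s. \<lbrakk>e \<in> edges U; d \<in> edges (E e); 0 \<le> t; t \<le> 1; 0 \<le> s; s \<le> 1; p = (SQ e d, (t, s));
      q = (SQ e (rv (E e) d), (1 - t, s))\<rbrakk> \<Longrightarrow> P"
    and "\<And>e d t s. \<lbrakk>e \<in> edges U; d \<in> edges (E e); 0 \<le> t; t \<le> 1; 0 \<le> s; s \<le> 1; p = (SQ e d, (t, s));
      q = (SQ (rv U e) d, (t, 1 - s))\<rbrakk> \<Longrightarrow> P"
    and "\<And>e d t. \<lbrakk>e \<in> edges U; d \<in> edges (E e); 0 \<le> t; t \<le> 1; p = (SQ e d, (t, 1));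
      q = (VE (tgt U e) (te X e d), (t, 0))\<rbrakk> \<Longrightarrow> P"
    and "\<And>e d s. \<lbrakk>e \<in> edges U; d \<in> edges (E e); 0 \<le> s; s \<le> 1; p = (SQ e d, (1, s));
      q = (HE e (tgt (E e) d), (s, 0))\<rbrakk> \<Longrightarrow> P"
  shows P
proof -
  have p: "p \<in> cell_pts" using assms(1) unfolding glue_def by blast
  from assms(1) show P
    unfolding glue_def
  proof (elim conjE disjE exE)
    fix v d t assume *: "p = (VE v d, (t, 0))" "q = (VE v (rv (VS X v) d), (1 - t, 0))"
    show P by (rule assms(2)[OF _ _ _ _ *]) (use p in \<open>auto simp: * mem_cell_pts\<close>)
  next
    fix v d assume *: "p = (VE v d, (1, 0))" "q = (VV v (tgt (VS X v) d), (0, 0))"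
    show P by (rule assms(3)[OF _ _ *]) (use p in \<open>auto simp: * mem_cell_pts\<close>)
  next
    fix e x s assume *: "p = (HE e x, (s, 0))" "q = (HE (rv (UG X) e) x, (1 - s, 0))"
    show P by (rule assms(4)[OF _ _ _ _ *]) (use p in \<open>auto simp: * mem_cell_pts\<close>)
  next
    fix e x assume *: "p = (HE e x, (1, 0))" "q = (VV (tgt (UG X) e) (tv X e x), (0, 0))"
    show P by (rule assms(5)[OF _ _ *]) (use p in \<open>auto simp: * mem_cell_pts\<close>)
  next
    fix e d t s assume *: "p = (SQ e d, (t, s))" "q = (SQ e (rv (ES X e) d), (1 - t, s))"
    show P by (rule assms(6)[OF _ _ _ _ _ _ *]) (use p in \<open>auto simp: * mem_cell_pts\<close>)
  next
    fix e d t s assume *: "p = (SQ e d, (t, s))" "q = (SQ (rv (UG X) e) d, (t, 1 - s))"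
    show P by (rule assms(7)[OF _ _ _ _ _ _ *]) (use p in \<open>auto simp: * mem_cell_pts\<close>)
  next
    fix e d t assume *: "p = (SQ e d, (t, 1))" "q = (VE (tgt (UG X) e) (te X e d), (t, 0))"
    show P by (rule assms(8)[OF _ _ _ _ *]) (use p in \<open>auto simp: * mem_cell_pts\<close>)
  next
    fix e d s assume *: "p = (SQ e d, (1, s))" "q = (HE e (tgt (ES X e) d), (s, 0))"
    show P by (rule assms(9)[OF _ _ _ _ *]) (use p in \<open>auto simp: * mem_cell_pts\<close>)
  qed
qed

lemma glueI:
  "v \<in> verts U \<Longrightarrow> \<epsilon> \<in> edges (V v) \<Longrightarrow> 0 \<le> t \<Longrightarrow> t \<le> 1 \<Longrightarrow> glue X (VE v \<epsilon>, (t, 0)) (VE v (rv (V v) \<epsilon>), (1 - t, 0))"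
  "v \<in> verts U \<Longrightarrow> \<epsilon> \<in> edges (V v) \<Longrightarrow> glue X (VE v \<epsilon>, (1, 0)) (VV v (tgt (V v) \<epsilon>), (0, 0))"
  "e \<in> edges U \<Longrightarrow> y \<in> verts (E e) \<Longrightarrow> 0 \<le> s \<Longrightarrow> s \<le> 1 \<Longrightarrow> glue X (HE e y, (s, 0)) (HE (rv U e) y, (1 - s, 0))"
  "e \<in> edges U \<Longrightarrow> y \<in> verts (E e) \<Longrightarrow> glue X (HE e y, (1, 0)) (VV (tgt U e) (tv X e y), (0, 0))"
  "e \<in> edges U \<Longrightarrow> d \<in> edges (E e) \<Longrightarrow> 0 \<le> t \<Longrightarrow> t \<le> 1 \<Longrightarrow> 0 \<le> s \<Longrightarrow> s \<le> 1 \<Longrightarrow>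
    glue X (SQ e d, (t, s)) (SQ e (rv (E e) d), (1 - t, s))"
  "e \<in> edges U \<Longrightarrow> d \<in> edges (E e) \<Longrightarrow> 0 \<le> t \<Longrightarrow> t \<le> 1 \<Longrightarrow> 0 \<le> s \<Longrightarrow> s \<le> 1 \<Longrightarrow>
    glue X (SQ e d, (t, s)) (SQ (rv U e) d, (t, 1 - s))"
  "e \<in> edges U \<Longrightarrow> d \<in> edges (E e) \<Longrightarrow> 0 \<le> t \<Longrightarrow> t \<le> 1 \<Longrightarrow> glue X (SQ e d, (t, 1)) (VE (tgt U e) (te X e d), (t, 0))"
  "e \<in> edges U \<Longrightarrow> d \<in> edges (E e) \<Longrightarrow> 0 \<le> s \<Longrightarrow> s \<le> 1 \<Longrightarrow> glue X (SQ e d, (1, s)) (HE e (tgt (E e) d), (s, 0))"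
  unfolding glue_def mem_cell_pts using Ud Vd Ed E_rv tau(1,2) by simp_all

lemma glue_cls: "glue X p q \<Longrightarrow> cls X p = cls X q"
  unfolding cls_def by (auto intro: equivclp_trans equivclp_sym r_into_equivclp)

lemma cls_eqD:
  assumes "\<And>p q. glue X p q \<Longrightarrow> f p = f q" "cls X p = cls X q" "p \<in> cell_pts"
  shows "f p = f q"
proof -
  have "p \<in> cls X p" using assms(3) by (simp add: cls_def)
  then have "equivclp (glue X) q p" unfolding assms(2) by (simp add: cls_def)
  then have "f q = f p"
    by (induction rule: equivclp_induct) (auto dest: assms(1))
  then show ?thesis by simp
qed

lemma openin_realization:
  "openin (realization X) W \<longleftrightarrow> W \<subseteq> cls X ` cell_pts \<and> openin (base_top X) {p \<in> cell_pts. cls X p \<in> W}"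
  unfolding realization_def quotient_top_def topology_inverse'[OF istopology_quotient_top] cls_def ..

lemma topspace_realization: "topspace (realization X) = cls X ` cell_pts"
proof
  show "topspace (realization X) \<subseteq> cls X ` cell_pts" using openin_realization by (simp add: topspace_def) blast
  have "{p \<in> cell_pts. cls X p \<in> cls X ` cell_pts} = cell_pts" by auto
  then have "openin (realization X) (cls X ` cell_pts)" by (simp add: openin_realization)
  then show "cls X ` cell_pts \<subseteq> topspace (realization X)" by (rule openin_subset)
qed

lemma quotient_map_cls: "quotient_map (base_top X) (realization X) (cls X)"
  unfolding quotient_map_def topspace_realization by (simp add: openin_realization)

lemma continuous_map_cell:
  assumes "c \<in> cells X"
  shows "continuous_map (top_of_set (cdom c)) (realization X) (\<lambda>z. cls X (c, z))"
proof -
  have "continuous_map (top_of_set (cdom c)) (base_top X) (\<lambda>z. (c, z))"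
    unfolding base_top_def by (rule continuous_map_component_injection[OF assms])
  from continuous_map_compose[OF this quotient_imp_continuous_map[OF quotient_map_cls]]
  show ?thesis by (simp add: o_def)
qed

text \<open>A map given cell by cell and compatible with the gluing descends to the part of the
  realization described by P. Openness of that part is what allows the quotient map to be restricted
  to it.\<close>

lemma realization_lift:
  assumes P: "\<And>p q. glue X p q \<Longrightarrow> P p \<longleftrightarrow> P q"
    and f: "\<And>p q. glue X p q \<Longrightarrow> P p \<Longrightarrow> P q \<Longrightarrow> f p = f q"
    and op: "\<And>c. c \<in> cells X \<Longrightarrow> openin (top_of_set (cdom c)) {z \<in> cdom c. P (c, z)}"
    and cont: "\<And>c. c \<in> cells X \<Longrightarrow> continuous_map (top_of_set {z \<in> cdom c. P (c, z)}) Y (\<lambda>z. f (c, z))"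
  obtains F where "continuous_map (subtopology (realization X) (cls X ` {p \<in> cell_pts. P p})) Y F"
    "\<And>p. p \<in> cell_pts \<Longrightarrow> P p \<Longrightarrow> F (cls X p) = f p"
proof -
  \<comment> \<open>A constant value off P makes \<open>g\<close> invariant under every gluing, so
    the representative of a class may be chosen arbitrarily.\<close>
  define g where "g p = (if P p then f p else undefined)" for p
  define F where "F C = g (SOME p. p \<in> C)" for C
  have F: "F (cls X p) = g p" if "p \<in> cell_pts" for p
  proof -
    have "p \<in> cls X p" using that by (simp add: cls_def)
    then have "(SOME q. q \<in> cls X p) \<in> cls X p" by (metis someI)
    then have "equivclp (glue X) p (SOME q. q \<in> cls X p)" by (simp add: cls_def)
    then have "g (SOME q. q \<in> cls X p) = g p"
      by (induction rule: equivclp_induct) (use P f in \<open>auto simp: g_def\<close>)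
    then show ?thesis by (simp add: F_def)
  qed
  let ?S = "{p \<in> cell_pts. P p}" and ?W = "cls X ` {p \<in> cell_pts. P p}"
  have S: "{p \<in> cell_pts. cls X p \<in> ?W} = ?S"
  proof (intro equalityI subsetI)
    fix p assume "p \<in> {p \<in> cell_pts. cls X p \<in> ?W}"
    then have p: "p \<in> cell_pts" "cls X p \<in> ?W" by simp_all
    then obtain q where q: "P q" "cls X p = cls X q" by blast
    have "P p = P q" by (rule cls_eqD[OF _ q(2) p(1)]) (rule P)
    then show "p \<in> ?S" using p(1) q(1) by simp
  next
    fix p assume "p \<in> ?S"
    then show "p \<in> {p \<in> cell_pts. cls X p \<in> ?W}" by simp
  qed
  have opS: "openin (base_top X) ?S"
  proof -
    have "{z. (c, z) \<in> ?S} = {z \<in> cdom c. P (c, z)}" if "c \<in> cells X" for c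
      using that by (simp add: base_top_def)
    then show ?thesis using op unfolding base_top_def openin_sum_topology by auto
  qed
  have "openin (realization X) ?W" unfolding openin_realization S using opS by auto
  then have q: "quotient_map (subtopology (base_top X) ?S) (subtopology (realization X) ?W) (cls X)"
    by (intro quotient_map_restriction[OF quotient_map_cls S]) simp
  have "continuous_map (subtopology (base_top X) ?S) Y (F \<circ> cls X)"
    unfolding continuous_map_def
  proof (intro conjI allI impI)
    have val: "(F \<circ> cls X) (c, z) = f (c, z)" "c \<in> cells X" "z \<in> {z \<in> cdom c. P (c, z)}" if "(c, z) \<in> ?S" for c z
      using that F[of "(c, z)"] by (auto simp: g_def base_top_def)
    show "F \<circ> cls X \<in> topspace (subtopology (base_top X) ?S) \<rightarrow> topspace Y"
    proof
      fix p assume p: "p \<in> topspace (subtopology (base_top X) ?S)"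
      obtain c z where cz: "p = (c, z)" by (cases p)
      have "(c, z) \<in> ?S" using p cz by auto
      then show "(F \<circ> cls X) p \<in> topspace Y"
        using val[of c z] cont[of c] cz by (auto simp: continuous_map_def)
    qed
    fix T assume T: "openin Y T"
    let ?A = "{p \<in> topspace (subtopology (base_top X) ?S). (F \<circ> cls X) p \<in> T}"
    have A: "?A = {p \<in> ?S. (F \<circ> cls X) p \<in> T}" by auto
    have "openin (base_top X) {p \<in> ?S. (F \<circ> cls X) p \<in> T}"
      unfolding base_top_def openin_sum_topology
    proof (intro conjI ballI)
      show "{p \<in> {p \<in> topspace (sum_topology (\<lambda>c. top_of_set (cdom c)) (cells X)). P p}. (F \<circ> cls X) p \<in> T}
        \<subseteq> Sigma (cells X) (topspace \<circ> (\<lambda>c. top_of_set (cdom c)))" by auto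
      fix c assume c: "c \<in> cells X"
      let ?D = "{z \<in> cdom c. P (c, z)}"
      have "openin (top_of_set ?D) {z \<in> ?D. f (c, z) \<in> T}"
        using cont[OF c] T by (auto simp: continuous_map_def)
      then have "openin (top_of_set (cdom c)) {z \<in> ?D. f (c, z) \<in> T}"
        using op[OF c] by (rule openin_trans)
      moreover have "{z. (c, z) \<in> {p \<in> ?S. (F \<circ> cls X) p \<in> T}} = {z \<in> ?D. f (c, z) \<in> T}"
        using val c by (auto simp: base_top_def)
      ultimately show "openin (top_of_set (cdom c)) {z. (c, z) \<in> {p \<in> {p \<in> topspace (sum_topology
          (\<lambda>c. top_of_set (cdom c)) (cells X)). P p}. (F \<circ> cls X) p \<in> T}}"
        by (simp add: base_top_def)
    qed
    then show "openin (subtopology (base_top X) ?S) ?A"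
      unfolding A by (subst openin_open_subtopology[OF opS]) auto
  qed
  from continuous_compose_quotient_map[OF q this]
  show thesis by (rule that) (simp add: F g_def)
qed

text \<open>A union of connected components of the horizontal graph: an edge belongs to it exactly
  when its end point does.\<close>

definition component :: "('a \<times> 'c) set \<Rightarrow> ('b \<times> 'c) set \<Rightarrow> bool" where
  "component Vs Es \<longleftrightarrow> Vs \<subseteq> verts (hgraph X) \<and> Es \<subseteq> edges (hgraph X) \<and>
     (\<forall>e\<in>edges U. \<forall>y\<in>verts (E e). ((e, y) \<in> Es \<longleftrightarrow> (tgt U e, tv X e y) \<in> Vs) \<and> ((rv U e, y) \<in> Es \<longleftrightarrow> (e, y) \<in> Es))"

text \<open>The preimage of \<open>hreal X Vs Es\<close> in the disjoint union of the cells. A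
  square meets the horizontal graph only in its sides t = 0 and t = 1.\<close>

fun in_part :: "('a \<times> 'c) set \<Rightarrow> ('b \<times> 'c) set \<Rightarrow> ('a, 'b, 'c, 'd) pt \<Rightarrow> bool" where
  "in_part Vs Es (VV v x, _) \<longleftrightarrow> (v, x) \<in> Vs"
| "in_part Vs Es (HE e y, _) \<longleftrightarrow> (e, y) \<in> Es"
| "in_part Vs Es (VE v \<epsilon>, z) \<longleftrightarrow> fst z = 1 \<and> (v, tgt (V v) \<epsilon>) \<in> Vs \<or> fst z = 0 \<and> (v, src (V v) \<epsilon>) \<in> Vs"
| "in_part Vs Es (SQ e d, z) \<longleftrightarrow> fst z = 1 \<and> (e, tgt (E e) d) \<in> Es \<or> fst z = 0 \<and> (e, src (E e) d) \<in> Es"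

lemma component:
  assumes "component Vs Es" "e \<in> edges U" "y \<in> verts (E e)"
  shows "(e, y) \<in> Es \<longleftrightarrow> (tgt U e, tv X e y) \<in> Vs" "(rv U e, y) \<in> Es \<longleftrightarrow> (e, y) \<in> Es"
  using assms unfolding component_def by blast+

lemma in_part_glue:
  assumes c: "component Vs Es" and g: "glue X p q"
  shows "in_part Vs Es p \<longleftrightarrow> in_part Vs Es q"
  using g
proof (cases rule: glue_cases)
  case (VE_VE v \<epsilon> t)
  then show ?thesis using Vd(8,9)[OF VE_VE(1,2)] by auto
next
  case (HE_HE e y s)
  then show ?thesis using component(2)[OF c HE_HE(1,2)] by simp
next
  case (HE_VV e y)
  then show ?thesis using component(1)[OF c HE_VV(1,2)] by simp
next
  case (SQ_flip e d t s)
  then show ?thesis using Ed(8,9)[OF SQ_flip(1,2)] by auto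
next
  case (SQ_reverse e d t s)
  then show ?thesis using component(2)[OF c SQ_reverse(1)] Ed(6,7)[OF SQ_reverse(1,2)] E_rv[OF SQ_reverse(1)] by simp
next
  case (SQ_VE e d t)
  then show ?thesis using component(1)[OF c SQ_VE(1)] Ed(6,7)[OF SQ_VE(1,2)] tau(4,5)[OF SQ_VE(1,2)] by simp
qed simp_all

lemma in_part_iff:
  assumes c: "component Vs Es" and p: "p \<in> cell_pts"
  shows "cls X p \<in> hreal X Vs Es \<longleftrightarrow> in_part Vs Es p"
proof
  let ?G = "{(VV v x, (0, 0)) | v x. (v, x) \<in> Vs} \<union> {(HE e x, (s, 0)) | e x s. (e, x) \<in> Es \<and> s \<in> {0..1}}"
  assume "cls X p \<in> hreal X Vs Es"
  then obtain q where q: "q \<in> ?G" "cls X p = cls X q" unfolding hreal_def by blast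
  have "in_part Vs Es p = in_part Vs Es q" using cls_eqD[OF in_part_glue[OF c] q(2) p] .
  then show "in_part Vs Es p" using q(1) by auto
next
  assume h: "in_part Vs Es p"
  have hVV: "cls X (VV v x, (0, 0)) \<in> hreal X Vs Es" if "(v, x) \<in> Vs" for v x
    using that unfolding hreal_def by blast
  have hHE: "cls X (HE e x, (s, 0)) \<in> hreal X Vs Es" if "(e, x) \<in> Es" "0 \<le> s" "s \<le> 1" for e x s
    using that unfolding hreal_def by auto
  have hVE: "cls X (VE v \<epsilon>, (1, 0)) \<in> hreal X Vs Es" if "v \<in> verts U" "\<epsilon> \<in> edges (V v)" "(v, tgt (V v) \<epsilon>) \<in> Vs" for v \<epsilon>
    using glue_cls[OF glueI(2)[OF that(1,2)]] hVV[OF that(3)] by simp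
  have hSQ: "cls X (SQ e d, (1, s)) \<in> hreal X Vs Es"
    if "e \<in> edges U" "d \<in> edges (E e)" "(e, tgt (E e) d) \<in> Es" "0 \<le> s" "s \<le> 1" for e d s
    using glue_cls[OF glueI(8)[OF that(1,2,4,5)]] hHE[OF that(3-5)] by simp
  obtain a t s where pa: "p = (a, (t, s))" by (cases p) auto
  show "cls X p \<in> hreal X Vs Es"
  proof (cases a)
    case (VV v x) then show ?thesis using pa p h hVV by (simp add: mem_cell_pts)
  next
    case (HE e y) then show ?thesis using pa p h hHE by (simp add: mem_cell_pts)
  next
    case (VE v \<epsilon>)
    then have v: "v \<in> verts U" "\<epsilon> \<in> edges (V v)" "s = 0" using p pa by (auto simp: mem_cell_pts)
    have "cls X (VE v \<epsilon>, (0, 0)) = cls X (VE v (rv (V v) \<epsilon>), (1, 0))"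
      using glue_cls[OF glueI(1)[OF v(1,2), of 0]] by simp
    then show ?thesis
      using hVE[OF v(1,2)] hVE[OF v(1) Vd(3)[OF v(1,2)]] v(3) Vd(8)[OF v(1,2)] h pa VE by auto
  next
    case (SQ e d)
    then have v: "e \<in> edges U" "d \<in> edges (E e)" "0 \<le> s" "s \<le> 1" using p pa by (auto simp: mem_cell_pts)
    have "cls X (SQ e d, (0, s)) = cls X (SQ e (rv (E e) d), (1, s))"
      using glue_cls[OF glueI(5)[OF v(1,2), of 0]] v by simp
    then show ?thesis
      using hSQ[OF v(1,2) _ v(3,4)] hSQ[OF v(1) Ed(3)[OF v(1,2)] _ v(3,4)] Ed(8)[OF v(1,2)] h pa SQ by auto
  qed
qed

lemma openin_not_in_part: "openin (top_of_set (cdom c)) {z \<in> cdom c. \<not> in_part Vs Es (c, z)}"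
proof -
  have *: "openin (top_of_set D) {z \<in> D. \<not> (fst z = 1 \<and> a \<or> fst z = 0 \<and> b)}" for D :: "(real \<times> real) set" and a b
  proof -
    have "open ((if a then {z :: real \<times> real. fst z \<noteq> 1} else UNIV) \<inter> (if b then {z. fst z \<noteq> 0} else UNIV))"
      by (auto intro!: open_Int open_Collect_neq continuous_intros)
    moreover have "{z \<in> D. \<not> (fst z = 1 \<and> a \<or> fst z = 0 \<and> b)} = D \<inter>
      ((if a then {z :: real \<times> real. fst z \<noteq> 1} else UNIV) \<inter> (if b then {z. fst z \<noteq> 0} else UNIV))" by auto
    ultimately show ?thesis by (auto simp: openin_open)
  qed
  have **: "openin (top_of_set D) {z \<in> D. a}" for D :: "(real \<times> real) set" and a
    by (cases a) auto
  show ?thesis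
    by (cases c) (simp_all only: in_part.simps * **)
qed

abbreviation "HV_all \<equiv> verts (hgraph X)"
abbreviation "HE_all \<equiv> edges (hgraph X)"

lemma mem_hgraph: "(v, x) \<in> HV_all \<longleftrightarrow> v \<in> verts U \<and> x \<in> verts (V v)"
  "(e, y) \<in> HE_all \<longleftrightarrow> e \<in> edges U \<and> y \<in> verts (E e)"
  by (auto simp: hgraph_def)

lemma component_hgraph: "component HV_all HE_all"
  unfolding component_def using Ud E_rv tau(1) by (auto simp: mem_hgraph)

lemma in_part_hgraph:
  "(VE v \<epsilon>, z) \<in> cell_pts \<Longrightarrow> in_part HV_all HE_all (VE v \<epsilon>, z) \<longleftrightarrow> fst z = 0 \<or> fst z = 1"
  "(SQ e d, z) \<in> cell_pts \<Longrightarrow> in_part HV_all HE_all (SQ e d, z) \<longleftrightarrow> fst z = 0 \<or> fst z = 1"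
  "(VV v x, z) \<in> cell_pts \<Longrightarrow> in_part HV_all HE_all (VV v x, z)"
  "(HE e y, z) \<in> cell_pts \<Longrightarrow> in_part HV_all HE_all (HE e y, z)"
  using Vd(6,7) Ed(6,7) by (auto simp: mem_cell_pts mem_hgraph)

text \<open>The function \<open>\<phi>\<close> propagates along the strips of squares; the sum runs over the four
labels of a square, which makes it invariant under the reversal identifications.\<close>

lemma strip_function:
  fixes \<phi> :: "'b \<times> 'd \<Rightarrow> complex" and \<theta> :: real
  assumes \<phi>: "\<And>s. s \<in> squares \<Longrightarrow> \<phi> (advance s) = \<phi> s * cis \<theta>"
  obtains F where "continuous_map (subtopology (realization X) (topspace (realization X) - hreal X HV_all HE_all)) euclidean F"
    "\<And>e d t s. e \<in> edges U \<Longrightarrow> d \<in> edges (E e) \<Longrightarrow> 0 < t \<Longrightarrow> t < 1 \<Longrightarrow> 0 \<le> s \<Longrightarrow> s \<le> 1 \<Longrightarrow>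
      F (cls X (SQ e d, (t, s))) =
       of_real (1 + t) * (\<phi> (e, d) * cis (\<theta> * s) + \<phi> (reverse (e, d)) * cis (\<theta> * (1 - s))) +
       of_real (2 - t) * (\<phi> (flip (e, d)) * cis (\<theta> * s) + \<phi> (reverse (flip (e, d))) * cis (\<theta> * (1 - s)))"
proof -
  \<comment> \<open>The weights 1 + t and 2 - t are exchanged by t -> 1 - t, as \<open>flip\<close>
    requires, and for 0 < t < 1 they stay between 1 and 2, away from the origin.\<close>
  define f :: "('a, 'b, 'c, 'd) pt \<Rightarrow> complex" where
    "f p = (case p of
       (SQ e d, (t, s)) \<Rightarrow>
         of_real (1 + t) * (\<phi> (e, d) * cis (\<theta> * s) + \<phi> (reverse (e, d)) * cis (\<theta> * (1 - s))) +
         of_real (2 - t) * (\<phi> (flip (e, d)) * cis (\<theta> * s) + \<phi> (reverse (flip (e, d))) * cis (\<theta> * (1 - s)))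
     | (VE v \<epsilon>, (t, s)) \<Rightarrow> of_real (1 + t) * (\<Sum>x\<in>pre v \<epsilon>. \<phi> x * cis \<theta>)
         + of_real (2 - t) * (\<Sum>x\<in>pre v (rv (V v) \<epsilon>). \<phi> x * cis \<theta>)
     | (_, _) \<Rightarrow> 0)" for p
  let ?P = "\<lambda>p. \<not> in_part HV_all HE_all p"
  \<comment> \<open>Matches squares with vertical edges at time 1: the edge sums over its two lifts,
    while the square sees its own label and its reverse; the latter is \<open>advance\<close> of the
    partner.\<close>
  have partner_sum: "(\<Sum>x\<in>pre (tgt U (fst s)) (te X (fst s) (snd s)). \<phi> x * cis \<theta>) = \<phi> s * cis \<theta> + \<phi> (reverse s)"
    if s: "s \<in> squares" for s
  proof -
    have "\<phi> (reverse s) = \<phi> (partner s) * cis \<theta>" using \<phi>[OF partner(1)[OF s]] by (simp add: advance_def partner s)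
    then show ?thesis using pre_partner[OF s] by auto
  qed
  have inv: "f p = f q" if g: "glue X p q" and P: "?P p" "?P q" for p q
    using g
  proof (cases rule: glue_cases)
    case (VE_VE v \<epsilon> t)
    then show ?thesis using Vd(5)[OF VE_VE(1,2)] by (simp add: f_def)
  next
    case (VE_VV v \<epsilon>)
    then show ?thesis using P in_part_hgraph(1)[of v \<epsilon> "(1, 0)"] by (simp add: mem_cell_pts)
  next
    case (HE_HE e y s)
    then show ?thesis by (simp add: f_def)
  next
    case (HE_VV e y)
    then show ?thesis by (simp add: f_def)
  next
    case (SQ_flip e d t s)
    then have s: "(e, d) \<in> squares" by (simp add: mem_squares)
    have "(e, rv (E e) d) = flip (e, d)" by (simp add: flip_def)
    then show ?thesis using SQ_flip flip(2)[OF s] by (simp add: f_def)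
  next
    case (SQ_reverse e d t s)
    then have s: "(e, d) \<in> squares" by (simp add: mem_squares)
    have "(rv U e, d) = reverse (e, d)" by (simp add: reverse_def)
    then show ?thesis using SQ_reverse reverse(2)[OF s] reverse(2)[OF flip(1)[OF s]] reverse_flip[OF s]
      by (simp add: f_def add.commute)
  next
    case (SQ_VE e d t)
    then have s: "(e, d) \<in> squares" by (simp add: mem_squares)
    have fl: "tgt U (fst (flip (e, d))) = tgt U e"
      "te X (fst (flip (e, d))) (snd (flip (e, d))) = rv (V (tgt U e)) (te X e d)"
      using tau(3)[OF SQ_VE(1,2)] by (simp_all add: flip_def)
    show ?thesis using partner_sum[OF s] partner_sum[OF flip(1)[OF s]] SQ_VE by (simp add: f_def fl)
  next
    case (SQ_HE e d s)
    then show ?thesis using P in_part_hgraph(2)[of e d "(1, s)"] by (simp add: mem_cell_pts)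
  qed
  have cont: "continuous_map (top_of_set {z \<in> cdom c. ?P (c, z)}) euclidean (\<lambda>z. f (c, z))" for c
    by (cases c) (auto simp: f_def split_def intro!: continuous_intros)
  obtain F where F: "continuous_map (subtopology (realization X) (cls X ` {p \<in> cell_pts. ?P p})) euclidean F"
    "\<And>p. p \<in> cell_pts \<Longrightarrow> ?P p \<Longrightarrow> F (cls X p) = f p"
  proof (rule realization_lift[of ?P f euclidean])
    show "?P p \<longleftrightarrow> ?P q" if "glue X p q" for p q using in_part_glue[OF component_hgraph that] by simp
  qed (use inv cont openin_not_in_part in auto)
  have "cls X ` {p \<in> cell_pts. ?P p} = topspace (realization X) - hreal X HV_all HE_all"
    using in_part_iff[OF component_hgraph] by (auto simp: topspace_realization)
  with F show thesis
    by (intro that[of F]) (auto simp: mem_cell_pts f_def in_part_hgraph mem_hgraph)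
qed

end

section \<open>Loops in the horizontal graph\<close>

definition turn :: "complex \<Rightarrow> real" where "turn z = Arg2pi z / (2 * pi)"

lemma turn_bounds: "0 \<le> turn z" "turn z < 1"
  using Arg2pi[of z] by (simp_all add: turn_def)

lemma turn_eq: "z = of_real (norm z) * cis (2 * pi * turn z)"
  using Arg2pi_eq[of z] by (simp add: turn_def cis_conv_exp)

lemma turn_rcis: assumes "0 < r" shows "turn (of_real r * cis (2 * pi * t)) = frac t"
proof -
  have "cis (2 * pi * t) = cis (2 * pi * frac t) * cis (2 * pi * of_int \<lfloor>t\<rfloor>)"
    by (simp add: cis_mult frac_def algebra_simps)
  also have "cis (2 * pi * of_int \<lfloor>t\<rfloor>) = 1"
    by (rule cis_multiple_2pi) simp
  finally have "of_real r * exp (\<i> * of_real (2 * pi * frac t)) = of_real r * cis (2 * pi * t)"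
    by (simp add: cis_conv_exp)
  then have "Arg2pi (of_real r * cis (2 * pi * t)) = 2 * pi * frac t"
    by (rule Arg2pi_unique) (use assms frac_lt_1[of t] frac_ge_0[of t] in auto)
  then show ?thesis by (simp add: turn_def)
qed

lemma turn_cis: "turn (cis (2 * pi * t)) = frac t"
  using turn_rcis[of 1 t] by simp

lemma cis_turn: "z \<in> sphere 0 1 \<Longrightarrow> cis (2 * pi * turn z) = z"
  using turn_eq[of z] by simp

text \<open>\<open>turn\<close> jumps across the positive axis, but a closed L hides the jump. The
  interval maps onto the circle by a quotient map, closed by compactness, and the punctured plane
  then projects radially to the circle.\<close>

lemma continuous_map_turn:
  fixes L :: "real \<Rightarrow> 'x"
  assumes L: "continuous_map (top_of_set {0..1}) Y L" and L01: "L 0 = L 1"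
  shows "continuous_map (top_of_set (- {0})) Y (\<lambda>z. L (turn z))"
proof -
  let ?c = "\<lambda>t. cis (2 * pi * t)"
  have img: "?c ` {0..1} = sphere 0 1"
  proof
    show "sphere 0 1 \<subseteq> ?c ` {0..1}"
    proof
      fix z :: complex assume "z \<in> sphere 0 1"
      then show "z \<in> ?c ` {0..1}"
        using cis_turn turn_bounds[of z] by (intro image_eqI[of _ _ "turn z"]) auto
    qed
  qed auto
  have c: "continuous_map (top_of_set {0..1}) S1 ?c"
    using img by (auto intro!: continuous_intros)
  have "closed_map (top_of_set {0..1}) S1 ?c"
    by (rule continuous_imp_closed_map_gen[OF _ _ c])
      (simp_all add: compact_space_subtopology Hausdorff_imp_kc_space Hausdorff_space_subtopology)
  then have q: "quotient_map (top_of_set {0..1}) S1 ?c"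
    using c img by (intro continuous_closed_imp_quotient_map) auto
  have "continuous_map (top_of_set {0..1}) Y ((\<lambda>z. L (turn z)) \<circ> ?c)"
  proof (rule continuous_map_eq[OF L])
    fix t :: real assume "t \<in> topspace (top_of_set {0..1})"
    then have t: "0 \<le> t" "t \<le> 1" by auto
    show "L t = ((\<lambda>z. L (turn z)) \<circ> ?c) t"
    proof (cases "t = 1")
      case True
      have "turn (cis (2 * pi * 1)) = 0" unfolding turn_cis by simp
      then show ?thesis using True L01 by simp
    next
      case False then show ?thesis using t by (simp add: turn_cis frac_eq)
    qed
  qed
  then have LS: "continuous_map S1 Y (\<lambda>z. L (turn z))"
    by (rule continuous_compose_quotient_map[OF q])
  have "continuous_map (top_of_set (- {0})) S1 (\<lambda>z :: complex. z / of_real (norm z))"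
    by (auto simp: norm_divide intro!: continuous_intros)
  from continuous_map_compose[OF this LS]
  show ?thesis
    by (rule continuous_map_eq) (simp add: turn_def)
qed

lemma frac_eq_01: "0 \<le> x \<Longrightarrow> x \<le> 1 \<Longrightarrow> frac (x::real) = (if x = 1 then 0 else x)"
  by (simp add: frac_eq)

text \<open>A simple closed curve winds at most once around any point off it.\<close>

lemma circle_embedding_homotopic:
  fixes P :: "complex \<Rightarrow> complex"
  assumes c: "continuous_on (sphere 0 1) P" and i: "inj_on P (sphere 0 1)" and 0: "0 \<notin> P ` sphere 0 1"
  obtains k :: int where "k \<in> {-1, 0, 1}"
    "homotopic_with_canon (\<lambda>_. True) (sphere 0 1) (- {0}) P (\<lambda>z. z powi k)"
proof -
  define p where "p t = P (cis (2 * pi * t))" for t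
  have "path p" unfolding p_def path_def
    by (rule continuous_on_compose2[OF c]) (auto intro!: continuous_intros)
  moreover have "loop_free p" unfolding loop_free_def
  proof (intro ballI impI)
    fix x y :: real assume xy: "x \<in> {0..1}" "y \<in> {0..1}" "p x = p y"
    then have "cis (2 * pi * x) = cis (2 * pi * y)" using i by (auto simp: p_def inj_on_def)
    then have "frac x = frac y" by (metis turn_cis)
    then show "x = y \<or> x = 0 \<and> y = 1 \<or> x = 1 \<and> y = 0"
      using xy by (auto simp: frac_eq_01 split: if_splits)
  qed
  ultimately have sp: "simple_path p" by (simp add: simple_path_def)
  have fin: "pathfinish p = pathstart p" by (simp add: pathfinish_def pathstart_def p_def)
  have p0: "0 \<notin> path_image p" using 0 by (auto simp: path_image_def p_def)
  have W: "winding_number p 0 \<in> {-1, 0, 1}" by (rule simple_closed_path_winding_number_cases[OF sp fin p0])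
  \<comment> \<open>In the punctured plane the winding number determines the free homotopy class, so
    P only has to be compared with one model loop for each of the three values.\<close>
  have main: "homotopic_with_canon (\<lambda>_. True) (sphere 0 1) (- {0}) P (\<lambda>z. z powi k)"
    if "path q" "pathfinish q = pathstart q" "0 \<notin> path_image q" "winding_number q 0 = winding_number p 0"
      "\<And>z. z \<in> sphere 0 1 \<Longrightarrow> q (turn z) = z powi k" for q k
  proof -
    have "homotopic_loops (- {0}) p q"
      using winding_number_homotopic_loops_eq[OF \<open>path p\<close> p0 that(1,3) fin that(2)] that(4) by simp
    from homotopic_loops_imp_homotopic_circlemaps[OF this]
    have "homotopic_with_canon (\<lambda>_. True) (sphere 0 1) (- {0}) (p \<circ> turn) (q \<circ> turn)"
      by (simp add: turn_def[abs_def])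
    then show ?thesis
      by (rule homotopic_with_eq) (use that(5) cis_turn in \<open>auto simp: p_def\<close>)
  qed
  have circ: "circlepath 0 1 t = cis (2 * pi * t)" for t
    by (simp add: circlepath_def part_circlepath_def linepath_def cis_conv_exp mult.commute)
  consider "winding_number p 0 = 1" | "winding_number p 0 = 0" | "winding_number p 0 = -1" using W by auto
  then show thesis
  proof cases
    case 1
    show thesis
      by (rule that[of 1], simp, rule main[of "circlepath 0 1"])
        (use 1 circ cis_turn in \<open>auto simp: winding_number_circlepath_centre\<close>)
  next
    case 2
    have l: "linepath (1 :: complex) 1 t = 1" for t by (simp add: linepath_def)
    show thesis
      by (rule that[of 0], simp, rule main[of "linepath 1 1"]) (use 2 l in auto)
  next
    case 3
    have r: "reversepath (circlepath 0 1) (turn z) = z powi - 1" if "z \<in> sphere 0 1" for z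
    proof -
      have "reversepath (circlepath 0 1) (turn z) = cis (2 * pi - 2 * pi * turn z)"
        by (simp only: reversepath_def circ) (simp add: algebra_simps)
      also have "\<dots> = inverse (cis (2 * pi * turn z))" by (simp add: cis_divide[symmetric] inverse_eq_divide)
      finally show ?thesis using cis_turn[OF that] by (simp add: power_int_minus)
    qed
    have w: "winding_number (reversepath (circlepath 0 1)) 0 = -1"
      by (subst winding_number_reversepath) (auto simp: winding_number_circlepath_centre)
    show thesis
      by (rule that[of "-1"], simp, rule main[of "reversepath (circlepath 0 1)"])
        (use 3 w r in auto)
  qed
qed

section \<open>Edge paths as loops in the realization\<close>

context two_cov
begin

definition edge_pt :: "'b \<times> 'c \<Rightarrow> real \<Rightarrow> ('a, 'b, 'c, 'd) pt set" where
  "edge_pt p s = cls X (HE (fst p) (snd p), (s, 0))"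

definition trace :: "(nat \<Rightarrow> 'b \<times> 'c) \<Rightarrow> real \<Rightarrow> ('a, 'b, 'c, 'd) pt set" where
  "trace f u = edge_pt (f (nat \<lfloor>u\<rfloor>)) (frac u)"

definition hword :: "('b \<times> 'c) set \<Rightarrow> (nat \<Rightarrow> 'b \<times> 'c) \<Rightarrow> bool" where
  "hword Es f \<longleftrightarrow> Es \<subseteq> HE_all \<and> (\<forall>j. f j \<in> Es \<and> tgt (hgraph X) (f j) = src (hgraph X) (f (Suc j)))"

text \<open>Depends on the angle of z only and is used off 0, so that it can be composed with
  plane-valued coordinates of a strip as well as with powers on the circle.\<close>

definition loop :: "(nat \<Rightarrow> 'b \<times> 'c) \<Rightarrow> nat \<Rightarrow> complex \<Rightarrow> ('a, 'b, 'c, 'd) pt set" where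
  "loop f n z = trace f (real n * turn z)"

lemma edge_pt_rv: "(e, y) \<in> HE_all \<Longrightarrow> 0 \<le> s \<Longrightarrow> s \<le> 1 \<Longrightarrow> edge_pt (e, y) s = edge_pt (rv U e, y) (1 - s)"
  unfolding edge_pt_def fst_conv snd_conv by (rule glue_cls) (simp add: glueI(3) mem_hgraph)

lemma edge_pt_1: "p \<in> HE_all \<Longrightarrow> edge_pt p 1 = cls X (VV (fst (tgt (hgraph X) p)) (snd (tgt (hgraph X) p)), (0, 0))"
  using glue_cls[OF glueI(4)[of "fst p" "snd p"]] by (cases p) (simp add: edge_pt_def hgraph_def)

lemma edge_pt_0:
  assumes "p \<in> HE_all"
  shows "edge_pt p 0 = cls X (VV (fst (src (hgraph X) p)) (snd (src (hgraph X) p)), (0, 0))"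
proof -
  have "edge_pt p 0 = edge_pt (rv (hgraph X) p) 1" using edge_pt_rv[of "fst p" "snd p" 0] assms by (cases p) (simp add: hgraph_def)
  then show ?thesis using edge_pt_1 wf_graphD(3)[OF wf_hgraph assms] by (simp add: src_def)
qed

lemma continuous_map_edge_pt:
  assumes "p \<in> HE_all" shows "continuous_map (top_of_set {0..1}) (realization X) (edge_pt p)"
proof -
  have c: "HE (fst p) (snd p) \<in> cells X" using assms by (cases p) (simp add: cells_def mem_hgraph)
  have "continuous_map (top_of_set {0..1}) (top_of_set (cdom (HE (fst p) (snd p)))) (\<lambda>s. (s, 0))"
    by (auto intro!: continuous_intros)
  from continuous_map_compose[OF this continuous_map_cell[OF c]]
  show ?thesis by (simp add: o_def edge_pt_def[abs_def])
qed

lemma hword_Suc: "hword Es f \<Longrightarrow> edge_pt (f j) 1 = edge_pt (f (Suc j)) 0"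
  unfolding hword_def by (metis edge_pt_0 edge_pt_1 subsetD)

lemma trace_piece:
  assumes f: "hword Es f" and u: "real j \<le> u" "u \<le> real j + 1"
  shows "trace f u = edge_pt (f j) (u - real j)"
proof (cases "u = real j + 1")
  case True
  then have "nat \<lfloor>u\<rfloor> = Suc j" "frac u = 0" by (simp_all add: floor_eq_iff frac_def)
  then have "trace f u = edge_pt (f (Suc j)) 0" unfolding trace_def by (simp only:)
  then show ?thesis using hword_Suc[OF f, of j] True by simp
next
  case False
  then have "\<lfloor>u\<rfloor> = int j" using u by (simp add: floor_eq_iff)
  then show ?thesis by (simp add: trace_def frac_def)
qed

lemma continuous_map_trace:
  assumes f: "hword Es f"
  shows "continuous_map (top_of_set {0..real n}) (realization X) (trace f)"
proof (induction n)
  case 0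
  have "continuous_map (top_of_set {0..real 0}) (realization X) (\<lambda>_. trace f 0)"
  proof (rule continuous_map_const[THEN iffD2], rule disjI2)
    have "f 0 \<in> HE_all" using f by (auto simp: hword_def)
    then show "trace f 0 \<in> topspace (realization X)"
      using continuous_map_edge_pt[of "f 0"] by (simp add: trace_def continuous_map_def Pi_iff)
  qed
  then show ?case by (rule continuous_map_eq) simp
next
  case (Suc n)
  let ?T = "top_of_set {0..real (Suc n)}"
  have "continuous_map ?T (realization X) (\<lambda>u. if u \<le> real n then trace f u else trace f u)"
  proof (rule continuous_map_cases_le)
    have "{x \<in> topspace ?T. x \<le> real n} = {0..real n}" by auto
    then show "continuous_map (subtopology ?T {x \<in> topspace ?T. x \<le> real n}) (realization X) (trace f)"
      using Suc by (simp add: subtopology_subtopology Int_absorb1)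
    have "{x \<in> topspace ?T. real n \<le> x} = {real n..real (Suc n)}" by auto
    moreover have "continuous_map (top_of_set {real n..real (Suc n)}) (realization X) (trace f)"
    proof (rule continuous_map_eq)
      have "f n \<in> HE_all" using f by (auto simp: hword_def)
      moreover have "continuous_map (top_of_set {real n..real (Suc n)}) (top_of_set {0..1}) (\<lambda>u. u - real n)"
        by (auto intro!: continuous_intros)
      ultimately show "continuous_map (top_of_set {real n..real (Suc n)}) (realization X) (edge_pt (f n) \<circ> (\<lambda>u. u - real n))"
        using continuous_map_compose continuous_map_edge_pt by blast
      show "(edge_pt (f n) \<circ> (\<lambda>u. u - real n)) x = trace f x" if "x \<in> topspace (top_of_set {real n..real (Suc n)})" for x
        using trace_piece[OF f, of n x] that by simp
    qed
    ultimately show "continuous_map (subtopology ?T {x \<in> topspace ?T. real n \<le> x}) (realization X) (trace f)"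
      by (simp add: subtopology_subtopology Int_absorb1)
  qed (auto intro!: continuous_intros)
  then show ?case by simp
qed

lemma trace_mult:
  assumes "\<And>j. f (j + n) = f j" "0 \<le> u"
  shows "trace f (u + real k * real n) = trace f u"
proof -
  have r: "real k * real n = of_int (int (k * n))" by simp
  have "\<lfloor>u + real k * real n\<rfloor> = \<lfloor>u\<rfloor> + int (k * n)" unfolding r by (rule floor_add_int[symmetric])
  then have "nat \<lfloor>u + real k * real n\<rfloor> = nat \<lfloor>u\<rfloor> + k * n" "frac (u + real k * real n) = frac u"
    using assms(2) by (simp_all add: nat_add_distrib frac_def nat_mult_distrib)
  moreover have "f (j + k * n) = f j" for j
    by (induction k arbitrary: j) (simp_all add: assms(1) add.assoc[symmetric] add.commute[of n])
  ultimately show ?thesis by (simp add: trace_def)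
qed

lemma hreal_trace: "hword Es f \<Longrightarrow> trace f u \<in> hreal X Vs Es"
  unfolding trace_def edge_pt_def hreal_def hword_def
  using frac_lt_1[of u] frac_ge_0[of u]
  by (intro imageI UnI2 CollectI exI[of _ "fst (f (nat \<lfloor>u\<rfloor>))"] exI[of _ "snd (f (nat \<lfloor>u\<rfloor>))"] exI[of _ "frac u"])
    (auto simp: less_imp_le)

lemma continuous_map_loop:
  assumes f: "hword Es f" and per: "\<And>j. f (j + n) = f j"
  shows "continuous_map (top_of_set (- {0})) (subtopology (realization X) (hreal X Vs Es)) (loop f n)"
proof -
  have "continuous_map (top_of_set {0..1}) (top_of_set {0..real n}) (\<lambda>t. real n * t)"
    by (auto intro!: continuous_intros simp: mult_left_le)
  from continuous_map_compose[OF this continuous_map_trace[OF f]]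
  have "continuous_map (top_of_set {0..1}) (realization X) (\<lambda>t. trace f (real n * t))" by (simp add: o_def)
  then have "continuous_map (top_of_set (- {0})) (realization X) (\<lambda>z. trace f (real n * turn z))"
    by (rule continuous_map_turn) (use trace_mult[of f n 0 1] per in simp)
  then show ?thesis
    unfolding loop_def[abs_def] continuous_map_in_subtopology using hreal_trace[OF f] by auto
qed

text \<open>Turns a period of the word into a power of a loop: a strip whose word has a proper
  period would give a proper power.\<close>

lemma loop_power:
  assumes per: "\<And>j. f (j + n) = f j" and z: "z \<in> sphere 0 1"
  shows "loop f (k * n) z = loop f n (z ^ k)"
proof -
  have "z ^ k = cis (2 * pi * turn z) ^ k" using cis_turn[OF z] by simp
  also have "\<dots> = cis (2 * pi * (real k * turn z))" by (simp add: Complex.DeMoivre algebra_simps)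
  finally have t: "turn (z ^ k) = frac (real k * turn z)" by (simp add: turn_cis)
  let ?v = "real k * turn z"
  have v: "0 \<le> ?v" using turn_bounds[of z] by simp
  have "real (nat \<lfloor>?v\<rfloor>) = of_int \<lfloor>?v\<rfloor>" using v by simp
  then have "real n * frac ?v + real (nat \<lfloor>?v\<rfloor>) * real n = real (k * n) * turn z"
    by (simp add: frac_def algebra_simps)
  then have "trace f (real (k * n) * turn z) = trace f (real n * frac ?v)"
    using trace_mult[of f n "real n * frac ?v" "nat \<lfloor>?v\<rfloor>"] per by simp
  then show ?thesis by (simp add: loop_def t)
qed

end

section \<open>Coordinates on a strip and the retraction onto the large component\<close>

context two_cov
begin

definition square_pt :: "'b \<times> 'd \<Rightarrow> real \<times> real \<Rightarrow> ('a, 'b, 'c, 'd) pt set" where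
  "square_pt s z = cls X (SQ (fst s) (snd s), z)"

text \<open>Squares suffice: an interior point of a vertical edge lies on the time-1 side of the
  square over either lift.\<close>

lemma off_hgraph:
  assumes C: "C \<in> topspace (realization X) - hreal X HV_all HE_all"
  shows "\<exists>x t r. x \<in> squares \<and> 0 < t \<and> t < 1 \<and> 0 \<le> r \<and> r \<le> 1 \<and> C = square_pt x (t, r)"
proof -
  obtain p where p: "p \<in> cell_pts" "C = cls X p" using C by (auto simp: topspace_realization)
  have nh: "\<not> in_part HV_all HE_all p" using in_part_iff[OF component_hgraph p(1)] C p(2) by simp
  obtain a t r where pa: "p = (a, (t, r))" by (cases p) auto
  show "\<exists>x t r. x \<in> squares \<and> 0 < t \<and> t < 1 \<and> 0 \<le> r \<and> r \<le> 1 \<and> C = square_pt x (t, r)"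
  proof (cases a)
    case (SQ e d)
    then have "(e, d) \<in> squares" "0 \<le> t" "t \<le> 1" "0 \<le> r" "r \<le> 1" using p pa by (auto simp: mem_cell_pts mem_squares)
    moreover have "t \<noteq> 0" "t \<noteq> 1" using nh p pa SQ in_part_hgraph(2)[of e d "(t, r)"] by auto
    ultimately show ?thesis using p pa SQ
      by (intro exI[of _ "(e, d)"] exI[of _ t] exI[of _ r]) (auto simp: square_pt_def)
  next
    case (VE v \<epsilon>)
    then have v: "v \<in> verts U" "\<epsilon> \<in> edges (V v)" "0 \<le> t" "t \<le> 1" "r = 0" using p pa by (auto simp: mem_cell_pts)
    have t: "t \<noteq> 0" "t \<noteq> 1" using nh p pa VE in_part_hgraph(1)[of v \<epsilon> "(t, r)"] by auto
    have "pre v \<epsilon> \<noteq> {}" using card_pre[OF v(1,2)] by auto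
    then obtain e d where "(e, d) \<in> pre v \<epsilon>" by auto
    then have ed: "e \<in> edges U" "tgt U e = v" "d \<in> edges (E e)" "te X e d = \<epsilon>" by (auto simp: mem_pre)
    have "C = square_pt (e, d) (t, 1)"
      using glue_cls[OF glueI(7)[OF ed(1,3) v(3,4)]] ed p pa VE v(5) by (simp add: square_pt_def)
    then show ?thesis using ed v t by (intro exI[of _ "(e, d)"] exI[of _ t] exI[of _ 1]) (auto simp: mem_squares)
  qed (use nh p pa in_part_hgraph in auto)
qed

lemma square_pt_flip: "s \<in> squares \<Longrightarrow> 0 \<le> t \<Longrightarrow> t \<le> 1 \<Longrightarrow> 0 \<le> r \<Longrightarrow> r \<le> 1 \<Longrightarrow> square_pt (flip s) (1 - t, r) = square_pt s (t, r)"
  unfolding square_pt_def flip_def fst_conv snd_conv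
  by (rule glue_cls[OF glueI(5), symmetric]) (cases s, simp_all add: mem_squares)+

lemma square_pt_reverse: "s \<in> squares \<Longrightarrow> 0 \<le> t \<Longrightarrow> t \<le> 1 \<Longrightarrow> 0 \<le> r \<Longrightarrow> r \<le> 1 \<Longrightarrow> square_pt (reverse s) (t, 1 - r) = square_pt s (t, r)"
  unfolding square_pt_def reverse_def fst_conv snd_conv
  by (rule glue_cls[OF glueI(6), symmetric]) (cases s, simp_all add: mem_squares)+

lemma square_pt_partner: assumes "s \<in> squares" "0 \<le> t" "t \<le> 1" shows "square_pt (partner s) (t, 1) = square_pt s (t, 1)"
proof -
  have *: "square_pt s (t, 1) = cls X (VE (tgt U (fst s)) (te X (fst s) (snd s)), (t, 0))" if "s \<in> squares" for s
    unfolding square_pt_def by (rule glue_cls[OF glueI(7)]) (use that assms in \<open>cases s, simp_all add: mem_squares\<close>)+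
  show ?thesis using *[OF assms(1)] *[OF partner(1)[OF assms(1)]] partner(2,3)[OF assms(1)] by simp
qed

lemma square_pt_advance: assumes "s \<in> squares" "0 \<le> t" "t \<le> 1" shows "square_pt (advance s) (t, 0) = square_pt s (t, 1)"
  using square_pt_reverse[OF partner(1)[OF assms(1)] assms(2,3), of 1] square_pt_partner[OF assms] assms(1) by (simp add: advance_def)

text \<open>Otherwise the reversal reflects the orbit, and at the midpoint of the reflection some
  square equals its own reverse (k even) or its own partner (k odd).\<close>

lemma reverse_notin_orbit: assumes s: "s \<in> squares" shows "reverse s \<noteq> (advance ^^ k) s"
proof
  assume eq: "reverse s = (advance ^^ k) s"
  define l where "l = k div 2"
  let ?u = "(advance ^^ l) s"
  have u: "?u \<in> squares" using s by (simp add: advance_pow_squares)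
  have inj: "inj (advance ^^ l)" by (rule inj_fn[OF inj_advance])
  have k: "k = l + l \<or> k = l + Suc l" by (auto simp: l_def)
  have "(advance ^^ l) (reverse ?u) = (advance ^^ k) s" using reverse_advance_pow[OF s, of l] eq by simp
  then have "reverse ?u = ?u \<or> reverse ?u = (advance ^^ Suc l) s"
    using k injD[OF inj] by (metis comp_apply funpow_add)
  moreover have "(advance ^^ Suc l) s = reverse (partner ?u)" using u by (simp add: advance_def[of ?u])
  ultimately have "reverse ?u = ?u \<or> reverse (reverse ?u) = reverse (reverse (partner ?u))" by auto
  then show False using reverse(2,3)[OF u] reverse(2)[OF partner(1)[OF u]] pre_partner(2)[OF u] by auto
qed

lemma advance_pow_mult_period: assumes "s \<in> squares" shows "(advance ^^ (j + m * period s)) s = (advance ^^ j) s"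
proof -
  have "(advance ^^ (m * period s)) s = s"
  proof (induction m)
    case (Suc m)
    then show ?case using period(2)[OF assms] by (simp add: funpow_add)
  qed simp
  then show ?thesis by (simp add: funpow_add)
qed

lemma advance_pow_eq:
  assumes s: "s \<in> squares" shows "(advance ^^ i) s = (advance ^^ j) s \<longleftrightarrow> i mod period s = j mod period s"
proof
  let ?n = "period s"
  have mod: "(advance ^^ (i mod ?n)) s = (advance ^^ i) s" for i
    using advance_pow_mult_period[OF s, of "i mod ?n" "i div ?n"] unfolding mod_div_mult_eq by (rule sym)
  assume "i mod ?n = j mod ?n" then show "(advance ^^ i) s = (advance ^^ j) s" using mod by metis
next
  let ?n = "period s"
  have mod: "(advance ^^ (i mod ?n)) s = (advance ^^ i) s" for i
    using advance_pow_mult_period[OF s, of "i mod ?n" "i div ?n"] unfolding mod_div_mult_eq by (rule sym)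
  have *: False if "a < b" "b < ?n" "(advance ^^ a) s = (advance ^^ b) s" for a b
  proof -
    have "(advance ^^ b) s = (advance ^^ a) ((advance ^^ (b - a)) s)"
      using that(1) by (metis comp_apply funpow_add le_add_diff_inverse less_imp_le)
    then have "(advance ^^ (b - a)) s = s" using that(3) inj_fn[OF inj_advance, of a] by (simp add: inj_eq)
    then show False using period(3)[OF s, of "b - a"] that by simp
  qed
  assume "(advance ^^ i) s = (advance ^^ j) s"
  then have eq: "(advance ^^ (i mod ?n)) s = (advance ^^ (j mod ?n)) s" using mod by simp
  have lt: "i mod ?n < ?n" "j mod ?n < ?n" using period(1)[OF s] by auto
  show "i mod ?n = j mod ?n" using *[of "i mod ?n" "j mod ?n"] *[of "j mod ?n" "i mod ?n"] eq lt
    by (metis linorder_neqE_nat)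
qed

lemma reverse_advance_notin_orbit: assumes s: "s \<in> squares" shows "reverse ((advance ^^ i) s) \<noteq> (advance ^^ j) s"
proof
  assume eq: "reverse ((advance ^^ i) s) = (advance ^^ j) s"
  let ?n = "period s"
  have "j + i * (?n - 1) + i = j + i * ?n" using period(1)[OF s] by (cases ?n) auto
  then have "(advance ^^ (j + i * (?n - 1))) ((advance ^^ i) s) = (advance ^^ (j + i * ?n)) s"
    by (metis comp_apply funpow_add)
  also have "\<dots> = (advance ^^ j) s" by (rule advance_pow_mult_period[OF s])
  finally have "reverse ((advance ^^ i) s) = (advance ^^ (j + i * (?n - 1))) ((advance ^^ i) s)" using eq by simp
  moreover have "(advance ^^ i) s \<in> squares" using s by (simp add: advance_pow_squares)
  ultimately show False using reverse_notin_orbit by blast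
qed

text \<open>An eigenfunction of \<open>advance\<close>: the j-th square of the strip of
  \<open>s\<close> gets the angle 2 pi j / n, with n the period, and squares off the orbit get 0.
  Hence the strip winds once around the origin.\<close>

definition \<phi> :: "'b \<times> 'd \<Rightarrow> 'b \<times> 'd \<Rightarrow> complex" where
  "\<phi> s x = (if x \<in> range (\<lambda>j. (advance ^^ j) s)
     then cis (2 * pi * real ((SOME j. (advance ^^ j) s = x) mod period s) / real (period s)) else 0)"

lemma cis_mod: assumes "0 < n" shows "cis (2 * pi * real (j mod n) / real n) = cis (2 * pi * real j / real n)"
proof -
  have "real j = real (j mod n) + real (j div n) * real n"
    by (metis mod_div_mult_eq of_nat_add of_nat_mult)
  then have "2 * pi * real j / real n = 2 * pi * real (j mod n) / real n + 2 * pi * real (j div n)"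
    using assms by (simp add: field_simps)
  moreover have "cis (2 * pi * real (j div n)) = 1" by (rule cis_multiple_2pi) simp
  ultimately show ?thesis by (simp only: cis_mult[symmetric]) simp
qed

lemma \<phi>_orbit: assumes s: "s \<in> squares" shows "\<phi> s ((advance ^^ j) s) = cis (2 * pi * real j / real (period s))"
proof -
  let ?i = "SOME i. (advance ^^ i) s = (advance ^^ j) s"
  have "(advance ^^ ?i) s = (advance ^^ j) s" by (rule someI) simp
  then have "?i mod period s = j mod period s" by (simp add: advance_pow_eq[OF s])
  then show ?thesis using cis_mod[OF period(1)[OF s]] by (simp add: \<phi>_def)
qed

lemma \<phi>_advance:
  assumes s: "s \<in> squares" shows "\<phi> s (advance x) = \<phi> s x * cis (2 * pi / real (period s))"
proof (cases "x \<in> range (\<lambda>j. (advance ^^ j) s)")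
  case True
  then obtain j where j: "x = (advance ^^ j) s" by auto
  have "\<phi> s (advance x) = cis (2 * pi * real (Suc j) / real (period s))"
    using \<phi>_orbit[OF s, of "Suc j"] j by simp
  then show ?thesis using \<phi>_orbit[OF s, of j] j by (simp add: cis_mult add_divide_distrib algebra_simps)
next
  case False
  \<comment> \<open>By periodicity the orbit is also closed under the inverse of
    \<open>advance\<close>.\<close>
  have "advance x \<notin> range (\<lambda>j. (advance ^^ j) s)"
  proof
    assume "advance x \<in> range (\<lambda>j. (advance ^^ j) s)"
    then obtain j where "advance x = (advance ^^ j) s" by auto
    also have "\<dots> = (advance ^^ (j + 1 * period s)) s" by (rule advance_pow_mult_period[OF s, symmetric])
    also have "\<dots> = advance ((advance ^^ (j + period s - 1)) s)"
      using period(1)[OF s] by (cases "j + period s") auto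
    finally show False using False inj_advance by (auto simp: inj_eq)
  qed
  with False show ?thesis by (simp add: \<phi>_def)
qed

end

section \<open>Words and plane coordinates of upward squares\<close>

context bip
begin

lemma upward_flip: "s \<in> upward \<Longrightarrow> flip s \<notin> upward"
  using bip Ed(8) by (cases s) (auto simp: upward_def flip_def head_edge_def mem_squares)

lemma upward_reverse: "s \<in> squares \<Longrightarrow> reverse s \<in> upward \<longleftrightarrow> s \<in> upward"
  using EA_rv Ed(6) E_rv reverse(1) by (cases s) (auto simp: upward_def reverse_def head_edge_def mem_squares)

lemma upward_partner: "s \<in> squares \<Longrightarrow> partner s \<in> upward \<longleftrightarrow> s \<in> upward"
proof -
  have *: "s \<in> upward \<longleftrightarrow> (tgt U (fst s), tgt (V (tgt U (fst s))) (te X (fst s) (snd s))) \<in> VA" if "s \<in> squares" for s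
    using that EA_VA[OF _ Ed(6)] tau(4) by (cases s) (auto simp: upward_def head_edge_def mem_squares)
  assume "s \<in> squares"
  then show ?thesis using *[of s] *[of "partner s"] partner(1-3)[of s] by simp
qed

lemma upward_advance_pow: "s \<in> upward \<Longrightarrow> (advance ^^ j) s \<in> upward"
proof (induction j)
  case (Suc j)
  then have "(advance ^^ j) s \<in> upward" by simp
  then show ?case using upward_reverse[OF partner(1)] upward_partner by (simp add: advance_def[of "(advance ^^ j) s"] upward_def)
qed simp

lemma upward_squares: "s \<in> upward \<Longrightarrow> s \<in> squares" by (simp add: upward_def)

definition word :: "'b \<times> 'd \<Rightarrow> nat \<Rightarrow> 'b \<times> 'c" where "word s j = head_edge ((advance ^^ j) s)"

lemma tgt_head_edge_advance: assumes s: "s \<in> squares" shows "tgt (hgraph X) (head_edge s) = src (hgraph X) (head_edge (advance s))"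
proof -
  obtain e d e' d' where k: "s = (e, d)" "partner s = (e', d')" by fastforce
  have e: "e \<in> edges U" "d \<in> edges (E e)" "e' \<in> edges U" "d' \<in> edges (E e')" "tgt U e' = tgt U e" "te X e' d' = te X e d"
    using s partner[OF s] k by (auto simp: mem_squares)
  have "tv X e' (tgt (E e') d') = tv X e (tgt (E e) d)" using e tau(4)[OF e(1,2)] tau(4)[OF e(3,4)] by simp
  then show ?thesis using s k e Ud(5) E_rv by (simp add: advance_def reverse_def head_edge_def hgraph_def src_def)
qed

lemma hword_word: assumes "s \<in> upward" shows "hword EA (word s)"
  unfolding hword_def
proof (intro conjI allI EA_sub)
  fix j
  show "word s j \<in> EA" using upward_advance_pow[OF assms] by (simp add: word_def upward_def)
  show "tgt (hgraph X) (word s j) = src (hgraph X) (word s (Suc j))"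
    using tgt_head_edge_advance[of "(advance ^^ j) s"] assms by (simp add: word_def upward_squares advance_pow_squares)
qed

lemma word_period: "s \<in> upward \<Longrightarrow> word s (j + period s) = word s j"
  using advance_pow_mult_period[OF upward_squares, of s j 1] by (simp add: word_def)

text \<open>On an upward square of the orbit only one of the four terms survives: its reverse is off
  the orbit, and its flipped labels are not upward. What remains are polar coordinates, with radius
  1 + t across the strip and the angle measuring the position along it; F is 0 off the
  strip.\<close>

lemma strip_coordinates:
  assumes s: "s \<in> upward"
  obtains F where "continuous_map (subtopology (realization X) (topspace (realization X) - hreal X HV_all HE_all)) euclidean F"
    "\<And>j t r. 0 < t \<Longrightarrow> t < 1 \<Longrightarrow> 0 \<le> r \<Longrightarrow> r \<le> 1 \<Longrightarrow>
       F (square_pt ((advance ^^ j) s) (t, r)) = of_real (1 + t) * cis (2 * pi * ((real j + r) / real (period s)))"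
    "\<And>C. C \<in> topspace (realization X) - hreal X HV_all HE_all \<Longrightarrow> F C \<noteq> 0 \<Longrightarrow>
       \<exists>j t r. 0 < t \<and> t < 1 \<and> 0 \<le> r \<and> r < 1 \<and> C = square_pt ((advance ^^ j) s) (t, r)"
    "\<And>x t r. x \<in> squares \<Longrightarrow> 0 < t \<Longrightarrow> t < 1 \<Longrightarrow> 0 \<le> r \<Longrightarrow> r \<le> 1 \<Longrightarrow> F (square_pt x (t, r)) \<noteq> 0 \<Longrightarrow>
       \<exists>j. x = (advance ^^ j) s \<or> reverse x = (advance ^^ j) s \<or> flip x = (advance ^^ j) s \<or> reverse (flip x) = (advance ^^ j) s"
proof -
  let ?n = "real (period s)" and ?\<theta> = "2 * pi / real (period s)"
  note sS = upward_squares[OF s]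
  obtain F where F: "continuous_map (subtopology (realization X) (topspace (realization X) - hreal X HV_all HE_all)) euclidean F"
    "\<And>e d t r. e \<in> edges U \<Longrightarrow> d \<in> edges (E e) \<Longrightarrow> 0 < t \<Longrightarrow> t < 1 \<Longrightarrow> 0 \<le> r \<Longrightarrow> r \<le> 1 \<Longrightarrow>
      F (cls X (SQ e d, (t, r))) =
       of_real (1 + t) * (\<phi> s (e, d) * cis (?\<theta> * r) + \<phi> s (reverse (e, d)) * cis (?\<theta> * (1 - r))) +
       of_real (2 - t) * (\<phi> s (flip (e, d)) * cis (?\<theta> * r) + \<phi> s (reverse (flip (e, d))) * cis (?\<theta> * (1 - r)))"
    using strip_function[of "\<phi> s" ?\<theta>] \<phi>_advance[OF sS] by metis
  have Fs: "F (square_pt x (t, r)) = of_real (1 + t) * (\<phi> s x * cis (?\<theta> * r) + \<phi> s (reverse x) * cis (?\<theta> * (1 - r))) +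
       of_real (2 - t) * (\<phi> s (flip x) * cis (?\<theta> * r) + \<phi> s (reverse (flip x)) * cis (?\<theta> * (1 - r)))"
    if "x \<in> squares" "0 < t" "t < 1" "0 \<le> r" "r \<le> 1" for x t r
    using F(2)[of "fst x" "snd x" t r] that by (cases x) (simp add: square_pt_def mem_squares)
  have orbit: "\<exists>j. x = (advance ^^ j) s \<or> reverse x = (advance ^^ j) s \<or> flip x = (advance ^^ j) s \<or> reverse (flip x) = (advance ^^ j) s"
    if "x \<in> squares" "0 < t" "t < 1" "0 \<le> r" "r \<le> 1" "F (square_pt x (t, r)) \<noteq> 0" for x t r
  proof -
    have "\<phi> s x \<noteq> 0 \<or> \<phi> s (reverse x) \<noteq> 0 \<or> \<phi> s (flip x) \<noteq> 0 \<or> \<phi> s (reverse (flip x)) \<noteq> 0"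
      using that(6) Fs[OF that(1-5)] by auto
    then show ?thesis by (auto simp: \<phi>_def split: if_splits)
  qed
  show thesis
  proof (rule that[OF F(1) _ _ orbit])
    fix j and t r :: real assume tr: "0 < t" "t < 1" "0 \<le> r" "r \<le> 1"
    let ?x = "(advance ^^ j) s"
    have x: "?x \<in> upward" "?x \<in> squares" using upward_advance_pow[OF s] upward_squares by auto
    have "\<phi> s (reverse ?x) = 0" using reverse_advance_notin_orbit[OF sS] by (auto simp: \<phi>_def)
    moreover have "\<phi> s (flip ?x) = 0" using upward_flip[OF x(1)] upward_advance_pow[OF s] by (auto simp: \<phi>_def)
    moreover have "\<phi> s (reverse (flip ?x)) = 0"
      using upward_flip[OF x(1)] upward_reverse[OF flip(1)[OF x(2)]] upward_advance_pow[OF s] by (auto simp: \<phi>_def)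
    ultimately have "F (square_pt ?x (t, r)) = of_real (1 + t) * (cis (2 * pi * real j / ?n) * cis (?\<theta> * r))"
      using Fs[OF x(2) tr] \<phi>_orbit[OF sS, of j] by simp
    also have "cis (2 * pi * real j / ?n) * cis (?\<theta> * r) = cis (2 * pi * ((real j + r) / ?n))"
      by (simp add: cis_mult add_divide_distrib algebra_simps)
    finally show "F (square_pt ?x (t, r)) = of_real (1 + t) * cis (2 * pi * ((real j + r) / ?n))" .
  next
    fix C assume C: "C \<in> topspace (realization X) - hreal X HV_all HE_all" "F C \<noteq> 0"
    from off_hgraph[OF C(1)] obtain x t r where x: "x \<in> squares" "0 < t" "t < 1" "0 \<le> r" "r \<le> 1" "C = square_pt x (t, r)" by blast
    have "\<exists>j. x = (advance ^^ j) s \<or> reverse x = (advance ^^ j) s \<or> flip x = (advance ^^ j) s \<or> reverse (flip x) = (advance ^^ j) s"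
      using orbit[OF x(1-5)] C(2) x(6) by simp
    then obtain j y t' r' where y: "y = (advance ^^ j) s" "0 < t'" "t' < 1" "0 \<le> r'" "r' \<le> 1" "C = square_pt y (t', r')"
    proof (elim disjE exE)
      fix j assume "x = (advance ^^ j) s" then show thesis using that[OF _ x(2-6)] by blast
    next
      fix j assume j: "reverse x = (advance ^^ j) s"
      show thesis by (rule that[OF j, of t "1 - r"]) (use x square_pt_reverse[OF x(1), of t r] in auto)
    next
      fix j assume j: "flip x = (advance ^^ j) s"
      show thesis by (rule that[OF j, of "1 - t" r]) (use x square_pt_flip[OF x(1), of t r] in auto)
    next
      fix j assume j: "reverse (flip x) = (advance ^^ j) s"
      show thesis by (rule that[OF j, of "1 - t" "1 - r"])
        (use x square_pt_flip[OF x(1), of t r] square_pt_reverse[OF flip(1)[OF x(1)], of "1 - t" r] in auto)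
    qed
    \<comment> \<open>The side r = 1 is passed to the next square as r = 0. The half-open range
      makes r recoverable from the angle.\<close>
    show "\<exists>j t r. 0 < t \<and> t < 1 \<and> 0 \<le> r \<and> r < 1 \<and> C = square_pt ((advance ^^ j) s) (t, r)"
    proof (cases "r' = 1")
      case True
      have "y \<in> squares" using y(1) sS by (simp add: advance_pow_squares)
      then have "C = square_pt ((advance ^^ Suc j) s) (t', 0)" using square_pt_advance[of y t'] y True by simp
      moreover have "0 \<le> (0 :: real)" "(0 :: real) < 1" by simp_all
      ultimately show ?thesis using y(2,3) by blast
    next
      case False
      then have "r' < 1" using y(5) by simp
      then show ?thesis using y by blast
    qed
  qed assumption+
qed

lemma component_A: "component VA EA"
  unfolding component_def using VA_sub EA_sub EA_VA EA_rv by blast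

lemma component_B: "component (HV_all - VA) (HE_all - EA)"
  unfolding component_def using EA_VA EA_rv component_hgraph by (auto simp: component_def)

text \<open>Every square and every vertical edge has exactly one end in the large component; with
  the circles removed it can be pushed there along t, keeping the time coordinate r.\<close>

lemma retraction:
  obtains \<rho> where "continuous_map (subtopology (realization X) (topspace (realization X) - hreal X (HV_all - VA) (HE_all - EA)))
      (subtopology (realization X) (hreal X VA EA)) \<rho>"
    "\<And>C. C \<in> hreal X VA EA \<Longrightarrow> \<rho> C = C"
    "\<And>x t r. x \<in> upward \<Longrightarrow> 0 < t \<Longrightarrow> t \<le> 1 \<Longrightarrow> 0 \<le> r \<Longrightarrow> r \<le> 1 \<Longrightarrow> \<rho> (square_pt x (t, r)) = edge_pt (head_edge x) r"
proof -
  define f :: "('a, 'b, 'c, 'd) pt \<Rightarrow> ('a, 'b, 'c, 'd) pt set" where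
    "f p = (case p of
       (SQ e d, z) \<Rightarrow> edge_pt (e, if (e, tgt (E e) d) \<in> EA then tgt (E e) d else src (E e) d) (snd z)
     | (VE v \<epsilon>, z) \<Rightarrow> cls X (VV v (if (v, tgt (V v) \<epsilon>) \<in> VA then tgt (V v) \<epsilon> else src (V v) \<epsilon>), (0, 0))
     | (VV v x, z) \<Rightarrow> cls X (VV v x, (0, 0))
     | (HE e y, z) \<Rightarrow> edge_pt (e, y) (fst z))" for p
  let ?B = "in_part (HV_all - VA) (HE_all - EA)" and ?A = "in_part VA EA"
  let ?Y = "subtopology (realization X) (hreal X VA EA)"
  have inv: "f p = f q" if g: "glue X p q" and P: "\<not> ?B p" "\<not> ?B q" for p q
    using g
  proof (cases rule: glue_cases)
    case (VE_VE v \<epsilon> t)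
    then show ?thesis using bipV[OF VE_VE(1,2)] Vd(8,9)[OF VE_VE(1,2)] by (auto simp: f_def)
  next
    case (VE_VV v \<epsilon>)
    then have "(v, tgt (V v) \<epsilon>) \<in> VA" using P Vd(6)[OF VE_VV(1,2)] by (auto simp: mem_hgraph)
    then show ?thesis using VE_VV by (simp add: f_def)
  next
    case (HE_HE e y s)
    then show ?thesis using edge_pt_rv[of e y s] by (simp add: f_def mem_hgraph)
  next
    case (HE_VV e y)
    then show ?thesis using edge_pt_1[of "(e, y)"] by (simp add: f_def mem_hgraph) (simp add: hgraph_def)
  next
    case (SQ_flip e d t s)
    then show ?thesis using bip[OF SQ_flip(1,2)] Ed(8,9)[OF SQ_flip(1,2)] by (auto simp: f_def)
  next
    case (SQ_reverse e d t s)
    have "edge_pt (e, y) s = edge_pt (rv U e, y) (1 - s)" if "y \<in> verts (E e)" for y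
      using edge_pt_rv[of e y s] that SQ_reverse by (simp add: mem_hgraph)
    then show ?thesis using SQ_reverse EA_rv[OF SQ_reverse(1)] E_rv[OF SQ_reverse(1)] Ed(6,7)[OF SQ_reverse(1,2)]
      by (simp add: f_def)
  next
    case (SQ_VE e d t)
    have "edge_pt (e, y) 1 = cls X (VV (tgt U e) (tv X e y), (0, 0))" if "y \<in> verts (E e)" for y
      using edge_pt_1[of "(e, y)"] that SQ_VE(1) by (simp add: mem_hgraph) (simp add: hgraph_def)
    then show ?thesis using SQ_VE EA_VA[OF SQ_VE(1)] tau(4,5)[OF SQ_VE(1,2)] Ed(6,7)[OF SQ_VE(1,2)]
      by (simp add: f_def)
  next
    case (SQ_HE e d s)
    then have "(e, tgt (E e) d) \<in> EA" using P Ed(6)[OF SQ_HE(1,2)] by (auto simp: mem_hgraph)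
    then show ?thesis using SQ_HE by (simp add: f_def)
  qed
  have cont: "continuous_map (top_of_set {z \<in> cdom c. \<not> ?B (c, z)}) ?Y (\<lambda>z. f (c, z))" if c: "c \<in> cells X" for c
  proof -
    let ?D = "{z \<in> cdom c. \<not> ?B (c, z)}"
    have VVc: "continuous_map (top_of_set ?D) ?Y (\<lambda>_. cls X (VV v x, (0, 0)))" if "(v, x) \<in> VA" for v x
    proof -
      have "(VV v x, (0, 0)) \<in> cell_pts" using that VA_sub by (auto simp: mem_cell_pts mem_hgraph)
      moreover from this have "cls X (VV v x, (0, 0)) \<in> hreal X VA EA" using that in_part_iff[OF component_A] by simp
      ultimately show ?thesis by (simp add: continuous_map_const topspace_realization)
    qed
    have HEc: "continuous_map (top_of_set ?D) ?Y (\<lambda>z. edge_pt (e, y) (g z))"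
      if e: "(e, y) \<in> EA" and g: "continuous_map (top_of_set ?D) (top_of_set {0..1}) g" for e y and g :: "real \<times> real \<Rightarrow> real"
    proof -
      have H: "(e, y) \<in> HE_all" using e EA_sub by blast
      have "continuous_map (top_of_set ?D) (realization X) (\<lambda>z. edge_pt (e, y) (g z))"
        using continuous_map_compose[OF g continuous_map_edge_pt[OF H]] by (simp add: o_def)
      moreover have "edge_pt (e, y) (g z) \<in> hreal X VA EA" if "z \<in> ?D" for z
      proof -
        have "g z \<in> {0..1}" using g that by (auto simp: continuous_map_def)
        then have "(HE e y, (g z, 0)) \<in> cell_pts" using H by (auto simp: mem_cell_pts mem_hgraph)
        then show ?thesis using in_part_iff[OF component_A] e by (simp add: edge_pt_def)
      qed
      ultimately show ?thesis unfolding continuous_map_in_subtopology by auto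
    qed
    show ?thesis
    proof (cases c)
      case (VV v x)
      show ?thesis
      proof (cases "(v, x) \<in> VA")
        case True then show ?thesis using VVc VV by (simp add: f_def)
      next
        case False
        then have D: "?D = {}" using c VV by (auto simp: cells_def mem_hgraph)
        show ?thesis unfolding D by (simp add: continuous_map_def)
      qed
    next
      case (VE v \<epsilon>)
      then have v: "v \<in> verts U" "\<epsilon> \<in> edges (V v)" using c by (auto simp: cells_def)
      then show ?thesis using VVc bipV[OF v] VE by (simp add: f_def)
    next
      case (HE e y)
      show ?thesis
      proof (cases "(e, y) \<in> EA")
        case True
        have "continuous_map (top_of_set ?D) (top_of_set {0..1}) fst"
          using HE by (auto intro!: continuous_intros)
        then show ?thesis using HEc[OF True] HE by (simp add: f_def)
      next
        case False
        then have D: "?D = {}" using c HE by (auto simp: cells_def mem_hgraph)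
        show ?thesis unfolding D by (simp add: continuous_map_def)
      qed
    next
      case (SQ e d)
      then have e: "e \<in> edges U" "d \<in> edges (E e)" using c by (auto simp: cells_def)
      have "continuous_map (top_of_set ?D) (top_of_set {0..1}) snd"
        using SQ by (auto intro!: continuous_intros)
      then show ?thesis using HEc bip[OF e] SQ by (simp add: f_def)
    qed
  qed
  obtain \<rho> where \<rho>: "continuous_map (subtopology (realization X) (cls X ` {p \<in> cell_pts. \<not> ?B p})) ?Y \<rho>"
    "\<And>p. p \<in> cell_pts \<Longrightarrow> \<not> ?B p \<Longrightarrow> \<rho> (cls X p) = f p"
  proof (rule realization_lift[of "\<lambda>p. \<not> ?B p" f ?Y])
    show "\<not> ?B p \<longleftrightarrow> \<not> ?B q" if "glue X p q" for p q using in_part_glue[OF component_B that] by simp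
  qed (use inv cont openin_not_in_part in auto)
  have W: "cls X ` {p \<in> cell_pts. \<not> ?B p} = topspace (realization X) - hreal X (HV_all - VA) (HE_all - EA)"
    using in_part_iff[OF component_B] by (auto simp: topspace_realization)
  show thesis
  proof (rule that[OF \<rho>(1)[unfolded W]])
    fix C assume "C \<in> hreal X VA EA"
    then obtain q where q: "C = cls X q" "q \<in> {(VV v x, (0, 0)) | v x. (v, x) \<in> VA} \<union> {(HE e x, (s, 0)) | e x s. (e, x) \<in> EA \<and> s \<in> {0..1}}"
      unfolding hreal_def by blast
    have "q \<in> cell_pts" "\<not> ?B q" "f q = cls X q"
      using q(2) VA_sub EA_sub by (auto simp: mem_cell_pts mem_hgraph f_def edge_pt_def)
    then show "\<rho> C = C" using \<rho>(2) q(1) by simp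
  next
    fix x and t r :: real assume x: "x \<in> upward" and tr: "0 < t" "t \<le> 1" "0 \<le> r" "r \<le> 1"
    obtain e d where ed: "x = (e, d)" by (cases x)
    have e: "e \<in> edges U" "d \<in> edges (E e)" "(e, tgt (E e) d) \<in> EA" using x ed by (auto simp: upward_def mem_squares head_edge_def)
    have "(SQ e d, (t, r)) \<in> cell_pts" "\<not> ?B (SQ e d, (t, r))" using e tr by (auto simp: mem_cell_pts)
    from \<rho>(2)[OF this] show "\<rho> (square_pt x (t, r)) = edge_pt (head_edge x) r" using e by (simp add: ed square_pt_def f_def head_edge_def)
  qed
qed

end

section \<open>Annuli mapped onto a strip\<close>

context two_cov
begin

lemma continuous_map_annulus:
  fixes \<Psi> :: "complex \<times> real \<Rightarrow> ('a, 'b, 'c, 'd) pt set"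
  assumes \<Psi>: "continuous_map (prod_topology S1 (top_of_set {0..1})) (realization X) \<Psi>"
    and D: "D \<subseteq> sphere 0 1 \<times> {0..1}" and W: "\<Psi> ` D \<subseteq> W"
    and F: "continuous_map (subtopology (realization X) W) Y F"
  shows "continuous_map (top_of_set D) Y (\<lambda>z. F (\<Psi> z))"
proof -
  have "continuous_map (top_of_set (sphere 0 1 \<times> {0..1})) (realization X) \<Psi>" using \<Psi> by simp
  then have "continuous_map (top_of_set D) (realization X) \<Psi>"
    using D by (metis continuous_map_from_subtopology subtopology_subtopology inf.absorb_iff2)
  then have "continuous_map (top_of_set D) (subtopology (realization X) W) \<Psi>"
    using W by (auto simp: continuous_map_in_subtopology)
  from continuous_map_compose[OF this F] show ?thesis by (simp add: o_def)
qed

lemma hreal_mono: "Vs \<subseteq> Vs' \<Longrightarrow> Es \<subseteq> Es' \<Longrightarrow> hreal X Vs Es \<subseteq> hreal X Vs' Es'"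
  unfolding hreal_def by (intro image_mono Un_mono) blast+

lemma connected_annulus: "connected (sphere (0 :: complex) 1 \<times> {0<..<1 :: real})"
  by (intro connected_Times connected_sphere) auto

end

context bip
begin

lemma hreal_A_B: "hreal X VA EA \<inter> hreal X (HV_all - VA) (HE_all - EA) = {}"
proof (rule ccontr)
  assume "hreal X VA EA \<inter> hreal X (HV_all - VA) (HE_all - EA) \<noteq> {}"
  then obtain C where C: "C \<in> hreal X VA EA" "C \<in> hreal X (HV_all - VA) (HE_all - EA)" by blast
  from C(1) obtain p where p: "p \<in> {(VV v x, (0, 0)) | v x. (v, x) \<in> VA} \<union> {(HE e x, (s, 0)) | e x s. (e, x) \<in> EA \<and> s \<in> {0..1}}"
    "C = cls X p" unfolding hreal_def by blast
  have "p \<in> cell_pts" using p(1) VA_sub EA_sub by (auto simp: mem_cell_pts mem_hgraph)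
  then have "in_part (HV_all - VA) (HE_all - EA) p" using in_part_iff[OF component_B] C(2) p(2) by simp
  then show False using p(1) by auto
qed

lemma word_mod: "s \<in> upward \<Longrightarrow> i mod period s = j mod period s \<Longrightarrow> (advance ^^ i) s = (advance ^^ j) s"
  using advance_pow_eq[OF upward_squares] by simp

text \<open>F sends the middle circle of the annulus to a simple closed curve that misses 0, whose
  degree is k. Retracting the upper half of the annulus moves the top circle to the retracted middle
  circle. On the strip the retraction equals \<open>loop\<close> after F, because the angle of F
  records the position along the word.\<close>

lemma annulus_homotopy:
  fixes \<Psi> :: "complex \<times> real \<Rightarrow> ('a, 'b, 'c, 'd) pt set"
  assumes s: "s \<in> upward"
    and \<Psi>: "continuous_map (prod_topology S1 (top_of_set {0..1})) (realization X) \<Psi>"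
    and top: "\<And>z. z \<in> sphere 0 1 \<Longrightarrow> \<Psi> (z, 1) \<in> hreal X VA EA"
    and inj: "inj_on \<Psi> (sphere 0 1 \<times> {0<..<1})"
    and off: "\<Psi> ` (sphere 0 1 \<times> {0<..<1}) \<inter> hreal X HV_all HE_all = {}"
    and meets: "z0 \<in> sphere 0 1" "0 < t0" "t0 < 1" "\<Psi> (z0, t0) = square_pt s (t1, r1)"
      "0 < t1" "t1 < 1" "0 \<le> r1" "r1 \<le> 1"
  obtains k :: int where "k \<in> {-1, 0, 1}"
    "homotopic_with (\<lambda>_. True) S1 (subtopology (realization X) (hreal X VA EA))
       (\<lambda>z. \<Psi> (z, 1)) (\<lambda>z. loop (word s) (period s) (z powi k))"
    "\<And>x z t. x \<in> upward \<Longrightarrow> z \<in> sphere 0 1 \<Longrightarrow> 0 < t \<Longrightarrow> t < 1 \<Longrightarrow> \<Psi> (z, t) = square_pt x (1 / 2, 1 / 2) \<Longrightarrow>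
       \<exists>j. x = (advance ^^ j) s \<or> reverse x = (advance ^^ j) s"
proof -
  let ?n = "period s" and ?R = "topspace (realization X)"
  let ?A = "sphere (0 :: complex) 1 \<times> {0<..<1 :: real}"
  have n0: "0 < ?n" by (rule period(1)[OF upward_squares[OF s]])
  obtain F where F: "continuous_map (subtopology (realization X) (?R - hreal X HV_all HE_all)) euclidean F"
    and Fs: "\<And>j t r. 0 < t \<Longrightarrow> t < 1 \<Longrightarrow> 0 \<le> r \<Longrightarrow> r \<le> 1 \<Longrightarrow>
       F (square_pt ((advance ^^ j) s) (t, r)) = of_real (1 + t) * cis (2 * pi * ((real j + r) / real ?n))"
    and Fn: "\<And>C. C \<in> ?R - hreal X HV_all HE_all \<Longrightarrow> F C \<noteq> 0 \<Longrightarrow>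
       \<exists>j t r. 0 < t \<and> t < 1 \<and> 0 \<le> r \<and> r < 1 \<and> C = square_pt ((advance ^^ j) s) (t, r)"
    and Fo: "\<And>x t r. x \<in> squares \<Longrightarrow> 0 < t \<Longrightarrow> t < 1 \<Longrightarrow> 0 \<le> r \<Longrightarrow> r \<le> 1 \<Longrightarrow> F (square_pt x (t, r)) \<noteq> 0 \<Longrightarrow>
       \<exists>j. x = (advance ^^ j) s \<or> reverse x = (advance ^^ j) s \<or> flip x = (advance ^^ j) s \<or> reverse (flip x) = (advance ^^ j) s"
    by (rule strip_coordinates[OF s], blast)
  have top\<Psi>: "\<Psi> x \<in> ?R" if "x \<in> sphere 0 1 \<times> {0..1}" for x
    using \<Psi> that by (auto simp: continuous_map_def)
  have W: "\<Psi> x \<in> ?R - hreal X HV_all HE_all" if "x \<in> ?A" for x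
    using top\<Psi>[of x] off that by auto
  have "continuous_map (top_of_set ?A) euclidean (\<lambda>x. F (\<Psi> x))"
  proof (rule continuous_map_annulus[OF \<Psi> _ _ F])
    show "\<Psi> ` ?A \<subseteq> ?R - hreal X HV_all HE_all" using W by blast
  qed auto
  then have FA: "continuous_on ?A (\<lambda>x. F (\<Psi> x))" by simp
  have Fnorm: "norm (F C) \<in> {0} \<union> {1<..<2}" if CR: "C \<in> ?R - hreal X HV_all HE_all" for C
  proof (cases "F C = 0")
    case False
    then obtain j t r where "0 < t" "t < 1" "0 \<le> r" "r < 1" "C = square_pt ((advance ^^ j) s) (t, r)"
      using Fn[OF CR] by blast
    then have "F C = of_real (1 + t) * cis (2 * pi * ((real j + r) / real ?n))" "0 < t" "t < 1" using Fs by auto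
    then have "norm (F C) = 1 + t" by (simp only: norm_mult norm_of_real norm_cis) simp
    then show ?thesis using \<open>0 < t\<close> \<open>t < 1\<close> by simp
  qed simp
  \<comment> \<open>The modulus of F never equals 1/2, and it exceeds 1 at the given point of the
    strip; connectedness of the open annulus then excludes the value 0.\<close>
  have Fnz: "F (\<Psi> x) \<noteq> 0" if x: "x \<in> ?A" for x
  proof
    assume F0: "F (\<Psi> x) = 0"
    have x0: "(z0, t0) \<in> ?A" using meets by simp
    have "F (\<Psi> (z0, t0)) = of_real (1 + t1) * cis (2 * pi * ((real 0 + r1) / real ?n))"
      using Fs[OF meets(5-8), of 0] unfolding meets(4) by simp
    then have "norm (F (\<Psi> (z0, t0))) = \<bar>1 + t1\<bar>" by (simp only: norm_mult norm_of_real norm_cis) simp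
    then have "1 < norm (F (\<Psi> (z0, t0)))" using meets(5) by simp
    have "connected ((\<lambda>x. norm (F (\<Psi> x))) ` ?A)"
      by (intro connected_continuous_image continuous_on_norm FA connected_annulus)
    then have "1 / 2 \<in> (\<lambda>x. norm (F (\<Psi> x))) ` ?A"
      using connectedD_interval[of "(\<lambda>x. norm (F (\<Psi> x))) ` ?A" "norm (F (\<Psi> x))" "norm (F (\<Psi> (z0, t0)))" "1 / 2"]
        x x0 F0 \<open>1 < norm (F (\<Psi> (z0, t0)))\<close> by (auto simp del: mem_Sigma_iff)
    then obtain y where "y \<in> ?A" "norm (F (\<Psi> y)) = 1 / 2" by auto
    then show False using Fnorm[OF W, of y] by auto
  qed
  \<comment> \<open>The modulus recovers t, and the angle recovers j + r modulo the period. Since r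
    lies in [0, 1), this separates r from the residue of j.\<close>
  have Finj: "C = C'" if C: "C \<in> ?R - hreal X HV_all HE_all" "C' \<in> ?R - hreal X HV_all HE_all" "F C = F C'" "F C \<noteq> 0" for C C'
  proof -
    obtain j t r where 1: "0 < t" "t < 1" "0 \<le> r" "r < 1" "C = square_pt ((advance ^^ j) s) (t, r)"
      using Fn[OF C(1,4)] by blast
    obtain j' t' r' where 2: "0 < t'" "t' < 1" "0 \<le> r'" "r' < 1" "C' = square_pt ((advance ^^ j') s) (t', r')"
      using Fn[OF C(2)] C(3,4) by metis
    let ?a = "(real j + r) / real ?n" and ?a' = "(real j' + r') / real ?n"
    have eq: "of_real (1 + t) * cis (2 * pi * ?a) = of_real (1 + t') * cis (2 * pi * ?a')"
      using Fs[of t r j] Fs[of t' r' j'] 1 2 C(3) by simp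
    then have "norm (of_real (1 + t) * cis (2 * pi * ?a)) = norm (of_real (1 + t') * cis (2 * pi * ?a'))" by (rule arg_cong)
    then have tt: "t = t'" using 1 2 by (simp only: norm_mult norm_of_real norm_cis) simp
    have "frac ?a = frac ?a'"
      using turn_rcis[of "1 + t" ?a] turn_rcis[of "1 + t'" ?a'] eq 1 2 by simp
    then have "?a - ?a' = of_int (\<lfloor>?a\<rfloor> - \<lfloor>?a'\<rfloor>)" by (simp add: frac_def algebra_simps)
    then obtain m where m0: "?a - ?a' = of_int m" by blast
    have "real j + r = real ?n * ?a" "real j' + r' = real ?n * ?a'" using n0 by simp_all
    then have "(real j + r) - (real j' + r') = real ?n * (?a - ?a')" by (simp only: right_diff_distrib)
    then have m: "real j + r = real j' + r' + of_int (m * int ?n)"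
      unfolding m0 by (simp add: mult.commute)
    then have "of_int (int j - int j' - m * int ?n) = r' - r" by simp
    then have "int j - int j' - m * int ?n = 0" using 1 2
      by (smt (verit) of_int_0_less_iff of_int_less_1_iff of_int_minus)
    then have jj: "int j = int j' + m * int ?n" by simp
    then have "real_of_int (int j) = of_int (int j' + m * int ?n)" by (rule arg_cong)
    then have "r = r'" using m by simp
    have "int j mod int ?n = int j' mod int ?n" using jj by simp
    then have "j mod ?n = j' mod ?n" by (metis of_nat_eq_iff zmod_int)
    from word_mod[OF s this] show ?thesis using 1(5) 2(5) tt \<open>r = r'\<close> by simp
  qed
  define P where "P z = F (\<Psi> (z, 1 / 2))" for z
  have half: "(z, 1 / 2) \<in> ?A" if "z \<in> sphere 0 1" for z :: complex using that by simp
  have "continuous_on (sphere 0 1) P" unfolding P_def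
    by (rule continuous_on_compose2[OF FA]) (auto intro!: continuous_intros)
  moreover have "inj_on P (sphere 0 1)"
  proof (rule inj_onI)
    fix z z' :: complex assume z: "z \<in> sphere 0 1" "z' \<in> sphere 0 1" "P z = P z'"
    have "\<Psi> (z, 1 / 2) = \<Psi> (z', 1 / 2)"
      by (rule Finj[OF W[OF half[OF z(1)]] W[OF half[OF z(2)]]]) (use z Fnz[OF half] in \<open>auto simp: P_def\<close>)
    then show "z = z'" using inj_onD[OF inj _ half[OF z(1)] half[OF z(2)]] by simp
  qed
  moreover have P0: "0 \<notin> P ` sphere 0 1" using Fnz[OF half] by (auto simp: P_def)
  ultimately obtain k :: int where k: "k \<in> {-1, 0, 1}"
    "homotopic_with_canon (\<lambda>_. True) (sphere 0 1) (- {0}) P (\<lambda>z. z powi k)"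
    by (rule circle_embedding_homotopic)
  let ?Y = "subtopology (realization X) (hreal X VA EA)" and ?l = "loop (word s) ?n"
  have "homotopic_with (\<lambda>_. True) S1 ?Y (?l \<circ> P) (?l \<circ> (\<lambda>z. z powi k))"
    by (rule homotopic_with_compose_continuous_map_left[OF k(2) continuous_map_loop[OF hword_word[OF s]]])
      (simp_all add: word_period[OF s])
  moreover have "homotopic_with (\<lambda>_. True) S1 ?Y (\<lambda>z. \<Psi> (z, 1)) (?l \<circ> P)"
  proof -
    obtain \<rho> where \<rho>: "continuous_map (subtopology (realization X) (?R - hreal X (HV_all - VA) (HE_all - EA))) ?Y \<rho>"
      and \<rho>A: "\<And>C. C \<in> hreal X VA EA \<Longrightarrow> \<rho> C = C"
      and \<rho>s: "\<And>x t r. x \<in> upward \<Longrightarrow> 0 < t \<Longrightarrow> t \<le> 1 \<Longrightarrow> 0 \<le> r \<Longrightarrow> r \<le> 1 \<Longrightarrow> \<rho> (square_pt x (t, r)) = edge_pt (head_edge x) r"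
      using retraction by metis
    let ?D = "sphere (0 :: complex) 1 \<times> {0<..1 :: real}"
    have "\<Psi> x \<in> ?R - hreal X (HV_all - VA) (HE_all - EA)" if "x \<in> ?D" for x
    proof (cases "snd x = 1")
      case True
      then have "\<Psi> x \<in> hreal X VA EA" using top[of "fst x"] that by (cases x) auto
      then show ?thesis using hreal_A_B top\<Psi>[of x] that by auto
    next
      case False
      then have "x \<in> ?A" using that by auto
      then show ?thesis using W[of x] hreal_mono[of "HV_all - VA" HV_all "HE_all - EA" HE_all] by blast
    qed
    then have \<rho>\<Psi>: "continuous_map (top_of_set ?D) ?Y (\<lambda>x. \<rho> (\<Psi> x))"
      by (intro continuous_map_annulus[OF \<Psi> _ _ \<rho>]) auto
    have "continuous_map (prod_topology (top_of_set {0..1}) S1) (top_of_set ?D) (\<lambda>(u, z). (z, 1 - u / 2))"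
      by (auto simp: split_def intro!: continuous_intros)
    from continuous_map_compose[OF this \<rho>\<Psi>]
    have c: "continuous_map (prod_topology (top_of_set {0..1}) S1) ?Y (\<lambda>(u, z). \<rho> (\<Psi> (z, 1 - u / 2)))"
      by (simp add: o_def split_def)
    have "homotopic_with (\<lambda>_. True) S1 ?Y (\<lambda>z. \<rho> (\<Psi> (z, 1))) (\<lambda>z. \<rho> (\<Psi> (z, 1 / 2)))"
      unfolding homotopic_with_def by (rule exI[of _ "\<lambda>(u, z). \<rho> (\<Psi> (z, 1 - u / 2))"]) (use c in simp)
    then show ?thesis
    proof (rule homotopic_with_eq)
      fix z :: complex assume "z \<in> topspace S1"
      then have z: "z \<in> sphere 0 1" by simp
      show "\<Psi> (z, 1) = \<rho> (\<Psi> (z, 1))" using \<rho>A[OF top[OF z]] by simp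
      obtain j t r where C: "0 < t" "t < 1" "0 \<le> r" "r < 1" "\<Psi> (z, 1 / 2) = square_pt ((advance ^^ j) s) (t, r)"
        using Fn[OF W[OF half[OF z]] Fnz[OF half[OF z]]] by blast
      let ?a = "(real j + r) / real ?n"
      have a0: "0 \<le> ?a" using C by simp
      have "turn (P z) = frac ?a" using turn_rcis[of "1 + t" ?a] C Fs[of t r j] by (simp add: P_def)
      moreover have "real ?n * frac ?a + real (nat \<lfloor>?a\<rfloor>) * real ?n = real j + r"
      proof -
        have "real (nat \<lfloor>?a\<rfloor>) = of_int \<lfloor>?a\<rfloor>" using a0 by simp
        then have "real ?n * frac ?a + real (nat \<lfloor>?a\<rfloor>) * real ?n = real ?n * ?a"
          by (simp add: frac_def algebra_simps)
        then show ?thesis using n0 by simp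
      qed
      ultimately have "loop (word s) ?n (P z) = trace (word s) (real j + r)"
        using trace_mult[of "word s" ?n "real ?n * frac ?a" "nat \<lfloor>?a\<rfloor>"] word_period[OF s] by (simp add: loop_def)
      also have "\<dots> = edge_pt (word s j) r" using trace_piece[OF hword_word[OF s], of j "real j + r"] C by simp
      also have "\<dots> = \<rho> (\<Psi> (z, 1 / 2))"
        unfolding C(5) word_def using \<rho>s[OF upward_advance_pow[OF s]] C by simp
      finally show "(?l \<circ> P) z = \<rho> (\<Psi> (z, 1 / 2))" by simp
    qed simp
  qed
  ultimately have "homotopic_with (\<lambda>_. True) S1 ?Y (\<lambda>z. \<Psi> (z, 1)) (?l \<circ> (\<lambda>z. z powi k))"
    using homotopic_with_trans by blast
  then have hom: "homotopic_with (\<lambda>_. True) S1 ?Y (\<lambda>z. \<Psi> (z, 1)) (\<lambda>z. ?l (z powi k))" by (simp add: o_def)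
  show thesis
  proof (rule that[OF k(1) hom])
    fix x and z :: complex and t :: real
    assume x: "x \<in> upward" "z \<in> sphere 0 1" "0 < t" "t < 1" "\<Psi> (z, t) = square_pt x (1 / 2, 1 / 2)"
    then have "F (square_pt x (1 / 2, 1 / 2)) \<noteq> 0" using Fnz[of "(z, t)"] by simp
    then obtain j where j: "x = (advance ^^ j) s \<or> reverse x = (advance ^^ j) s \<or> flip x = (advance ^^ j) s \<or> reverse (flip x) = (advance ^^ j) s"
      using Fo[OF upward_squares[OF x(1)], of "1 / 2" "1 / 2"] by auto
    have "flip x \<notin> upward" "reverse (flip x) \<notin> upward" using upward_flip[OF x(1)] upward_reverse[OF flip(1)[OF upward_squares[OF x(1)]]] by auto
    then show "\<exists>j. x = (advance ^^ j) s \<or> reverse x = (advance ^^ j) s" using j upward_advance_pow[OF s, of j] by auto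
  qed
qed

end

section \<open>Cylinders\<close>

text \<open>Near the end point of the three arms the circle embeds in a line, by the imaginary part.\<close>

lemma no_tripod_in_circle:
  fixes a :: "nat \<Rightarrow> real \<Rightarrow> complex"
  assumes c: "c < 1" and cont: "\<And>k. k < 3 \<Longrightarrow> continuous_on {c..1} (a k)"
    and sph: "\<And>k s. k < 3 \<Longrightarrow> s \<in> {c..1} \<Longrightarrow> a k s \<in> sphere 0 1"
    and w: "\<And>k. k < 3 \<Longrightarrow> a k 1 = w"
    and dis: "\<And>k l s t. k < 3 \<Longrightarrow> l < 3 \<Longrightarrow> k \<noteq> l \<Longrightarrow> s \<in> {c..<1} \<Longrightarrow> t \<in> {c..1} \<Longrightarrow> a k s \<noteq> a l t"
  shows False
proof -
  have w1: "norm w = 1" using sph[of 0 1] w[of 0] c by auto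
  define b where "b k s = a k s / w" for k s
  \<comment> \<open>After division by w the arms end at 1, near which the real part is positive and
    the imaginary part is injective on the circle.\<close>
  have bc: "continuous_on {c..1} (b k)" if "k < 3" for k
    unfolding b_def using cont[OF that] w1 by (intro continuous_intros) auto
  have b1: "b k 1 = 1" if "k < 3" for k using w[OF that] w1 by (auto simp: b_def)
  have bs: "norm (b k s) = 1" if "k < 3" "s \<in> {c..1}" for k s using sph[OF that] w1 by (simp add: b_def norm_divide)
  have "\<exists>d<1. c \<le> d \<and> (\<forall>s\<in>{d..1}. 0 < Re (b k s))" if k: "k < 3" for k
  proof -
    have "1 \<in> {c..1}" using c by simp
    then obtain \<delta> where \<delta>: "0 < \<delta>" "\<And>s. s \<in> {c..1} \<Longrightarrow> dist s 1 < \<delta> \<Longrightarrow> dist (b k s) (b k 1) < 1"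
      using bc[OF k] unfolding continuous_on_iff by (metis zero_less_one)
    let ?d = "max c (1 - \<delta> / 2)"
    have "0 < Re (b k s)" if s: "s \<in> {?d..1}" for s
    proof -
      have "dist (b k s) 1 < 1" using \<delta>(2)[of s] \<delta>(1) s b1[OF k] by (auto simp: dist_real_def)
      then have "\<bar>Re (b k s - 1)\<bar> < 1" using abs_Re_le_cmod[of "b k s - 1"] by (simp add: dist_norm)
      then show ?thesis by simp
    qed
    then show ?thesis using c \<delta>(1) by (intro exI[of _ ?d]) auto
  qed
  then obtain d where d: "\<And>k. k < 3 \<Longrightarrow> d k < 1 \<and> c \<le> d k \<and> (\<forall>s\<in>{d k..1}. 0 < Re (b k s))" by metis
  define s0 where "s0 = max (d 0) (max (d 1) (d 2))"
  have d3: "d 0 < 1" "d 1 < 1" "d 2 < 1" using d by auto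
  have k3: "k = 0 \<or> k = 1 \<or> k = 2" if "k < 3" for k :: nat using that by auto
  have s0: "s0 < 1" "c \<le> s0" using d[of 0] d3 by (auto simp: s0_def)
  have "d k \<le> s0" if "k < 3" for k using k3[OF that] by (auto simp: s0_def)
  then have re: "0 < Re (b k s)" if "k < 3" "s \<in> {s0..1}" for k s using d[OF that(1)] that by force
  define y where "y k s = Im (b k s)" for k s
  have yc: "continuous_on {s0..1} (y k)" if "k < 3" for k
    unfolding y_def using continuous_on_subset[OF bc[OF that]] s0 by (intro continuous_intros) auto
  have y1: "y k 1 = 0" if "k < 3" for k using b1[OF that] by (simp add: y_def)
  have yeq: "a k s = a l t" if "k < 3" "l < 3" "s \<in> {s0..1}" "t \<in> {s0..1}" "y k s = y l t" for k l s t
  proof -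
    have "(Re (b k s))\<^sup>2 + (Im (b k s))\<^sup>2 = 1" "(Re (b l t))\<^sup>2 + (Im (b l t))\<^sup>2 = 1"
      using bs[of k s] bs[of l t] that s0 by (auto simp: cmod_def)
    then have "(Re (b k s))\<^sup>2 = (Re (b l t))\<^sup>2" using that(5) by (simp add: y_def)
    then have "Re (b k s) = Re (b l t)" using re[OF that(1,3)] re[OF that(2,4)] by simp
    then have "b k s = b l t" using that(5) by (simp add: y_def complex_eq_iff)
    then show ?thesis using w1 by (auto simp: b_def)
  qed
  \<comment> \<open>If two arms start on the same side of the end point, the outer one sweeps over
    the start of the other on its way to 0.\<close>
  have key: False if kl: "k < 3" "l < 3" "k \<noteq> l" "\<bar>y k s0\<bar> \<le> \<bar>y l s0\<bar>" "0 \<le> y k s0 * y l s0" for k l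
  proof -
    have "\<exists>t\<in>{s0..1}. y l t = y k s0"
    proof (cases "0 \<le> y l s0")
      case True
      then have "y l 1 \<le> y k s0" "y k s0 \<le> y l s0"
        using kl y1[OF kl(2)] by (auto simp: zero_le_mult_iff)
      then show ?thesis using IVT2'[of "y l" 1 "y k s0" s0] yc[OF kl(2)] s0 by auto
    next
      case False
      then have "y k s0 \<le> y l 1" "y l s0 \<le> y k s0"
        using kl y1[OF kl(2)] by (auto simp: zero_le_mult_iff)
      then show ?thesis using IVT'[of "y l" s0 "y k s0" 1] yc[OF kl(2)] s0 by auto
    qed
    then obtain t where t: "t \<in> {s0..1}" "y l t = y k s0" by blast
    then have "a k s0 = a l t" using yeq[of k l s0 t] kl s0 by auto
    then show False using dis[OF kl(1-3), of s0 t] s0 t by auto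
  qed
  have key': False if "k < 3" "l < 3" "k \<noteq> l" "0 \<le> y k s0 * y l s0" for k l
    using key[of k l] key[of l k] that by (cases "\<bar>y k s0\<bar> \<le> \<bar>y l s0\<bar>") (auto simp: mult.commute)
  \<comment> \<open>Among three real numbers, two have the same weak sign.\<close>
  have "0 \<le> y 0 s0 * y 1 s0 \<or> 0 \<le> y 0 s0 * y 2 s0 \<or> 0 \<le> y 1 s0 * y 2 s0"
    by (auto simp: zero_le_mult_iff)
  then show False using key'[of 0 1] key'[of 0 2] key'[of 1 2] by auto
qed

section \<open>Detecting components and vertices through the gluing\<close>

context two_cov
begin

definition touches :: "('b \<times> 'c) set \<Rightarrow> 'b \<times> 'd \<Rightarrow> bool" where
  "touches Es s \<longleftrightarrow> (fst s, tgt (E (fst s)) (snd s)) \<in> Es \<or> (fst s, src (E (fst s)) (snd s)) \<in> Es"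

text \<open>Squares glued along a vertical edge touch the same components, so the indicator is well
  defined and constant on each open cell of the complement.\<close>

lemma touches_function:
  assumes c: "component Vs Es"
  obtains F :: "('a, 'b, 'c, 'd) pt set \<Rightarrow> real"
  where "continuous_map (subtopology (realization X) (topspace (realization X) - hreal X HV_all HE_all)) euclidean F"
    "\<And>s t r. s \<in> squares \<Longrightarrow> 0 < t \<Longrightarrow> t < 1 \<Longrightarrow> 0 \<le> r \<Longrightarrow> r \<le> 1 \<Longrightarrow> F (square_pt s (t, r)) = of_bool (touches Es s)"
proof -
  define f :: "('a, 'b, 'c, 'd) pt \<Rightarrow> real" where
    "f p = (case fst p of SQ e d \<Rightarrow> of_bool (touches Es (e, d))
       | VE v \<epsilon> \<Rightarrow> of_bool ((v, tgt (V v) \<epsilon>) \<in> Vs \<or> (v, src (V v) \<epsilon>) \<in> Vs) | _ \<Rightarrow> 0)" for p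
  let ?P = "\<lambda>p. \<not> in_part HV_all HE_all p"
  have inv: "f p = f q" if g: "glue X p q" and P: "?P p" "?P q" for p q
    using g
  proof (cases rule: glue_cases)
    case (VE_VE v \<epsilon> t)
    then show ?thesis using Vd(8,9)[OF VE_VE(1,2)] by (auto simp: f_def)
  next
    case (VE_VV v \<epsilon>)
    then show ?thesis using P in_part_hgraph(1)[of v \<epsilon> "(1, 0)"] by (simp add: mem_cell_pts)
  next
    case (SQ_flip e d t s)
    then show ?thesis using Ed(8,9)[OF SQ_flip(1,2)] by (auto simp: f_def touches_def)
  next
    case (SQ_reverse e d t s)
    then show ?thesis using component(2)[OF c SQ_reverse(1)] Ed(6,7)[OF SQ_reverse(1,2)] E_rv[OF SQ_reverse(1)]
      by (simp add: f_def touches_def)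
  next
    case (SQ_VE e d t)
    then show ?thesis using component(1)[OF c SQ_VE(1)] Ed(6,7)[OF SQ_VE(1,2)] tau(4,5)[OF SQ_VE(1,2)]
      by (simp add: f_def touches_def)
  next
    case (SQ_HE e d s)
    then show ?thesis using P in_part_hgraph(2)[of e d "(1, s)"] by (simp add: mem_cell_pts)
  qed (simp_all add: f_def)
  have cont: "continuous_map (top_of_set {z \<in> cdom c. ?P (c, z)}) euclidean (\<lambda>z. f (c, z))" for c
    by (cases c) (auto simp: f_def)
  obtain F where F: "continuous_map (subtopology (realization X) (cls X ` {p \<in> cell_pts. ?P p})) euclidean F"
    "\<And>p. p \<in> cell_pts \<Longrightarrow> ?P p \<Longrightarrow> F (cls X p) = f p"
  proof (rule realization_lift[of ?P f euclidean])
    show "?P p \<longleftrightarrow> ?P q" if "glue X p q" for p q using in_part_glue[OF component_hgraph that] by simp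
  qed (use inv cont openin_not_in_part in auto)
  have W: "cls X ` {p \<in> cell_pts. ?P p} = topspace (realization X) - hreal X HV_all HE_all"
    using in_part_iff[OF component_hgraph] by (auto simp: topspace_realization)
  show thesis
  proof (rule that[OF F(1)[unfolded W]])
    fix s and t r :: real assume s: "s \<in> squares" "0 < t" "t < 1" "0 \<le> r" "r \<le> 1"
    then have p: "(SQ (fst s) (snd s), (t, r)) \<in> cell_pts" by (cases s) (simp add: mem_cell_pts mem_squares)
    then show "F (square_pt s (t, r)) = of_bool (touches Es s)"
      using F(2)[OF p] in_part_hgraph(2)[OF p] s(2,3) by (simp add: square_pt_def f_def)
  qed
qed

text \<open>The indicator takes only the values 0 and 1 on the connected open annulus, so it is
  constant there.\<close>

lemma annulus_touches:
  fixes \<Psi> :: "complex \<times> real \<Rightarrow> ('a, 'b, 'c, 'd) pt set"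
  assumes c: "component Vs Es"
    and \<Psi>: "continuous_map (prod_topology S1 (top_of_set {0..1})) (realization X) \<Psi>"
    and off: "\<Psi> ` (sphere 0 1 \<times> {0<..<1}) \<inter> hreal X HV_all HE_all = {}"
    and x: "x \<in> sphere 0 1 \<times> {0<..<1}" "\<Psi> x = square_pt s (1 / 2, 1 / 2)" "s \<in> squares"
    and x': "x' \<in> sphere 0 1 \<times> {0<..<1}" "\<Psi> x' = square_pt s' (1 / 2, 1 / 2)" "s' \<in> squares"
    and t: "touches Es s"
  shows "touches Es s'"
proof (rule ccontr)
  assume nt: "\<not> touches Es s'"
  let ?A = "sphere (0 :: complex) 1 \<times> {0<..<1 :: real}"
  obtain F :: "('a, 'b, 'c, 'd) pt set \<Rightarrow> real" where
    F: "continuous_map (subtopology (realization X) (topspace (realization X) - hreal X HV_all HE_all)) euclidean F"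
    "\<And>s t r. s \<in> squares \<Longrightarrow> 0 < t \<Longrightarrow> t < 1 \<Longrightarrow> 0 \<le> r \<Longrightarrow> r \<le> 1 \<Longrightarrow> F (square_pt s (t, r)) = of_bool (touches Es s)"
    using touches_function[OF c] by metis
  have W: "\<Psi> y \<in> topspace (realization X) - hreal X HV_all HE_all" if "y \<in> ?A" for y
    using \<Psi> off that by (auto simp: continuous_map_def)
  have "continuous_map (top_of_set ?A) euclidean (\<lambda>y. F (\<Psi> y))"
  proof (rule continuous_map_annulus[OF \<Psi> _ _ F(1)])
    show "\<Psi> ` ?A \<subseteq> topspace (realization X) - hreal X HV_all HE_all" using W by blast
  qed auto
  then have "connected ((\<lambda>y. F (\<Psi> y)) ` ?A)" by (intro connected_continuous_image connected_annulus) simp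
  moreover have "F (\<Psi> x') = 0" "F (\<Psi> x) = 1" using x x' t nt F(2) by simp_all
  ultimately have "1 / 2 \<in> (\<lambda>y. F (\<Psi> y)) ` ?A"
    using connectedD_interval[of "(\<lambda>y. F (\<Psi> y)) ` ?A" "F (\<Psi> x')" "F (\<Psi> x)" "1 / 2"]
      imageI[OF x(1), of "\<lambda>y. F (\<Psi> y)"] imageI[OF x'(1), of "\<lambda>y. F (\<Psi> y)"] by simp
  then obtain y where y: "y \<in> ?A" "F (\<Psi> y) = 1 / 2" by auto
  obtain u a b where "u \<in> squares" "0 < a" "a < 1" "0 \<le> b" "b \<le> 1" "\<Psi> y = square_pt u (a, b)"
    using off_hgraph[OF W[OF y(1)]] by blast
  then show False using F(2)[of u a b] y(2) by (cases "touches Es u") simp_all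
qed

text \<open>Marks the representatives of the vertex point (v, x) in all cells. Invariance under
  gluing shows that a square containing this point has a corner at x.\<close>

fun over :: "'a \<Rightarrow> 'c \<Rightarrow> ('a, 'b, 'c, 'd) pt \<Rightarrow> bool" where
  "over v x (VV v' x', _) \<longleftrightarrow> v' = v \<and> x' = x"
| "over v x (VE v' \<epsilon>, z) \<longleftrightarrow> v' = v \<and> (fst z = 1 \<and> tgt (V v) \<epsilon> = x \<or> fst z = 0 \<and> src (V v) \<epsilon> = x)"
| "over v x (HE e y, z) \<longleftrightarrow> fst z = 1 \<and> (e, y) \<in> half v x \<or> fst z = 0 \<and> (rv U e, y) \<in> half v x"
| "over v x (SQ e d, z) \<longleftrightarrow> (\<exists>y. (fst z = 1 \<and> y = tgt (E e) d \<or> fst z = 0 \<and> y = src (E e) d) \<and>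
     (snd z = 1 \<and> (e, y) \<in> half v x \<or> snd z = 0 \<and> (rv U e, y) \<in> half v x))"

lemma over_glue: assumes "glue X p q" shows "over v x p \<longleftrightarrow> over v x q"
  using assms
proof (cases rule: glue_cases)
  case (VE_VE v' \<epsilon> t)
  then show ?thesis using Vd(8,9)[OF VE_VE(1,2)] by auto
next
  case (HE_HE e y s)
  then show ?thesis using Ud(5)[OF HE_HE(1)] by auto
next
  case (HE_VV e y)
  then show ?thesis by (auto simp: half_def)
next
  case (SQ_flip e d t s)
  then show ?thesis using Ed(8,9)[OF SQ_flip(1,2)] by auto
next
  case (SQ_reverse e d t s)
  then show ?thesis using E_rv[OF SQ_reverse(1)] Ud(5)[OF SQ_reverse(1)] by auto
next
  case (SQ_VE e d t)
  then show ?thesis using tau(4,5)[OF SQ_VE(1,2)] Ed(6,7)[OF SQ_VE(1,2)] by (auto simp: half_def)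
qed auto

text \<open>The position on the terminal half of h, read from either label of the edge. It vanishes
  at the end points to agree with the value 0 at vertices, so a value in (1/2, 1) determines the
  point.\<close>

definition bump :: "'b \<times> 'c \<Rightarrow> 'b \<times> 'c \<Rightarrow> real \<Rightarrow> real" where
  "bump h k u = (if k = h \<and> 1 / 2 < u \<and> u < 1 then u
     else if (rv U (fst k), snd k) = h \<and> 0 < u \<and> u < 1 / 2 then 1 - u else 0)"

text \<open>Separates the points of the terminal half of the edge \<open>h\<close>; continuity is not needed.\<close>

fun arm :: "'b \<times> 'c \<Rightarrow> ('a, 'b, 'c, 'd) pt \<Rightarrow> real" where
  "arm h (VV v x, _) = 0"
| "arm h (VE v \<epsilon>, _) = 0"
| "arm h (HE e y, z) = bump h (e, y) (fst z)"
| "arm h (SQ e d, z) = (if fst z = 1 then bump h (e, tgt (E e) d) (snd z)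
     else if fst z = 0 then bump h (e, src (E e) d) (snd z) else 0)"

lemma arm_glue: assumes "glue X p q" shows "arm h p = arm h q"
  using assms
proof (cases rule: glue_cases)
  case (HE_HE e y s)
  then show ?thesis using Ud(4,5)[OF HE_HE(1)] by (auto simp: bump_def)
next
  case (SQ_flip e d t s)
  then show ?thesis using Ed(8,9)[OF SQ_flip(1,2)] by auto
next
  case (SQ_reverse e d t s)
  then show ?thesis using Ud(4,5)[OF SQ_reverse(1)] E_rv[OF SQ_reverse(1)] by (auto simp: bump_def)
qed (auto simp: bump_def)

lemma edge_pt_inj:
  assumes h: "(e, y) \<in> HE_all" "h' \<in> HE_all" and s: "1 / 2 < s" "s < 1" "1 / 2 < s'" "s' \<le> 1"
    and eq: "edge_pt (e, y) s = edge_pt h' s'"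
  shows "h' = (e, y) \<and> s = s'"
proof -
  have "(HE e y, (s, 0)) \<in> cell_pts" using h s by (simp add: mem_cell_pts mem_hgraph)
  then have "arm (e, y) (HE e y, (s, 0)) = arm (e, y) (HE (fst h') (snd h'), (s', 0))"
    using cls_eqD[of "arm (e, y)", OF arm_glue] eq unfolding edge_pt_def fst_conv snd_conv by blast
  then show ?thesis using s by (auto simp: bump_def split: if_splits)
qed

end

section \<open>Deriving the bipartite structure from the cylinders\<close>

locale cylinders = two_cov X for X :: "('a, 'b, 'c, 'd) gspaces" +
  fixes Vinf :: "('a \<times> 'c) set" and Einf :: "('b \<times> 'c) set"
    and m :: nat and Vr :: "nat \<Rightarrow> ('a \<times> 'c) set" and Er :: "nat \<Rightarrow> ('b \<times> 'c) set"
    and q :: "nat \<Rightarrow> complex \<Rightarrow> ('a, 'b, 'c, 'd) pt set"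
    and \<Phi> :: "nat \<Rightarrow> complex \<times> real \<Rightarrow> ('a, 'b, 'c, 'd) pt set"
  assumes part_V: "verts (hgraph X) = Vinf \<union> (\<Union>i<m. Vr i)"
    and part_E: "edges (hgraph X) = Einf \<union> (\<Union>i<m. Er i)"
    and disj_inf: "\<And>i. i < m \<Longrightarrow> Vinf \<inter> Vr i = {} \<and> Einf \<inter> Er i = {}"
    and disj_r: "\<And>i j. i < m \<Longrightarrow> j < m \<Longrightarrow> i \<noteq> j \<Longrightarrow> Vr i \<inter> Vr j = {} \<and> Er i \<inter> Er j = {}"
    and sub_inf: "is_subgraph (hgraph X) Vinf Einf"
    and sub_r: "\<And>i. i < m \<Longrightarrow> is_subgraph (hgraph X) (Vr i) (Er i)"
    and r_circle: "\<And>i. i < m \<Longrightarrow> subtopology (realization X) (hreal X (Vr i) (Er i)) homeomorphic_space S1"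
    and q_onto: "\<And>i. i < m \<Longrightarrow> q i ` sphere 0 1 = topspace (realization X) \<inter> hreal X (Vr i) (Er i)"
    and cyl_cont: "\<And>i. i < m \<Longrightarrow>
          continuous_map (prod_topology S1 (top_of_set {0..1})) (realization X) (\<Phi> i)"
    and cyl_base: "\<And>i z. i < m \<Longrightarrow> z \<in> sphere 0 1 \<Longrightarrow> \<Phi> i (z, 0) = q i z"
    and cyl_top: "\<And>i z. i < m \<Longrightarrow> z \<in> sphere 0 1 \<Longrightarrow> \<Phi> i (z, 1) \<in> hreal X Vinf Einf"
    and cyl_inj: "\<And>i. i < m \<Longrightarrow> inj_on (\<Phi> i) (sphere 0 1 \<times> {0<..<1})"
    and cyl_off: "\<And>i. i < m \<Longrightarrow>
          \<Phi> i ` (sphere 0 1 \<times> {0<..<1}) \<inter> hreal X (verts (hgraph X)) (edges (hgraph X)) = {}"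
    and cyl_cells: "\<And>i. i < m \<Longrightarrow> \<exists>C \<subseteq> two_cell_index X.
          \<Phi> i ` (sphere 0 1 \<times> {0..1}) = (\<Union>(e, d)\<in>C. two_cell X e d)"
    and cyl_all_cells: "(\<Union>i<m. \<Phi> i ` (sphere 0 1 \<times> {0..1}))
          = (\<Union>(e, d)\<in>two_cell_index X. two_cell X e d)"
begin

lemma subgraph_component:
  assumes sub: "is_subgraph (hgraph X) Vs Es"
    and rest: "\<And>h. h \<in> HE_all \<Longrightarrow> h \<notin> Es \<Longrightarrow> tgt (hgraph X) h \<notin> Vs"
  shows "component Vs Es"
  unfolding component_def
proof (intro conjI ballI)
  show "Vs \<subseteq> HV_all" "Es \<subseteq> HE_all" using sub by (auto simp: is_subgraph_def)
  fix e y assume e: "e \<in> edges U" "y \<in> verts (E e)"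
  then have h: "(e, y) \<in> HE_all" by (simp add: mem_hgraph)
  have t: "tgt (hgraph X) (e, y) = (tgt U e, tv X e y)" and rv: "rv (hgraph X) (e, y) = (rv U e, y)" for e y
    by (simp_all add: hgraph_def)
  show "(e, y) \<in> Es \<longleftrightarrow> (tgt U e, tv X e y) \<in> Vs" using rest[OF h] sub t by (auto simp: is_subgraph_def)
  show "(rv U e, y) \<in> Es \<longleftrightarrow> (e, y) \<in> Es" using sub rv Ud(5)[OF e(1)] unfolding is_subgraph_def by metis
qed

lemma component_inf: "component Vinf Einf"
proof (rule subgraph_component[OF sub_inf])
  fix h assume "h \<in> HE_all" "h \<notin> Einf"
  then obtain i where "i < m" "h \<in> Er i" using part_E by blast
  then show "tgt (hgraph X) h \<notin> Vinf" using sub_r[of i] disj_inf[of i] by (auto simp: is_subgraph_def)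
qed

lemma component_r: assumes i: "i < m" shows "component (Vr i) (Er i)"
proof (rule subgraph_component[OF sub_r[OF i]])
  fix h assume h: "h \<in> HE_all" "h \<notin> Er i"
  show "tgt (hgraph X) h \<notin> Vr i"
  proof (cases "h \<in> Einf")
    case True
    then show ?thesis using sub_inf disj_inf[OF i] by (auto simp: is_subgraph_def)
  next
    case False
    then obtain j where j: "j < m" "h \<in> Er j" using part_E h by blast
    then have "j \<noteq> i" using h by blast
    then show ?thesis using sub_r[OF j(1)] disj_r[OF i j(1)] j(2) by (auto simp: is_subgraph_def)
  qed
qed

lemma component_hreal_mono: "component Vs Es \<Longrightarrow> hreal X Vs Es \<subseteq> hreal X HV_all HE_all"
  unfolding component_def by (intro hreal_mono) auto

text \<open>The centre of a 2-cell is off the horizontal graph, while both boundary circles of a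
  cylinder lie in it; so the centre is hit at an interior parameter. Centres represent the cells
  from here on.\<close>

lemma two_cell_in:
  assumes i: "i < m" and s: "s \<in> squares" and sub: "square_pt s (1 / 2, 1 / 2) \<in> \<Phi> i ` (sphere 0 1 \<times> {0..1})"
  obtains x where "x \<in> sphere 0 1 \<times> {0<..<1}" "\<Phi> i x = square_pt s (1 / 2, 1 / 2)"
proof -
  obtain z t where z: "z \<in> sphere 0 1" "t \<in> {0..1}" "\<Phi> i (z, t) = square_pt s (1 / 2, 1 / 2)" using sub by auto
  have p: "(SQ (fst s) (snd s), (1 / 2, 1 / 2)) \<in> cell_pts" using s by (cases s) (simp add: mem_cell_pts mem_squares)
  then have off: "square_pt s (1 / 2, 1 / 2) \<notin> hreal X HV_all HE_all"
    using in_part_iff[OF component_hgraph p] in_part_hgraph(2)[OF p] by (simp add: square_pt_def)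
  have "t \<noteq> 0" using off z cyl_base[OF i z(1)] q_onto[OF i] component_hreal_mono[OF component_r[OF i]] by blast
  moreover have "t \<noteq> 1" using off z cyl_top[OF i z(1)] component_hreal_mono[OF component_inf] by auto
  ultimately show thesis using that[of "(z, t)"] z by auto
qed

lemma square_pt_two_cell: "(e, d) \<in> squares \<Longrightarrow> square_pt (e, d) (1 / 2, 1 / 2) \<in> two_cell X e d"
  by (auto simp: square_pt_def two_cell_def)

lemma square_in_cylinder:
  assumes s: "s \<in> squares"
  obtains i x where "i < m" "x \<in> sphere 0 1 \<times> {0<..<1}" "\<Phi> i x = square_pt s (1 / 2, 1 / 2)"
proof -
  have "square_pt s (1 / 2, 1 / 2) \<in> (\<Union>(e, d)\<in>squares. two_cell X e d)"
    using s square_pt_two_cell by (cases s) auto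
  then obtain i where "i < m" "square_pt s (1 / 2, 1 / 2) \<in> \<Phi> i ` (sphere 0 1 \<times> {0..1})"
    unfolding cyl_all_cells[symmetric] by blast
  then show thesis using two_cell_in s that by metis
qed

text \<open>A cylinder is a union of closed 2-cells, so one of them contains C and hence touches the
  component; \<open>annulus_touches\<close> passes this on to every square of the cylinder.\<close>

lemma cylinder_touches:
  assumes i: "i < m" and s: "s \<in> squares" and x: "x \<in> sphere 0 1 \<times> {0<..<1}" "\<Phi> i x = square_pt s (1 / 2, 1 / 2)"
    and c: "component Vs Es" and C: "C \<in> hreal X Vs Es" "C \<in> \<Phi> i ` (sphere 0 1 \<times> {0..1})"
  shows "touches Es s"
proof -
  obtain I where I: "I \<subseteq> squares" "\<Phi> i ` (sphere 0 1 \<times> {0..1}) = (\<Union>(e, d)\<in>I. two_cell X e d)"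
    using cyl_cells[OF i] by blast
  then obtain e d where ed: "(e, d) \<in> I" "C \<in> two_cell X e d" using C(2) by auto
  then obtain t r where tr: "0 \<le> t" "t \<le> 1" "0 \<le> r" "r \<le> 1" "C = cls X (SQ e d, (t, r))" by (auto simp: two_cell_def)
  have S: "(e, d) \<in> squares" using ed I by blast
  then have "(SQ e d, (t, r)) \<in> cell_pts" using tr by (simp add: mem_cell_pts mem_squares)
  then have "touches Es (e, d)" using in_part_iff[OF c] C(1) tr(5) by (auto simp: touches_def)
  moreover have "square_pt (e, d) (1 / 2, 1 / 2) \<in> \<Phi> i ` (sphere 0 1 \<times> {0..1})"
    unfolding I(2) using square_pt_two_cell[OF S] ed(1) by blast
  then obtain x' where "x' \<in> sphere 0 1 \<times> {0<..<1}" "\<Phi> i x' = square_pt (e, d) (1 / 2, 1 / 2)"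
    using two_cell_in[OF i S] by blast
  ultimately show ?thesis using annulus_touches[OF c cyl_cont[OF i] cyl_off[OF i]] S s x by blast
qed

text \<open>The cylinder of the square reaches the large component at its top and a circle at its
  base, so the square touches both; having only two horizontal sides, it has one in each.\<close>

lemma square_sides:
  assumes ed: "e \<in> edges U" "d \<in> edges (E e)"
  shows "(e, tgt (E e) d) \<in> Einf \<longleftrightarrow> (e, src (E e) d) \<notin> Einf"
proof -
  have s: "(e, d) \<in> squares" using ed by (simp add: mem_squares)
  obtain i x where i: "i < m" and x: "x \<in> sphere 0 1 \<times> {0<..<1}" "\<Phi> i x = square_pt (e, d) (1 / 2, 1 / 2)"
    using square_in_cylinder[OF s] by blast
  have "touches Einf (e, d)"
    by (rule cylinder_touches[OF i s x component_inf, of "\<Phi> i (1, 1)"]) (use cyl_top[OF i, of 1] in auto)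
  moreover have "touches (Er i) (e, d)"
  proof (rule cylinder_touches[OF i s x component_r[OF i], of "\<Phi> i (1, 0)"])
    show "\<Phi> i (1, 0) \<in> hreal X (Vr i) (Er i)" using cyl_base[OF i, of 1] q_onto[OF i] by auto
  qed auto
  ultimately show ?thesis using disj_inf[OF i] by (auto simp: touches_def)
qed

lemma r_vertex:
  assumes v: "v \<in> verts U" "x \<in> verts (V v)" "(v, x) \<notin> Vinf"
  obtains i where "i < m" "(v, x) \<in> Vr i"
  using assms part_V by (auto simp: mem_hgraph)

text \<open>The covering is onto, so the vertex lies on the base of a cylinder and therefore in a
  closed 2-cell; \<open>over\<close> finds the corner of that cell at the vertex.\<close>

lemma r_vertex_edge:
  assumes v: "v \<in> verts U" "x \<in> verts (V v)" "(v, x) \<notin> Vinf"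
  shows "\<exists>\<epsilon>\<in>edges (V v). src (V v) \<epsilon> = x"
proof -
  obtain i where i: "i < m" "(v, x) \<in> Vr i" using r_vertex[OF v] by blast
  let ?C = "cls X (VV v x, (0, 0))"
  have p: "(VV v x, (0, 0)) \<in> cell_pts" using v by (simp add: mem_cell_pts)
  have "?C \<in> topspace (realization X) \<inter> hreal X (Vr i) (Er i)"
    using in_part_iff[OF component_r[OF i(1)] p] i(2) p by (simp add: topspace_realization)
  then obtain z where z: "z \<in> sphere 0 1" "?C = q i z" unfolding q_onto[OF i(1), symmetric] by (rule imageE)
  then have "?C = \<Phi> i (z, 0)" using cyl_base[OF i(1) z(1)] by simp
  then have "?C \<in> \<Phi> i ` (sphere 0 1 \<times> {0..1})" using z(1) by (intro image_eqI[of _ _ "(z, 0)"]) auto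
  then have "?C \<in> (\<Union>j<m. \<Phi> j ` (sphere 0 1 \<times> {0..1}))" using i(1) by blast
  then obtain e d t r where ed: "(e, d) \<in> squares" "?C = cls X (SQ e d, (t, r))"
    unfolding cyl_all_cells by (auto simp: two_cell_def)
  have e: "e \<in> edges U" "d \<in> edges (E e)" using ed by (auto simp: mem_squares)
  have "over v x (VV v x, (0, 0)) = over v x (SQ e d, (t, r))" by (rule cls_eqD[OF over_glue ed(2) p])
  then have "over v x (SQ e d, (t, r))" by simp
  then obtain y f where y: "y = tgt (E e) d \<or> y = src (E e) d" "f = e \<or> f = rv U e" "(f, y) \<in> half v x" by auto
  then have f: "f \<in> edges U" "d \<in> edges (E f)" "E f = E e" "tgt U f = v" "tv X f y = x"
    using e Ud(3) E_rv by (auto simp: half_def)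
  obtain \<epsilon> where "\<epsilon> \<in> edges (V v)" "tgt (V v) \<epsilon> = x \<or> src (V v) \<epsilon> = x"
    using tau(2,4,5)[OF f(1,2)] f y(1) by auto
  then show ?thesis using Vd(3,9)[OF v(1)] by metis
qed

text \<open>Three half-edges would be three arms in a circle that meet only in their common end
  point.\<close>

lemma r_vertex_valence:
  assumes v: "v \<in> verts U" "x \<in> verts (V v)" "(v, x) \<notin> Vinf"
  shows "card (half v x) \<le> 2"
proof (rule ccontr)
  assume "\<not> card (half v x) \<le> 2"
  then have "3 \<le> card (half v x)" by simp
  then obtain H where H: "H \<subseteq> half v x" "card H = 3" by (meson obtain_subset_with_card_n)
  then obtain h where h: "bij_betw h {0..<3::nat} H"
    using ex_bij_betw_nat_finite[of H] card.infinite by fastforce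
  have hh: "h k \<in> half v x" if "k < 3" for k
    using bij_betwE[OF h] that H(1) by auto
  have hd: "h k \<noteq> h l" if "k < 3" "l < 3" "k \<noteq> l" for k l
    using bij_betw_imp_inj_on[OF h] that by (auto simp: inj_on_def)
  obtain i where i: "i < m" "(v, x) \<in> Vr i" using r_vertex[OF v] by blast
  let ?R = "subtopology (realization X) (hreal X (Vr i) (Er i))"
  have hE: "h k \<in> HE_all" "h k \<in> Er i" "tgt (hgraph X) (h k) = (v, x)" if "k < 3" for k
    using hh[OF that] i(2) component(1)[OF component_r[OF i(1)], of "fst (h k)" "snd (h k)"]
    by (auto simp: half_def mem_hgraph) (auto simp: hgraph_def)
  obtain f g where "homeomorphic_maps ?R S1 f g" using r_circle[OF i(1)] by (auto simp: homeomorphic_space_def)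
  then have f: "continuous_map ?R S1 f" "\<And>C. C \<in> topspace ?R \<Longrightarrow> g (f C) = C" by (auto simp: homeomorphic_maps_def)
  have hp: "edge_pt (h k) s \<in> hreal X (Vr i) (Er i)" if "k < 3" "s \<in> {0..1}" for k s
  proof -
    have "(HE (fst (h k)) (snd (h k)), (s, 0)) \<in> cell_pts" using hE(1)[OF that(1)] that(2) by (cases "h k") (simp add: mem_cell_pts mem_hgraph)
    from in_part_iff[OF component_r[OF i(1)] this] show ?thesis using hE(2)[OF that(1)] by (simp add: edge_pt_def)
  qed
  have hc: "continuous_map (top_of_set {0..1}) ?R (edge_pt (h k))" if "k < 3" for k
    using continuous_map_edge_pt[OF hE(1)[OF that]] hp[OF that] by (auto simp: continuous_map_in_subtopology)
  have fc: "continuous_map (top_of_set {0..1}) S1 (\<lambda>s. f (edge_pt (h k) s))" if "k < 3" for k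
    using continuous_map_compose[OF hc[OF that] f(1)] by (simp add: o_def)
  have ht: "edge_pt (h k) s \<in> topspace ?R" if "k < 3" "s \<in> {0..1}" for k s
    using hc[OF that(1)] that(2) by (auto simp: continuous_map_def)
  show False
  \<comment> \<open>Starting at 3/4 keeps the arms inside the terminal halves of the edges, which
    are disjoint before their ends even for the two labels of one loop.\<close>
  proof (rule no_tripod_in_circle[of "3 / 4" "\<lambda>k s. f (edge_pt (h k) s)" "f (cls X (VV v x, (0, 0)))"])
    fix k :: nat assume k: "k < 3"
    show "continuous_on {3 / 4..1} (\<lambda>s. f (edge_pt (h k) s))"
      using fc[OF k] by (auto elim!: continuous_on_subset)
    show "f (edge_pt (h k) s) \<in> sphere 0 1" if "s \<in> {3 / 4..1}" for s
      using fc[OF k] that by (auto simp: continuous_map_def)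
    show "f (edge_pt (h k) 1) = f (cls X (VV v x, (0, 0)))" using edge_pt_1[OF hE(1)[OF k]] hE(3)[OF k] by simp
    fix l :: nat and s t :: real
    assume l: "l < 3" "k \<noteq> l" and s: "s \<in> {3 / 4..<1}" and t: "t \<in> {3 / 4..1}"
    show "f (edge_pt (h k) s) \<noteq> f (edge_pt (h l) t)"
    proof
      assume "f (edge_pt (h k) s) = f (edge_pt (h l) t)"
      moreover have "g (f (edge_pt (h k) s)) = edge_pt (h k) s" by (rule f(2)[OF ht[OF k]]) (use s in simp)
      moreover have "g (f (edge_pt (h l) t)) = edge_pt (h l) t" by (rule f(2)[OF ht[OF l(1)]]) (use t in simp)
      ultimately have "edge_pt (h k) s = edge_pt (h l) t" by metis
      then have "h l = h k"
        using edge_pt_inj[of "fst (h k)" "snd (h k)" "h l" s t, unfolded prod.collapse, OF hE(1)[OF k] hE(1)[OF l(1)]] s t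
        by simp
      then show False using hd[OF k l] by simp
    qed
  qed simp
qed

lemma bip: "bip X Vinf Einf"
proof
  show "Vinf \<subseteq> HV_all" "Einf \<subseteq> HE_all" using part_V part_E by auto
qed (use component[OF component_inf] square_sides r_vertex_valence r_vertex_edge in \<open>auto simp: half_def\<close>)

end

section \<open>Conclusion\<close>

lemma periodic_gcd:
  fixes f :: "nat \<Rightarrow> 'x"
  assumes "\<And>j. f (j + a) = f j" "\<And>j. f (j + b) = f j" "a \<noteq> 0"
  shows "f (j + gcd a b) = f j"
proof -
  have mult: "f (j + c * x) = f j" if "\<And>j. f (j + c) = f j" for c x j
    by (induction x arbitrary: j) (simp_all add: that add.assoc[symmetric])
  obtain x y where "a * x = b * y + gcd a b" using bezout_nat[OF assms(3)] by blast
  then have "f (j + gcd a b) = f (j + a * x)"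
    using mult[OF assms(2), of "j + gcd a b" y] by (simp add: ac_simps)
  then show ?thesis using mult[OF assms(1)] by simp
qed

context bip
begin

text \<open>Backtracking would make the square and its partner two lifts of one vertical edge with
  the same end in the same edge space, against local injectivity.\<close>

lemma word_reduced: assumes s: "s \<in> squares" shows "head_edge (advance s) \<noteq> (rv U (fst (head_edge s)), snd (head_edge s))"
proof
  assume eq: "head_edge (advance s) = (rv U (fst (head_edge s)), snd (head_edge s))"
  obtain e d e' d' where k: "s = (e, d)" "partner s = (e', d')" by fastforce
  have e: "e \<in> edges U" "d \<in> edges (E e)" "e' \<in> edges U" "d' \<in> edges (E e')" "te X e' d' = te X e d"
    using s partner[OF s] k by (auto simp: mem_squares)
  have "rv U e' = rv U e" "tgt (E e') d' = tgt (E e) d"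
    using eq s k e E_rv by (auto simp: head_edge_def advance_def reverse_def)
  then have "e' = e" "tgt (E e') d' = tgt (E e) d" using Ud(5) e by metis+
  then have "partner s = s" using te_inj[OF e(1)] e k by simp
  then show False using pre_partner(2)[OF s] by simp
qed

text \<open>A word equal to its reverse would be reflected about an edge or a vertex, hence invert an
edge or backtrack.\<close>

lemma word_not_reversed:
  assumes s: "s \<in> upward" "s' \<in> upward" and j: "reverse s' = (advance ^^ j) s" and w: "word s = word s'"
  shows False
proof -
  note sS = upward_squares[OF s(1)] upward_squares[OF s(2)]
  have rev: "word s l = (rv U (fst (word s (j - l))), snd (word s (j - l)))" if l: "l \<le> j" for l
  proof -
    let ?u = "(advance ^^ (j - l)) s"
    have u: "?u \<in> squares" using sS by (simp add: advance_pow_squares)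
    have "s' = reverse ((advance ^^ l) ?u)"
      using reverse(2)[OF sS(2)] j l by (metis comp_apply funpow_add le_add_diff_inverse)
    then have "(advance ^^ l) s' = reverse ?u" using reverse_advance_pow[OF u] by simp
    then have "word s l = head_edge (reverse ?u)" using w by (simp add: word_def fun_eq_iff)
    then show ?thesis using u E_rv by (cases ?u) (auto simp: word_def head_edge_def reverse_def mem_squares)
  qed
  have we: "fst (word s l) \<in> edges U" for l
    using advance_pow_squares[of l s] sS(1) by (cases "(advance ^^ l) s") (auto simp: word_def head_edge_def mem_squares)
  define l where "l = j div 2"
  have "j = l + l \<or> j = l + Suc l" by (auto simp: l_def)
  then show False
  proof
    assume "j = l + l"
    then have "word s l = (rv U (fst (word s l)), snd (word s l))" using rev[of l] by simp
    then show False using Ud(4)[OF we[of l]] by (metis fst_conv)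
  next
    assume "j = l + Suc l"
    then have "word s (Suc l) = (rv U (fst (word s l)), snd (word s l))" using rev[of "Suc l"] by simp
    then show False using word_reduced[of "(advance ^^ l) s"] sS(1) by (simp add: word_def advance_pow_squares)
  qed
qed

text \<open>For k = 0 the loop would be a 0-th power. A period p of the word yields the period g =
  gcd of \<open>period s\<close> and p, and the loop is then a power of the loop of length g, with
  exponent k times \<open>period s\<close> / g; indivisibility forces g =
  \<open>period s\<close>.\<close>

lemma indivisible_word:
  assumes s: "s \<in> upward" and k: "k \<in> {-1, 0, 1}"
    and h: "homotopic_with (\<lambda>_. True) S1 (subtopology (realization X) (hreal X VA EA)) c
       (\<lambda>z. loop (word s) (period s) (z powi k))"
    and indiv: "indivisible_loop (subtopology (realization X) (hreal X VA EA)) c"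
  shows "k \<noteq> 0" and "\<And>p. (\<And>j. word s (j + p) = word s j) \<Longrightarrow> period s dvd p"
proof -
  let ?Y = "subtopology (realization X) (hreal X VA EA)"
  have n0: "period s \<noteq> 0" using period(1)[OF upward_squares[OF s]] by simp
  have cont: "continuous_map S1 ?Y (loop (word s) p)" if "\<And>j. word s (j + p) = word s j" for p
    by (rule continuous_map_from_subtopology_mono[OF continuous_map_loop[OF hword_word[OF s] that]]) auto
  have ind: "k' = 1 \<or> k' = -1"
    if "\<And>j. word s (j + p) = word s j" "homotopic_with (\<lambda>_. True) S1 ?Y c (\<lambda>z. loop (word s) p (z powi k'))" for p k'
    using indiv cont[OF that(1)] that(2) unfolding indivisible_loop_def freely_homotopic_def by blast
  show k0: "k \<noteq> 0" using ind[OF word_period[OF s] h] by auto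
  fix p assume p: "\<And>j. word s (j + p) = word s j"
  define g where "g = gcd (period s) p"
  have g: "word s (j + g) = word s j" for j
    unfolding g_def by (rule periodic_gcd[OF word_period[OF s] p n0])
  obtain b where b: "period s = b * g" by (metis dvd_div_mult_self g_def gcd_dvd1)
  have "homotopic_with (\<lambda>_. True) S1 ?Y c (\<lambda>z. loop (word s) g (z powi (k * int b)))"
  proof (rule homotopic_with_eq[OF h])
    fix z :: complex assume "z \<in> topspace S1"
    then have z: "z powi k \<in> sphere 0 1" by (simp add: norm_power_int)
    have "loop (word s) g (z powi (k * int b)) = loop (word s) g ((z powi k) ^ b)"
      by (simp add: power_int_mult)
    also have "\<dots> = loop (word s) (period s) (z powi k)"
      unfolding b by (rule loop_power[where f = "word s" and n = g, OF g z, symmetric])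
    finally show "loop (word s) g (z powi (k * int b)) = loop (word s) (period s) (z powi k)" .
  qed simp_all
  then have "k * int b = 1 \<or> k * int b = -1" by (rule ind[OF g])
  then have "b = 1" using k by auto
  then show "period s dvd p" using b by (simp add: g_def) (metis gcd_dvd2)
qed

end

theorem theorem2p1:
  fixes X :: "('a, 'b, 'c, 'd) gspaces"
    and Vinf :: "('a \<times> 'c) set" and Einf :: "('b \<times> 'c) set"
    and m :: nat and Vr :: "nat \<Rightarrow> ('a \<times> 'c) set" and Er :: "nat \<Rightarrow> ('b \<times> 'c) set"
    and k :: "nat \<Rightarrow> nat"
    and q :: "nat \<Rightarrow> complex \<Rightarrow> ('a, 'b, 'c, 'd) pt set"
    and \<Phi> :: "nat \<Rightarrow> complex \<times> real \<Rightarrow> ('a, 'b, 'c, 'd) pt set"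
  assumes X: "two_covered X"
    and part_V: "verts (hgraph X) = Vinf \<union> (\<Union>i<m. Vr i)"
    and part_E: "edges (hgraph X) = Einf \<union> (\<Union>i<m. Er i)"
    and disj_inf: "\<And>i. i < m \<Longrightarrow> Vinf \<inter> Vr i = {} \<and> Einf \<inter> Er i = {}"
    and disj_r: "\<And>i j. i < m \<Longrightarrow> j < m \<Longrightarrow> i \<noteq> j \<Longrightarrow> Vr i \<inter> Vr j = {} \<and> Er i \<inter> Er j = {}"
    and sub_inf: "is_subgraph (hgraph X) Vinf Einf"
    and sub_r: "\<And>i. i < m \<Longrightarrow> is_subgraph (hgraph X) (Vr i) (Er i)"
    and conn_inf: "connected_graph (subg (hgraph X) Vinf Einf)"
    and not_circle: "\<not> (subtopology (realization X) (hreal X Vinf Einf) homeomorphic_space S1)"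
    and r_circle: "\<And>i. i < m \<Longrightarrow> subtopology (realization X) (hreal X (Vr i) (Er i)) homeomorphic_space S1"
    and k_ge: "\<And>i. i < m \<Longrightarrow> 2 \<le> k i"
    and cover: "\<And>i. i < m \<Longrightarrow>
          k_fold_covering (k i) S1 (subtopology (realization X) (hreal X (Vr i) (Er i))) (q i)"
    and cyl_cont: "\<And>i. i < m \<Longrightarrow>
          continuous_map (prod_topology S1 (top_of_set {0..1})) (realization X) (\<Phi> i)"
    and cyl_base: "\<And>i z. i < m \<Longrightarrow> z \<in> sphere 0 1 \<Longrightarrow> \<Phi> i (z, 0) = q i z"
    and cyl_top: "\<And>i. i < m \<Longrightarrow>
          circle_immersion (subtopology (realization X) (hreal X Vinf Einf)) (\<lambda>z. \<Phi> i (z, 1))"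
    and cyl_inj: "\<And>i. i < m \<Longrightarrow> inj_on (\<Phi> i) (sphere 0 1 \<times> {0<..<1})"
    and cyl_off: "\<And>i. i < m \<Longrightarrow>
          \<Phi> i ` (sphere 0 1 \<times> {0<..<1}) \<inter> hreal X (verts (hgraph X)) (edges (hgraph X)) = {}"
    and cyl_disj: "\<And>i j. i < m \<Longrightarrow> j < m \<Longrightarrow> i \<noteq> j \<Longrightarrow>
          \<Phi> i ` (sphere 0 1 \<times> {0<..<1}) \<inter> \<Phi> j ` (sphere 0 1 \<times> {0<..<1}) = {}"
    and cyl_cells: "\<And>i. i < m \<Longrightarrow> \<exists>C \<subseteq> two_cell_index X.
          \<Phi> i ` (sphere 0 1 \<times> {0..1}) = (\<Union>(e, d)\<in>C. two_cell X e d)"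
    and cyl_all_cells: "(\<Union>i<m. \<Phi> i ` (sphere 0 1 \<times> {0..1}))
          = (\<Union>(e, d)\<in>two_cell_index X. two_cell X e d)"
    and cyl_cover: "topspace (realization X)
          = hreal X (verts (hgraph X)) (edges (hgraph X)) \<union> (\<Union>i<m. \<Phi> i ` (sphere 0 1 \<times> {0..1}))"
    and indiv: "\<And>i. i < m \<Longrightarrow>
          indivisible_loop (subtopology (realization X) (hreal X Vinf Einf)) (\<lambda>z. \<Phi> i (z, 1))"
    and nonconj: "\<And>i j. i < m \<Longrightarrow> j < m \<Longrightarrow> i \<noteq> j \<Longrightarrow>
          \<not> freely_homotopic (subtopology (realization X) (hreal X Vinf Einf))
               (\<lambda>z. \<Phi> i (z, 1)) (\<lambda>z. \<Phi> j (z, 1))"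
    and nonconj_inv: "\<And>i j. i < m \<Longrightarrow> j < m \<Longrightarrow> i \<noteq> j \<Longrightarrow>
          \<not> freely_homotopic (subtopology (realization X) (hreal X Vinf Einf))
               (\<lambda>z. \<Phi> i (z, 1)) (\<lambda>z. \<Phi> j (cnj z, 1))"
    and euler: "chi (hgraph X) = chi (UG X)"
  shows "\<forall>e\<in>edges (UG X). is_tree (ES X e)"
proof (rule ccontr)
  let ?Y = "subtopology (realization X) (hreal X Vinf Einf)"
  let ?c = "\<lambda>i z. \<Phi> i (z, 1)"
  interpret cylinders X Vinf Einf m Vr Er q \<Phi>
  proof
    show "two_covered X" by (rule X)
    fix i assume i: "i < m"
    show "q i ` sphere 0 1 = topspace (realization X) \<inter> hreal X (Vr i) (Er i)"
      using cover[OF i] by (simp add: k_fold_covering_def)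
    fix z :: complex assume "z \<in> sphere 0 1"
    then show "\<Phi> i (z, 1) \<in> hreal X Vinf Einf"
      using cyl_top[OF i] by (auto simp: circle_immersion_def continuous_map_def)
  qed (fact part_V part_E disj_inf disj_r sub_inf sub_r r_circle cyl_cont cyl_base cyl_inj cyl_off
      cyl_cells cyl_all_cells)+
  interpret b: bip X Vinf Einf by (rule bip)
  interpret b: bip_tight X Vinf Einf by unfold_locales (rule euler)
  assume "\<not> (\<forall>e\<in>edges (UG X). is_tree (ES X e))"
  then obtain e where "e \<in> edges (UG X)" "\<not> is_tree (ES X e)" by blast
  then obtain s s' where s: "s \<in> b.upward" "s' \<in> b.upward" "s \<noteq> s'"
    and "\<And>j. head_edge ((advance ^^ j) s) = head_edge ((advance ^^ j) s')" using b.parallel_squares by metis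
  then have w: "b.word s = b.word s'" by (simp add: fun_eq_iff b.word_def)
  \<comment> \<open>Besides the degree, the last clause records that all upward squares in the
    cylinder of \<open>s\<close> belong to its strip, up to reversal; it decides the case where
    \<open>s'\<close> lies in the same cylinder.\<close>
  have cyl: "\<exists>i<m. \<exists>x\<in>sphere 0 1 \<times> {0<..<1}. \<exists>k::int. \<Phi> i x = square_pt s (1 / 2, 1 / 2) \<and> k \<in> {-1, 0, 1} \<and>
      homotopic_with (\<lambda>_. True) S1 ?Y (?c i) (\<lambda>z. loop (b.word s) (period s) (z powi k)) \<and>
      (\<forall>s'\<in>b.upward. \<forall>x'\<in>sphere 0 1 \<times> {0<..<1}. \<Phi> i x' = square_pt s' (1 / 2, 1 / 2) \<longrightarrow>
         (\<exists>j. s' = (advance ^^ j) s \<or> reverse s' = (advance ^^ j) s))" if s: "s \<in> b.upward" for s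
  proof -
    obtain i x where i: "i < m" and x: "x \<in> sphere 0 1 \<times> {0<..<1}" "\<Phi> i x = square_pt s (1 / 2, 1 / 2)"
      using square_in_cylinder[OF b.upward_squares[OF s]] by blast
    obtain z0 t0 where zt: "x = (z0, t0)" by (cases x)
    have m: "z0 \<in> sphere 0 1" "0 < t0" "t0 < 1" "\<Phi> i (z0, t0) = square_pt s (1 / 2, 1 / 2)"
      "0 < (1 / 2 :: real)" "1 / 2 < (1 :: real)" "0 \<le> (1 / 2 :: real)" "1 / 2 \<le> (1 :: real)"
      using x zt by auto
    have top: "\<Phi> i (z, 1) \<in> hreal X Vinf Einf" if "z \<in> sphere 0 1" for z
      using cyl_top[OF i] that by (auto simp: circle_immersion_def continuous_map_def)
    obtain k :: int where k: "k \<in> {-1, 0, 1}"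
      "homotopic_with (\<lambda>_. True) S1 ?Y (?c i) (\<lambda>z. loop (b.word s) (period s) (z powi k))"
      "\<And>x z t. x \<in> b.upward \<Longrightarrow> z \<in> sphere 0 1 \<Longrightarrow> 0 < t \<Longrightarrow> t < 1 \<Longrightarrow> \<Phi> i (z, t) = square_pt x (1 / 2, 1 / 2) \<Longrightarrow>
         \<exists>j. x = (advance ^^ j) s \<or> reverse x = (advance ^^ j) s"
      using b.annulus_homotopy[OF s cyl_cont[OF i] top cyl_inj[OF i] cyl_off[OF i] m] by metis
    have "\<forall>s'\<in>b.upward. \<forall>x'\<in>sphere 0 1 \<times> {0<..<1}. \<Phi> i x' = square_pt s' (1 / 2, 1 / 2) \<longrightarrow>
         (\<exists>j. s' = (advance ^^ j) s \<or> reverse s' = (advance ^^ j) s)"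
    proof (intro ballI impI)
      fix s' and x' :: "complex \<times> real"
      assume "s' \<in> b.upward" "x' \<in> sphere 0 1 \<times> {0<..<1}" "\<Phi> i x' = square_pt s' (1 / 2, 1 / 2)"
      then show "\<exists>j. s' = (advance ^^ j) s \<or> reverse s' = (advance ^^ j) s"
        using k(3)[of s' "fst x'" "snd x'"] by (cases x') simp
    qed
    then show ?thesis using i x k(1,2) by blast
  qed
  obtain i x k1 where i: "i < m" and k1: "k1 \<in> {-1, 0, 1 :: int}"
    "homotopic_with (\<lambda>_. True) S1 ?Y (?c i) (\<lambda>z. loop (b.word s) (period s) (z powi k1))"
    and orb: "\<And>u x'. u \<in> b.upward \<Longrightarrow> x' \<in> sphere 0 1 \<times> {0<..<1} \<Longrightarrow> \<Phi> i x' = square_pt u (1 / 2, 1 / 2) \<Longrightarrow>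
         \<exists>j. u = (advance ^^ j) s \<or> reverse u = (advance ^^ j) s"
    using cyl[OF s(1)] by blast
  obtain i' x' k2 where i': "i' < m" and x': "x' \<in> sphere 0 1 \<times> {0<..<1}" "\<Phi> i' x' = square_pt s' (1 / 2, 1 / 2)"
    and k2: "k2 \<in> {-1, 0, 1 :: int}"
    "homotopic_with (\<lambda>_. True) S1 ?Y (?c i') (\<lambda>z. loop (b.word s') (period s') (z powi k2))"
    using cyl[OF s(2)] by blast
  note ind1 = b.indivisible_word[OF s(1) k1 indiv[OF i]] and ind2 = b.indivisible_word[OF s(2) k2 indiv[OF i']]
  have "period s dvd period s'" by (rule ind1(2)) (use w b.word_period[OF s(2)] in simp)
  moreover have "period s' dvd period s" by (rule ind2(2)) (use w b.word_period[OF s(1)] in simp)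
  ultimately have per: "period s' = period s" by (simp add: dvd_antisym)
  define l where "l = loop (b.word s) (period s)"
  have h1: "homotopic_with (\<lambda>_. True) S1 ?Y (?c i) (\<lambda>z. l (z powi k1))" using k1(2) by (simp add: l_def)
  have h2: "homotopic_with (\<lambda>_. True) S1 ?Y (?c i') (\<lambda>z. l (z powi k2))" using k2(2) w per by (simp add: l_def)
  show False
  proof (cases "i = i'")
    case True
    then obtain j where "s' = (advance ^^ j) s \<or> reverse s' = (advance ^^ j) s" using orb[OF s(2) x'(1)] x'(2) by auto
    then show False
    proof
      assume j: "s' = (advance ^^ j) s"
      \<comment> \<open>A shift of the strip by j that preserves the word is a multiple of the
        period, so it fixes \<open>s\<close>.\<close>
      have "b.word s (a + j) = b.word s a" for a
        using w j by (simp add: fun_eq_iff b.word_def funpow_add)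
      then have "period s dvd j" by (rule ind1(2))
      then have "(advance ^^ j) s = (advance ^^ 0) s" using advance_pow_eq[OF b.upward_squares[OF s(1)], of j 0] by (simp only: mod_0 dvd_eq_mod_eq_0)
      then show False using j s(3) by simp
    qed (use b.word_not_reversed[OF s(1,2) _ w] in blast)
  next
    case False
    show False
    proof (cases "k1 = k2")
      case True
      then have "homotopic_with (\<lambda>_. True) S1 ?Y (?c i) (?c i')"
        using h1 h2 homotopic_with_trans homotopic_with_symD by blast
      then show False using nonconj[OF i i' False] by (simp add: freely_homotopic_def)
    next
      case neq: False
      \<comment> \<open>Both exponents are 1 or -1, so they are opposite; conjugation is inversion
        on the circle and absorbs the sign.\<close>
      then have k: "k1 = - k2" using k1(1) k2(1) ind1(1) ind2(1) by auto
      have "continuous_map S1 S1 cnj" by (auto intro!: continuous_intros)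
      from homotopic_with_compose_continuous_map_right[OF h2 this, of "\<lambda>_. True"]
      have "homotopic_with (\<lambda>_. True) S1 ?Y (\<lambda>z. \<Phi> i' (cnj z, 1)) (\<lambda>z. l (cnj z powi k2))" by (simp add: o_def)
      then have "homotopic_with (\<lambda>_. True) S1 ?Y (\<lambda>z. \<Phi> i' (cnj z, 1)) (\<lambda>z. l (z powi k1))"
      proof (rule homotopic_with_eq)
        fix z :: complex assume "z \<in> topspace S1"
        then have "z * cnj z = 1" using complex_norm_square[of z] by simp
        then have "cnj z = inverse z" by (rule inverse_unique[symmetric])
        then show "l (z powi k1) = l (cnj z powi k2)" by (simp add: k power_int_minus power_int_inverse)
      qed simp_all
      then have "homotopic_with (\<lambda>_. True) S1 ?Y (?c i) (\<lambda>z. \<Phi> i' (cnj z, 1))"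
        using h1 homotopic_with_trans homotopic_with_symD by blast
      then show False using nonconj_inv[OF i i' False] by (simp add: freely_homotopic_def)
    qed
  qed
qed

end
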